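(* Let $k\ge4$ be a fixed integer and let $j,\ell$ be integers with $1\le j\le\ell$ and $\gcd(j,\ell)=1$. Then, as $x\to\infty$, $$\sum_{\substack{2\le n\le x\\ p_1(n)\equiv j\ (\mathrm{mod}\ \ell)}}\mu(n)\omega(n)^{k-1}\left[\frac{x}{n}\right]\ll\frac{x(\log\log x)^{k}}{\log x}.$$
   Context: $\mu$ is the Möbius function, $\omega(n)$ the number of distinct prime factors of $n$, $p_1(n)$ the smallest prime factor of $n\ge2$, and $[w]$ the integer part of $w$. Implied constants may depend on $k$ and $\ell$. *)

theory Defs
  imports Complex_Main "HOL-Number_Theory.Number_Theory" "HOL-Computational_Algebra.Squarefree"
begin

definition moebius_mu :: "nat \<Rightarrow> int" where
  "moebius_mu n = (if squarefree n then (-1) ^ card (prime_factors n) else 0)"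

definition omega :: "nat \<Rightarrow> nat" where
  "omega n = card (prime_factors n)"

text \<open>Only meaningful for \<open>n \<ge> 2\<close>; otherwise the set of prime factors is empty.\<close>

definition smallest_prime_factor :: "nat \<Rightarrow> nat" where
  "smallest_prime_factor n = Min (prime_factors n)"

end

theory Submission
  imports Defs "HOL-Number_Theory.Prime_Powers" "HOL-Analysis.Analysis" "HOL-Real_Asymp.Real_Asymp"
begin

text \<open>
  Alladi's duality turns the sum into \<open>\<Sum>s<k. c s * card {m \<in> {1..N}. q s m \<equiv> j}\<close>, where
  \<open>q s m\<close> is the \<open>(s + 1)\<close>-st largest prime factor of \<open>m\<close>. Taking finite differences of
  \<open>t ^ (k - 1)\<close> shows that \<open>c s = 0\<close> for \<open>s \<ge> k\<close> and that the \<open>c s\<close> add up to \<open>0\<close>. Hence it suffices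
  that, for each \<open>s < k\<close>, the proportion of \<open>m\<close> with \<open>q s m \<equiv> j\<close> is the same number \<open>\<alpha>\<close> up to an
  admissible error. Since the value of \<open>\<alpha>\<close> is irrelevant, the only input about primes in progressions
  is that \<open>\<Sum>p\<le>N, p \<equiv> j. ln p / p = \<alpha> * ln N + O(1)\<close> for some \<open>\<alpha>\<close>. For this the characters \<open>\<psi>\<close> with
  \<open>L(1, \<psi>) = 0\<close> need not be excluded: they would contribute \<open>- ln N + O(1)\<close>.

  Let \<open>w p\<close> be \<open>1 - \<alpha>\<close> if \<open>p \<equiv> j\<close> and \<open>- \<alpha>\<close> otherwise. The sum of \<open>w\<close> over the largest prime
  factors of the \<open>m \<le> y\<close> is estimated as follows. Those \<open>m\<close> without prime factors above
  \<open>T = exp (ln y / (2 * ln (ln y)))\<close> are negligible. By duality, the others give the sum of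
  \<open>- w(p) \<mu>(n) [y / n]\<close> over the \<open>n\<close> with smallest prime factor \<open>p > T\<close>. There are only
  \<open>O(y / ln T)\<close> such \<open>n\<close>, so \<open>[y / n]\<close> may be replaced by \<open>y / n\<close>, after which partial summation in
  \<open>p\<close> applies. Splitting off the \<open>s\<close> largest primes of \<open>m\<close> reduces \<open>q s\<close> to the case \<open>s = 0\<close>.
\<close>

section \<open>Chebyshev and Mertens estimates\<close>

text \<open>The saving of a full \<open>ln x\<close> is not contained in Mertens' estimate itself,
  whose error O(1) is only small compared with \<open>ln N\<close>. It comes from partial summation
  against \<open>1 / ln p\<close> over primes \<open>p > T\<close>, which turns that error into O(1
  / ln T). The price is that the other factor, a Moebius sum of \<open>1 / d\<close> over the
  \<open>d <= y / p\<close> without prime factors up to \<open>p\<close>, must have small variation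
  in \<open>p\<close> when weighted by \<open>1 / ln p\<close>; pointwise boundedness would not do.
  The size of \<open>T\<close> balances two demands: Rankin's saving of two powers of
  \<open>ln y\<close> must leave O(y / ln y) smooth numbers in spite of an Euler product of size
  about \<open>ln T\<close>, and \<open>ln T\<close> should be as close to \<open>ln y\<close> as
  possible. This costs one factor \<open>ln (ln y)\<close>. Each of the \<open>s <= k - 1\<close>
  larger primes costs at most one more, which accounts for the power \<open>k\<close>. Finally
  \<alpha> drops out because its coefficients cancel on every \<open>m\<close> with at least
  \<open>k\<close> prime factors, and the other \<open>m\<close> are rare enough.\<close>

lemma real_nat_div_le: "real (n div d) \<le> real n / real d"
  using floor_divide_of_nat_eq[of n d, where ?'a = real] of_int_floor_le[of "real n / real d"] by simp

lemma real_div_nat_less: "real n / real d < real (n div d) + 1"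
  using floor_divide_of_nat_eq[of n d, where ?'a = real] floor_correct[of "real n / real d"] by simp

text \<open>The summand sees the divisor and its cofactor separately, so this one interchange serves
  all convolutions below; an ignored argument of \<open>F\<close> gives a plain divisor sum.\<close>

lemma sum_divisors_swap:
  fixes F :: "nat \<Rightarrow> nat \<Rightarrow> 'a::comm_monoid_add"
  shows "(\<Sum>n=1..N. \<Sum>d | d dvd n. F d (n div d)) = (\<Sum>d=1..N. \<Sum>m=1..N div d. F d m)"
proof -
  have "(\<Sum>n=1..N. \<Sum>d | d dvd n. F d (n div d)) =
      (\<Sum>(n,d)\<in>(SIGMA n:{1..N}. {d. d dvd n}). F d (n div d))"
    by (subst sum.Sigma) auto
  also have "\<dots> = (\<Sum>(d,m)\<in>(SIGMA d:{1..N}. {1..N div d}). F d m)"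
  proof -
    have *: "b \<le> N" if "0 < k" "b * k \<le> N" for b k :: nat
      using that mult_le_mono2[of 1 k b] by linarith
    show ?thesis
      by (intro sum.reindex_bij_witness[where i="\<lambda>(d,m). (d*m,d)" and j="\<lambda>(n,d). (d, n div d)"])
         (auto simp: less_eq_div_iff_mult_less_eq mult.commute Suc_le_eq intro: * elim!: dvdE)
  qed
  also have "\<dots> = (\<Sum>d=1..N. \<Sum>m=1..N div d. F d m)"
    by (subst sum.Sigma) auto
  finally show ?thesis .
qed

lemma sum_ln_lower: "real N * ln N - N \<le> (\<Sum>n=1..N. ln (real n))"
proof (induction N)
  case (Suc N)
  show ?case
  proof (cases "N = 0")
    case False
    have "real N * ln (real (Suc N) / N) \<le> real N * (1 / N)"
    proof (intro mult_left_mono)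
      have "real (Suc N) / N = 1 + 1 / N" using False by (simp add: field_simps)
      thus "ln (real (Suc N) / N) \<le> 1 / N"
        using ln_add_one_self_le_self[of "1 / real N"] by simp
    qed simp
    hence "real N * (ln (Suc N) - ln N) \<le> 1"
      using False by (simp add: ln_div del: of_nat_Suc)
    thus ?thesis using Suc.IH by (simp add: algebra_simps)
  qed simp
qed simp

lemma sum_ln_ratio_le: "(\<Sum>n=1..N. ln (real N / real n)) \<le> real N"
proof -
  have "(\<Sum>n=1..N. ln (real N / real n)) = (\<Sum>n=1..N. ln (real N) - ln (real n))"
    by (intro sum.cong refl) (auto simp: ln_div)
  also have "\<dots> = N * ln N - (\<Sum>n=1..N. ln (real n))"
    by (simp add: sum_subtractf)
  finally show ?thesis using sum_ln_lower[of N] by simp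
qed

lemma sum_ln_conv_mangoldt:
  "(\<Sum>n=1..N. ln (real n)) = (\<Sum>d=1..N. mangoldt d * real (N div d))"
proof -
  have "(\<Sum>n=1..N. ln (real n)) = (\<Sum>n=1..N. \<Sum>d | d dvd n. mangoldt d)"
    by (intro sum.cong refl) (use mangoldt_sum[where ?'a = real] in auto)
  also have "\<dots> = (\<Sum>d=1..N. \<Sum>m=1..N div d. mangoldt d)"
    by (rule sum_divisors_swap)
  finally show ?thesis by (simp add: mult.commute)
qed

lemma ln_fact_eq_sum: "ln (fact N :: real) = (\<Sum>n=1..N. ln (real n))"
  by (induction N) (auto simp: ln_mult simp del: of_nat_Suc)

text \<open>Central binomial coefficient: its logarithm is the sum of \<open>mangoldt d\<close>
  weighted by \<open>2 * n div d - 2 * (n div d)\<close>. These weights are nonnegative and at least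
  1 for \<open>n < d <= 2 * n\<close>, while the coefficient is at most
  \<open>2 ^ (2 * n)\<close>.\<close>

lemma sum_mangoldt_double:
  "(\<Sum>d=1..2*n. mangoldt d :: real) \<le> (\<Sum>d=1..n. mangoldt d) + 2 * real n * ln 2"
proof -
  have "(\<Sum>d=1..2*n. mangoldt d) - (\<Sum>d=1..n. mangoldt d :: real)
      = (\<Sum>d=n+1..2*n. mangoldt d)"
    using sum.ub_add_nat[of 1 n "mangoldt :: nat \<Rightarrow> real" n] by (simp add: mult_2)
  also have "\<dots> \<le> (\<Sum>d=n+1..2*n. mangoldt d * (real (2*n div d) - 2 * real (n div d)))"
  proof (intro sum_mono)
    fix d assume d: "d \<in> {n+1..2*n}"
    hence "2*n div d \<ge> 1" by (simp add: div_greater_zero_iff Suc_le_eq)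
    moreover have "n div d = 0" using d by simp
    ultimately have "1 \<le> real (2*n div d) - 2 * real (n div d)"
      by (metis of_nat_0 mult_zero_right diff_zero of_nat_1 of_nat_le_iff)
    thus "mangoldt d \<le> mangoldt d * (real (2*n div d) - 2 * real (n div d))"
      using mult_left_mono[OF _ mangoldt_nonneg[of d]] by fastforce
  qed
  also have "\<dots> \<le> (\<Sum>d=1..2*n. mangoldt d * (real (2*n div d) - 2 * real (n div d)))"
  proof (intro sum_mono2)
    fix d :: nat
    have "2 * (n div d) \<le> 2 * n div d"
      by (metis div_mult2_eq mult.commute div_le_dividend le_refl div_mult1_eq le_add1 mult.left_commute)
    hence "0 \<le> real (2*n div d) - 2 * real (n div d)"
      by (metis diff_ge_0_iff_ge of_nat_le_iff of_nat_mult of_nat_numeral)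
    thus "0 \<le> mangoldt d * (real (2*n div d) - 2 * real (n div d))"
      by (intro mult_nonneg_nonneg mangoldt_nonneg)
  qed auto
  also have "\<dots> = (\<Sum>d=1..2*n. mangoldt d * real (2*n div d))
                 - 2 * (\<Sum>d=1..2*n. mangoldt d * real (n div d))"
    by (simp add: right_diff_distrib sum_subtractf sum_distrib_left algebra_simps)
  also have "(\<Sum>d=1..2*n. mangoldt d * real (n div d)) = (\<Sum>d=1..n. mangoldt d * real (n div d))"
    by (rule sum.mono_neutral_right) auto
  also have "(\<Sum>d=1..2*n. mangoldt d * real (2*n div d)) - 2 * \<dots> = ln (fact (2*n)) - 2 * ln (fact n)"
    by (simp only: sum_ln_conv_mangoldt[symmetric] ln_fact_eq_sum)
  also have "\<dots> = ln (fact (2*n) / (fact n * fact n) :: real)"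
    by (simp add: ln_div ln_mult)
  also have "fact (2*n) / (fact n * fact n) = real (2*n choose n)"
    by (subst binomial_fact) (simp_all add: mult_2)
  also have "ln \<dots> \<le> ln (2 ^ (2*n))"
  proof (subst ln_le_cancel_iff)
    show "real (2*n choose n) \<le> 2 ^ (2*n)"
      using binomial_le_pow2[of "2*n" n] by (metis of_nat_le_iff of_nat_numeral of_nat_power)
  qed auto
  also have "\<dots> = 2 * real n * ln 2" by (subst ln_realpow) auto
  finally show ?thesis by simp
qed

text \<open>Halving: the bound for \<open>n = N div 2\<close> gives 4n + 2n = 6n up to
  \<open>2 * n\<close>. An odd \<open>N = 2 * n + 1\<close> adds one term, at most
  \<open>N - 1 = 2 * n\<close>, and the constant 4 leaves room for this 8n.\<close>

lemma chebyshev_mangoldt: "(\<Sum>d=1..N. mangoldt d) \<le> 4 * real N"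
proof (induction N rule: less_induct)
  case (less N)
  define n where "n = N div 2"
  have ln2: "ln 2 \<le> (1::real)" using ln_2_less_1 by simp
  hence l2: "real n * ln 2 \<le> real n" by (simp add: mult_left_le)
  show ?case
  proof (cases "N = 0")
    case False
    hence "n < N" by (auto simp: n_def)
    from less.IH[OF this] have IH: "(\<Sum>d=1..2*n. mangoldt d) \<le> 6 * real n"
      using sum_mangoldt_double[of n] l2 by linarith
    show ?thesis
    proof (cases "even N")
      case True
      hence "N = 2 * n" by (auto simp: n_def)
      thus ?thesis using IH by simp
    next
      case False
      hence N: "N = Suc (2 * n)" by (auto simp: n_def elim: oddE)
      have "mangoldt N \<le> ln (real N)" using N by (intro mangoldt_le) auto
      also have "\<dots> \<le> real N - 1" using N by (intro ln_le_minus_one) auto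
      finally have "(\<Sum>d=1..N. mangoldt d) \<le> 6 * real n + 2 * real n"
        using IH by (simp add: N)
      thus ?thesis using N by simp
    qed
  qed simp
qed

text \<open>By \<open>sum_ln_conv_mangoldt\<close> the sum of \<open>mangoldt d * (N div d)\<close>
  lies between \<open>N * ln N - N\<close> and \<open>N * ln N\<close>. Replacing
  \<open>N div d\<close> by \<open>N / d\<close> costs at most the Chebyshev sum, whence the
  4.\<close>

lemma mertens_mangoldt:
  assumes "N \<ge> 1"
  shows "\<bar>(\<Sum>d=1..N. mangoldt d / real d) - ln N\<bar> \<le> 4"
proof -
  define S where "S = (\<Sum>d=1..N. mangoldt d / real d)"
  have N: "real N > 0" using assms by simp
  have "(\<Sum>n=1..N. ln (real n)) \<le> (\<Sum>n=1..N. ln (real N))"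
    by (intro sum_mono) (auto simp: assms)
  hence up: "(\<Sum>d=1..N. mangoldt d * real (N div d)) \<le> N * ln N"
    unfolding sum_ln_conv_mangoldt[symmetric] by simp
  have lo: "(\<Sum>d=1..N. mangoldt d * real (N div d)) \<ge> N * ln N - N"
    using sum_ln_lower[of N] unfolding sum_ln_conv_mangoldt .
  have "(\<Sum>d=1..N. mangoldt d * real (N div d)) \<le> (\<Sum>d=1..N. N * (mangoldt d / d))"
  proof (intro sum_mono)
    fix d
    have "mangoldt d * real (N div d) \<le> mangoldt d * (N / d)"
      by (intro mult_left_mono mangoldt_nonneg real_nat_div_le)
    thus "mangoldt d * real (N div d) \<le> N * (mangoldt d / d)" by (simp add: mult.commute)
  qed
  hence 1: "N * ln N - N \<le> N * S" using lo by (simp add: S_def sum_distrib_left)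
  have "(\<Sum>d=1..N. N * (mangoldt d / d)) \<le> (\<Sum>d=1..N. mangoldt d * real (N div d) + mangoldt d)"
  proof (intro sum_mono)
    fix d :: nat
    have "real N / d \<le> real (N div d) + 1" using real_div_nat_less[of N d] by linarith
    from mult_left_mono[OF this mangoldt_nonneg[of d]]
    show "N * (mangoldt d / d) \<le> mangoldt d * real (N div d) + mangoldt d"
      by (simp add: algebra_simps)
  qed
  hence 2: "N * S \<le> N * ln N + 4 * N"
    using up chebyshev_mangoldt[of N] by (simp add: S_def sum_distrib_left sum.distrib)
  from 1 have "N * (ln N - 1) \<le> N * S" by (simp add: algebra_simps)
  hence "ln N - 1 \<le> S" using N mult_le_cancel_left_pos by blast
  moreover from 2 have "N * S \<le> N * (ln N + 4)" by (simp add: algebra_simps)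
  hence "S \<le> ln N + 4" using N mult_le_cancel_left_pos by blast
  ultimately show ?thesis unfolding S_def by linarith
qed

text \<open>Abel summation with the total variation of \<open>g\<close> in place of monotonicity.
  The 2 arises because a partial sum starting at \<open>M + 1\<close> is a difference of two that
  start at 1. Vector values cover the real weights on primes as well as the complex
  characters.\<close>

lemma sum_by_parts_bound:
  fixes b :: "nat \<Rightarrow> 'a::real_normed_vector" and g :: "nat \<Rightarrow> real"
  assumes B: "\<And>n. norm (\<Sum>i=1..n. b i) \<le> B" and "M \<le> N"
  shows "norm (\<Sum>n=M+1..N. g n *\<^sub>R b n) \<le> 2 * B * (\<bar>g N\<bar> + (\<Sum>n=M+1..<N. \<bar>g (Suc n) - g n\<bar>))"
proof -
  define T where "T n = (\<Sum>i=M+1..n. b i)" for n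
  have T: "norm (T n) \<le> 2 * B" if "n \<ge> M" for n
  proof -
    have "T n = (\<Sum>i=1..n. b i) - (\<Sum>i=1..M. b i)"
      using that sum.ub_add_nat[of 1 M b "n - M"] by (simp add: T_def)
    thus ?thesis using norm_triangle_ineq4[of "\<Sum>i=1..n. b i" "\<Sum>i=1..M. b i"] B[of n] B[of M]
      by simp
  qed
  have eq: "(\<Sum>n=M+1..N. g n *\<^sub>R b n) = g N *\<^sub>R T N - (\<Sum>n=M+1..<N. (g (Suc n) - g n) *\<^sub>R T n)"
    using \<open>M \<le> N\<close>
  proof (induction rule: dec_induct)
    case base
    show ?case by (simp add: T_def)
  next
    case (step n)
    have "(\<Sum>i=M+1..<Suc n. (g (Suc i) - g i) *\<^sub>R T i)
        = (\<Sum>i=M+1..<n. (g (Suc i) - g i) *\<^sub>R T i) + (g (Suc n) - g n) *\<^sub>R T n"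
    proof (cases "n = M")
      case True
      thus ?thesis by (simp add: T_def)
    next
      case False
      thus ?thesis using step.hyps by (subst sum.atLeastLessThan_Suc) auto
    qed
    hence D: "(\<Sum>i=M+1..<Suc n. (g (Suc i) - g i) *\<^sub>R T i)
        = g n *\<^sub>R T n - (\<Sum>i=M+1..n. g i *\<^sub>R b i) + (g (Suc n) - g n) *\<^sub>R T n"
      unfolding step.IH by simp
    have S: "(\<Sum>i=M+1..Suc n. g i *\<^sub>R b i) = (\<Sum>i=M+1..n. g i *\<^sub>R b i) + g (Suc n) *\<^sub>R b (Suc n)"
      using step.hyps by simp
    have T_Suc: "T (Suc n) = T n + b (Suc n)" using step.hyps by (simp add: T_def)
    show ?case unfolding S D T_Suc by (simp add: scaleR_right_distrib scaleR_left_diff_distrib)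
  qed
  have "norm (\<Sum>n=M+1..N. g n *\<^sub>R b n)
      \<le> norm (g N *\<^sub>R T N) + norm (\<Sum>n=M+1..<N. (g (Suc n) - g n) *\<^sub>R T n)"
    unfolding eq by (rule norm_triangle_ineq4)
  also have "norm (g N *\<^sub>R T N) \<le> \<bar>g N\<bar> * (2 * B)"
    using T[OF \<open>M \<le> N\<close>] by (simp add: mult_left_mono)
  also have "norm (\<Sum>n=M+1..<N. (g (Suc n) - g n) *\<^sub>R T n)
      \<le> (\<Sum>n=M+1..<N. \<bar>g (Suc n) - g n\<bar> * (2 * B))"
    by (rule sum_norm_le) (auto intro!: mult_left_mono T)
  also have "(\<Sum>n=M+1..<N. \<bar>g (Suc n) - g n\<bar> * (2 * B)) = (\<Sum>n=M+1..<N. \<bar>g (Suc n) - g n\<bar>) * (2 * B)"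
    by (rule sum_distrib_right[symmetric])
  finally show ?thesis by (simp add: distrib_left mult.commute)
qed

lemma sum_by_parts_decreasing:
  fixes b :: "nat \<Rightarrow> 'a::real_normed_vector" and g :: "nat \<Rightarrow> real"
  assumes B: "\<And>n. norm (\<Sum>i=1..n. b i) \<le> B"
    and nonneg: "\<And>n. n > M \<Longrightarrow> 0 \<le> g n" and decr: "\<And>n. n > M \<Longrightarrow> g (Suc n) \<le> g n"
  shows "norm (\<Sum>n=M+1..N. g n *\<^sub>R b n) \<le> 2 * B * g (M + 1)"
proof -
  have B0: "B \<ge> 0" using B[of 0] by simp
  show ?thesis
  proof (cases "M < N")
    case True
    have "(\<Sum>n=M+1..<N. \<bar>g (Suc n) - g n\<bar>) = (\<Sum>n=M+1..<N. - (g (Suc n) - g n))"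
      by (intro sum.cong refl) (use decr in auto)
    also have "\<dots> = g (M+1) - g N"
      using True by (subst sum_negf, subst sum_Suc_diff') auto
    finally have "\<bar>g N\<bar> + (\<Sum>n=M+1..<N. \<bar>g (Suc n) - g n\<bar>) = g (M+1)"
      using nonneg[OF True] by simp
    thus ?thesis using sum_by_parts_bound[OF B order.strict_implies_order[OF True], of g] by (simp only:)
  next
    case False
    thus ?thesis using B0 nonneg[of "M+1"] by simp
  qed
qed

text \<open>Extension by zero turns sums over primes into sums over intervals, ready for partial
  summation.\<close>

definition log_prime_ratio :: "nat \<Rightarrow> real" where
  "log_prime_ratio n = (if prime n then ln (real n) / real n else 0)"

lemma sum_geometric_tail_le:
  assumes "p \<ge> (2::nat)"
  shows "(\<Sum>a=2..A. 1 / real (p ^ a)) \<le> 2 / real p ^ 2"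
proof -
  \<comment> \<open>The subtracted \<open>2 / p ^ (A + 1)\<close> makes the induction work: the next
    term takes half of it, and the other half still covers \<open>2 / p ^ (A + 2)\<close> because
    \<open>p >= 2\<close>. For \<open>A < 2\<close> the sum is empty.\<close>
  have "(\<Sum>a=2..A. 1 / real (p ^ a)) \<le> 2 / real p ^ 2 - (1 / real p ^ (Suc A)) * (if A < 2 then 0 else 2)"
  proof (induction A)
    case (Suc A)
    have "1 / real p * 2 \<le> 1" using assms by simp
    have step: "2 * (1 / real p ^ Suc n) \<le> 1 / real p ^ n" for n
      using mult_left_mono[OF \<open>1 / real p * 2 \<le> 1\<close>, of "1 / real p ^ n"] by (simp add: mult.commute)
    consider "A = 0" | "A = 1" | "A \<ge> 2" by arith
    thus ?case
    proof cases
      case 2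
      thus ?thesis using step[of 2] by (simp add: eval_nat_numeral)
    next
      case 3
      moreover have "2 * (1 / real p ^ Suc (Suc A)) \<le> 1 / real p ^ Suc A" by (rule step)
      ultimately show ?thesis using Suc.IH by (auto simp del: power_Suc)
    qed simp
  qed simp
  also have "\<dots> \<le> 2 / real p ^ 2" by simp
  finally show ?thesis .
qed

text \<open>Summed over the exponents \<open>a >= 2\<close>, a prime contributes at most
  \<open>ln p * 2 / p ^ 2\<close>, and \<open>ln p <= 2 * sqrt p\<close> leaves the summable
  \<open>4 * p powr (-3/2)\<close>. This permits switching between \<open>mangoldt\<close> and
  primes in all Mertens sums.\<close>

lemma sum_mangoldt_nonprime_bounded:
  "\<exists>H\<ge>0. \<forall>N. (\<Sum>n | n \<in> {1..N} \<and> \<not> prime n. mangoldt n / real n) \<le> H"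
proof -
  define H where "H = (\<Sum>p. 4 * real p powr (-3/2))"
  have summ: "summable (\<lambda>p. 4 * real p powr (-3/2))"
    by (intro summable_mult) (simp add: summable_real_powr_iff)
  have "(\<Sum>n | n \<in> {1..N} \<and> \<not> prime n. mangoldt n / real n) \<le> H" for N
  proof -
    let ?A = "{n. n \<in> {1..N} \<and> primepow n \<and> \<not> prime n}"
    let ?P = "{p. prime p \<and> p \<le> N}"
    have "(\<Sum>n | n \<in> {1..N} \<and> \<not> prime n. mangoldt n / real n) = (\<Sum>n\<in>?A. mangoldt n / real n)"
      by (rule sum.mono_neutral_right) (auto simp: mangoldt_def)
    also have "\<dots> = (\<Sum>(p,a)\<in>(\<lambda>n. (aprimedivisor n, multiplicity (aprimedivisor n) n)) ` ?A. ln (real p) / real (p ^ a))"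
    proof (subst sum.reindex)
      show "inj_on (\<lambda>n. (aprimedivisor n, multiplicity (aprimedivisor n) n)) ?A"
        by (rule inj_on_inverseI[where g = "\<lambda>(p, a). p ^ a"]) (simp add: primepow_decompose)
      show "(\<Sum>n\<in>?A. mangoldt n / real n) = sum ((\<lambda>(p, a). ln (real p) / real (p ^ a)) \<circ>
         (\<lambda>n. (aprimedivisor n, multiplicity (aprimedivisor n) n))) ?A"
        by (intro sum.cong refl) (auto simp: mangoldt_def primepow_decompose simp del: of_nat_power)
    qed
    also have "\<dots> \<le> (\<Sum>(p,a)\<in>?P \<times> {2..N}. ln (real p) / real (p ^ a))"
    proof (intro sum_mono2)
      show "(\<lambda>n. (aprimedivisor n, multiplicity (aprimedivisor n) n)) ` ?A \<subseteq> ?P \<times> {2..N}"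
      proof safe
        fix n assume n: "n \<in> {1..N}" "primepow n" "\<not> prime n"
        define p where "p = aprimedivisor n"
        define a where "a = multiplicity p n"
        have eq: "n = p ^ a" using primepow_decompose[OF n(2)] by (simp add: p_def a_def)
        show p: "prime (aprimedivisor n)" using n(2) primepow_gt_Suc_0[OF n(2)]
          by (intro prime_aprimedivisor') auto
        hence p': "prime p" by (simp add: p_def)
        show "aprimedivisor n \<le> N"
          using n(1) aprimedivisor_le_nat[of n] primepow_gt_Suc_0[OF n(2)] by auto
        have "a \<noteq> 0" using eq n(2) by (metis power_0 one_not_primepow)
        moreover have "a \<noteq> 1" using eq n(3) p' by auto
        moreover have "a < p ^ a" using p' by (intro power_gt_expt) (use prime_gt_1_nat in auto)
        ultimately show "multiplicity (aprimedivisor n) n \<in> {2..N}"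
          using n(1) eq unfolding p_def[symmetric] a_def[symmetric] by auto
      qed
    qed (auto intro!: divide_nonneg_nonneg ln_ge_zero dest: prime_gt_0_nat)
    also have "\<dots> = (\<Sum>p\<in>?P. ln (real p) * (\<Sum>a=2..N. 1 / real (p ^ a)))"
      by (subst sum.Sigma [symmetric]) (auto simp: sum_distrib_left)
    also have "\<dots> \<le> (\<Sum>p\<in>?P. 4 * real p powr (-3/2))"
    proof (intro sum_mono)
      fix p assume "p \<in> ?P"
      hence p: "p \<ge> 2" by (auto simp: prime_ge_2_nat)
      have "ln (real p) * (\<Sum>a=2..N. 1 / real (p ^ a)) \<le> ln (real p) * (2 / real p ^ 2)"
        using p by (intro mult_left_mono sum_geometric_tail_le) auto
      also have "\<dots> \<le> (real p powr (1/2) / (1/2)) * (2 / real p ^ 2)"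
        using p by (intro mult_right_mono ln_powr_bound) auto
      also have "\<dots> = 4 * (real p powr (1/2) / real p powr 2)" using p by simp
      also have "\<dots> = 4 * real p powr (-3/2)" by (subst powr_diff[symmetric]) simp
      finally show "ln (real p) * (\<Sum>a=2..N. 1 / real (p ^ a)) \<le> 4 * real p powr (-3/2)" .
    qed
    also have "\<dots> \<le> H" unfolding H_def by (rule sum_le_suminf[OF summ]) auto
    finally show ?thesis .
  qed
  moreover have "H \<ge> 0" unfolding H_def by (intro suminf_nonneg summ) auto
  ultimately show ?thesis by blast
qed

lemma mertens_first:
  obtains B where "\<And>N. \<bar>(\<Sum>n=1..N. log_prime_ratio n) - ln (real N)\<bar> \<le> B"
proof -
  obtain H where H: "\<And>N. (\<Sum>n | n \<in> {1..N} \<and> \<not> prime n. mangoldt n / real n) \<le> H"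
    using sum_mangoldt_nonprime_bounded by blast
  have "\<bar>(\<Sum>n=1..N. log_prime_ratio n) - ln (real N)\<bar> \<le> 4 + H" for N
  proof (cases "N = 0")
    case True
    thus ?thesis using H[of 0] by simp
  next
    case False
    define E where "E = (\<Sum>n | n \<in> {1..N} \<and> \<not> prime n. mangoldt n / real n)"
    have "(\<Sum>n=1..N. mangoldt n / real n) =
        (\<Sum>n=1..N. log_prime_ratio n + (if \<not> prime n then mangoldt n / real n else 0))"
      by (intro sum.cong refl) (auto simp: log_prime_ratio_def)
    also have "\<dots> = (\<Sum>n=1..N. log_prime_ratio n) + E"
      unfolding sum.distrib E_def by (subst sum.inter_filter) auto
    finally have "(\<Sum>n=1..N. mangoldt n / real n) = (\<Sum>n=1..N. log_prime_ratio n) + E" .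
    moreover have "E \<ge> 0" unfolding E_def by (intro sum_nonneg) (auto simp: mangoldt_nonneg)
    moreover have "E \<le> H" unfolding E_def by (rule H)
    ultimately show ?thesis using mertens_mangoldt[of N] False by linarith
  qed
  thus ?thesis using that by blast
qed

section \<open>Upper bounds for sums of 1 / p and 1 / (p ln p) over primes\<close>

lemma sum_ln_diff: "(\<Sum>n=1..N. ln (real n) - ln (real (n - 1))) = ln (real N)"
  by (induction N) auto

text \<open>Discrete form of integrating \<open>1 / (x * ln x)\<close>: it is
  \<open>ln u <= u - 1\<close> for a ratio \<open>u\<close> of logarithms. From \<open>n = 3\<close>
  on, \<open>ln (n - 1)\<close> is positive.\<close>

lemma ln_diff_div_ln_le:
  assumes "n \<ge> (3::nat)"
  shows "(ln (real n) - ln (real (n - 1))) / ln (real n) \<le> ln (ln (real n)) - ln (ln (real (n - 1)))"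
proof -
  have pos: "0 < ln (real (n - 1))" "0 < ln (real n)" using assms by auto
  have "ln (ln (real (n - 1)) / ln (real n)) \<le> ln (real (n - 1)) / ln (real n) - 1"
    using pos by (intro ln_le_minus_one) auto
  thus ?thesis using pos by (simp add: ln_div diff_divide_distrib)
qed

text \<open>By \<open>mertens_first\<close>, the prime weights minus the increments of
  \<open>ln\<close> have bounded partial sums; the telescoping behind this starts from
  \<open>ln 0 = 0\<close>. Partial summation against \<open>1 / ln n\<close> and
  \<open>1 / (ln n) ^ 2\<close> leaves the increments, which are dominated by those of
  \<open>ln (ln n)\<close> and \<open>- 1 / ln n\<close>.\<close>

lemma mertens_second:
  obtains C where "C \<ge> 0" "\<And>t y. 2 \<le> t \<Longrightarrow> t \<le> y \<Longrightarrow>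
    (\<Sum>p | prime p \<and> t < p \<and> p \<le> y. 1 / real p) \<le> ln (ln (real y)) - ln (ln (real t)) + C"
    "\<And>t y. 2 \<le> t \<Longrightarrow> 
    (\<Sum>p | prime p \<and> t < p \<and> p \<le> y. 1 / (real p * ln (real p))) \<le> C / ln (real t)"
proof -
  define b where "b n = log_prime_ratio n - (ln (real n) - ln (real (n - 1)))" for n
  obtain B where B: "\<And>N. \<bar>(\<Sum>n=1..N. log_prime_ratio n) - ln (real N)\<bar> \<le> B"
    using mertens_first by blast
  have bB: "norm (\<Sum>n=1..N. b n) \<le> B" for N
    using B[of N] unfolding b_def sum_subtractf[of log_prime_ratio] sum_ln_diff by simp
  have B0: "B \<ge> 0" using bB[of 0] by simp
  define C where "C = 2 * B / ln 2 + 1"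
  have C0: "C \<ge> 0" using B0 by (simp add: C_def)
  have 1: "(\<Sum>p | prime p \<and> t < p \<and> p \<le> y. 1 / real p) \<le> ln (ln (real y)) - ln (ln (real t)) + C"
    if ty: "2 \<le> t" "t \<le> y" for t y
  proof -
    have "(\<Sum>p | prime p \<and> t < p \<and> p \<le> y. 1 / real p) = (\<Sum>n=t+1..y. (1 / ln n) * log_prime_ratio n)"
      using ty by (intro sum.mono_neutral_cong_left) (auto simp: log_prime_ratio_def)
    also have "\<dots> = (\<Sum>n=t+1..y. (1 / ln n) *\<^sub>R b n) + (\<Sum>n=t+1..y. (ln (real n) - ln (real (n - 1))) / ln (real n))"
      unfolding sum.distrib[symmetric]
      by (intro sum.cong refl) (simp add: b_def add_divide_distrib[symmetric])
    also have "(\<Sum>n=t+1..y. (1 / ln n) *\<^sub>R b n) \<le> 2 * B * (1 / ln (real (t+1)))"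
      using sum_by_parts_decreasing[OF bB, of t "\<lambda>n. 1 / ln n" y] ty
      by (auto simp: frac_le)
    also have "\<dots> \<le> 2 * B / ln 2" using ty B0 by (auto intro!: divide_left_mono)
    also have "(\<Sum>n=t+1..y. (ln (real n) - ln (real (n - 1))) / ln (real n)) \<le>
        (\<Sum>n=t+1..y. ln (ln (real n)) - ln (ln (real (n - 1))))"
      using ty by (intro sum_mono ln_diff_div_ln_le) auto
    also have "\<dots> = ln (ln (real y)) - ln (ln (real t))"
      using ty(2) by (induction rule: dec_induct) auto
    finally show ?thesis by (simp add: C_def)
  qed
  have 2: "(\<Sum>p | prime p \<and> t < p \<and> p \<le> y. 1 / (real p * ln (real p))) \<le> C / ln (real t)"
    if ty: "2 \<le> t" for t y
  proof (cases "t \<le> y")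
    case True
    have "(\<Sum>p | prime p \<and> t < p \<and> p \<le> y. 1 / (real p * ln (real p))) =
        (\<Sum>n=t+1..y. (1 / (ln n)\<^sup>2) * log_prime_ratio n)"
      using ty by (intro sum.mono_neutral_cong_left) (auto simp: log_prime_ratio_def power2_eq_square)
    also have "\<dots> = (\<Sum>n=t+1..y. (1 / (ln n)\<^sup>2) *\<^sub>R b n) + (\<Sum>n=t+1..y. (ln (real n) - ln (real (n - 1))) / (ln (real n))\<^sup>2)"
      unfolding sum.distrib[symmetric]
      by (intro sum.cong refl) (simp add: b_def add_divide_distrib[symmetric])
    also have "(\<Sum>n=t+1..y. (1 / (ln n)\<^sup>2) *\<^sub>R b n) \<le> 2 * B * (1 / (ln (real (t+1)))\<^sup>2)"
      using sum_by_parts_decreasing[OF bB, of t "\<lambda>n. 1 / (ln n)\<^sup>2" y] ty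
      by (auto simp: frac_le power_mono)
    also have "\<dots> \<le> 2 * B * (1 / (ln 2 * ln (real t)))"
      using ty B0 unfolding power2_eq_square
      by (intro mult_left_mono divide_left_mono mult_mono) auto
    also have "(\<Sum>n=t+1..y. (ln (real n) - ln (real (n - 1))) / (ln (real n))\<^sup>2) \<le>
        (\<Sum>n=t+1..y. 1 / ln (real (n - 1)) - 1 / ln (real n))"
    proof (intro sum_mono)
      fix n assume n: "n \<in> {t+1..y}"
      have pos: "0 < ln (real (n - 1))" "0 < ln (real n)" using n ty by auto
      have "(ln (real n) - ln (real (n - 1))) / (ln (real n))\<^sup>2 \<le> (ln (real n) - ln (real (n - 1))) / (ln (real (n-1)) * ln (real n))"
        unfolding power2_eq_square using n ty pos by (intro divide_left_mono mult_right_mono) auto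
      also have "\<dots> = 1 / ln (real (n - 1)) - 1 / ln (real n)"
        using pos by (simp add: field_simps)
      finally show "(ln (real n) - ln (real (n - 1))) / (ln (real n))\<^sup>2 \<le> 1 / ln (real (n - 1)) - 1 / ln (real n)" .
    qed
    also have "\<dots> = 1 / ln (real t) - 1 / ln (real y)"
      using True by (induction rule: dec_induct) auto
    also have "\<dots> \<le> 1 / ln (real t)" using ty True by simp
    finally show ?thesis by (simp add: C_def add_divide_distrib)
  next
    case False
    hence "{p. prime p \<and> t < p \<and> p \<le> y} = {}" by auto
    thus ?thesis using C0 ty by (simp only: sum.empty) simp
  qed
  show ?thesis by (rule that[OF C0 1 2])
qed

section \<open>Euler products, rough and smooth numbers\<close>

lemma prime_factors_remove_prime:
  fixes m :: nat
  assumes "m > 0" "p \<in> prime_factors m"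
  shows "prime_factors (m div p ^ multiplicity p m) = prime_factors m - {p}"
    and "m = p ^ multiplicity p m * (m div p ^ multiplicity p m)"
    and "multiplicity p m > 0"
proof -
  have p: "prime p" "p dvd m" using assms by (auto simp: in_prime_factors_iff)
  show k: "multiplicity p m > 0"
    using p assms by (simp add: prime_multiplicity_gt_zero_iff)
  show eq: "m = p ^ multiplicity p m * (m div p ^ multiplicity p m)"
    by (simp add: multiplicity_dvd)
  define m' where "m' = m div p ^ multiplicity p m"
  have eq': "m = p ^ multiplicity p m * m'" using eq by (simp add: m'_def)
  have m'0: "m' \<noteq> 0" using eq' assms by (metis mult_0_right neq0_conv)
  have nd: "\<not> p dvd m'"
    unfolding m'_def using p assms by (intro multiplicity_decompose) auto
  have "prime_factors m = prime_factors (p ^ multiplicity p m) \<union> prime_factors m'"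
    using p m'0 by (subst eq') (intro prime_factors_product, auto)
  also have "prime_factors (p ^ multiplicity p m) = {p}"
    using p k by (simp add: prime_factors_power prime_prime_factors)
  finally show "prime_factors (m div p ^ multiplicity p m) = prime_factors m - {p}"
    using nd unfolding m'_def[symmetric] by (auto simp: in_prime_factors_iff)
qed

lemma sum_power_le_geometric:
  fixes x :: real
  assumes "0 \<le> x" "x < 1"
  shows "(\<Sum>a\<le>A. x ^ a) \<le> 1 / (1 - x)"
proof -
  have "(1 - x) * (\<Sum>a\<le>A. x ^ a) = 1 - x ^ Suc A" by (rule sum_gp_basic)
  also have "\<dots> \<le> 1" using assms by simp
  finally show ?thesis using assms by (simp add: field_simps)
qed

text \<open>For a finite \<open>S\<close> no convergence is involved. Each \<open>m\<close> splits
  into a power of the prime \<open>p\<close> and a cofactor free of \<open>p\<close>; the exponents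
  give a partial geometric series, and the cofactors form a finite set for the remaining
  primes.\<close>

lemma euler_product_bound:
  fixes h :: "nat \<Rightarrow> real"
  assumes "finite P" "\<And>p. p \<in> P \<Longrightarrow> prime p"
    and nonneg: "\<And>n. h n \<ge> 0" and h1: "h 1 = 1"
    and mult: "\<And>a b. a > 0 \<Longrightarrow> b > 0 \<Longrightarrow> h (a * b) = h a * h b"
    and "\<And>p. p \<in> P \<Longrightarrow> h p < 1"
    and "finite S" "\<And>m. m \<in> S \<Longrightarrow> m > 0 \<and> prime_factors m \<subseteq> P"
  shows "(\<Sum>m\<in>S. h m) \<le> (\<Prod>p\<in>P. 1 / (1 - h p))"
  using assms(1,2,6-)
proof (induction P arbitrary: S rule: finite_induct)
  case empty
  have "m = 1" if "m \<in> S" for m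
  proof -
    have "m > 0" "prime_factors m = {}" using empty(4)[OF that] by auto
    thus ?thesis by (simp add: prime_factorization_empty_iff)
  qed
  hence "S \<subseteq> {1}" by auto
  hence "(\<Sum>m\<in>S. h m) \<le> (\<Sum>m\<in>{1}. h m)" by (intro sum_mono2) (auto simp: nonneg)
  thus ?case by (simp add: h1[simplified])
next
  case (insert p P)
  define \<phi> where "\<phi> m = (multiplicity p m, m div p ^ multiplicity p m)" for m :: nat
  define S' where "S' = (\<lambda>m. m div p ^ multiplicity p m) ` S"
  \<comment> \<open>Largest exponent of \<open>p\<close> occurring in \<open>S\<close>; the 0 covers
    an empty \<open>S\<close>.\<close>
  define A where "A = Max (insert 0 (multiplicity p ` S))"
  define g where "g = (\<lambda>(a,m). h p ^ a * h m)"
  have p: "prime p" using insert by auto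
  hence p0: "p > 0" by (simp add: prime_gt_0_nat)
  have hp: "h (p ^ a) = h p ^ a" for a
    by (induction a) (use h1 mult p0 in auto)
  have decomp: "m = p ^ multiplicity p m * (m div p ^ multiplicity p m)" for m
    by (simp add: multiplicity_dvd)
  have pos: "m div p ^ multiplicity p m > 0" if "m \<in> S" for m
    using decomp[of m] insert.prems(4)[OF that] by (metis mult_0_right neq0_conv)
  have "(\<Sum>m\<in>S. h m) = (\<Sum>m\<in>S. g (\<phi> m))"
  proof (intro sum.cong refl)
    fix m assume "m \<in> S"
    from pos[OF this] show "h m = g (\<phi> m)"
      using p0 by (subst decomp, subst mult) (auto simp: g_def \<phi>_def hp)
  qed
  also have "\<dots> = (\<Sum>x\<in>\<phi> ` S. g x)"
  proof (subst sum.reindex)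
    show "inj_on \<phi> S"
      by (rule inj_on_inverseI[where g = "\<lambda>(a, m). p ^ a * m"]) (simp add: \<phi>_def multiplicity_dvd)
  qed simp
  also have "\<dots> \<le> (\<Sum>x\<in>{..A} \<times> S'. g x)"
    using insert.prems(3) by (intro sum_mono2) (auto simp: g_def \<phi>_def S'_def A_def nonneg)
  also have "\<dots> = (\<Sum>a\<le>A. h p ^ a) * (\<Sum>m\<in>S'. h m)"
    by (simp add: g_def sum_product sum.cartesian_product)
  also have "\<dots> \<le> (1 / (1 - h p)) * (\<Prod>p\<in>P. 1 / (1 - h p))"
  proof (intro mult_mono)
    show "(\<Sum>a\<le>A. h p ^ a) \<le> 1 / (1 - h p)"
      by (intro sum_power_le_geometric) (use nonneg insert in auto)
    show "(\<Sum>m\<in>S'. h m) \<le> (\<Prod>p\<in>P. 1 / (1 - h p))"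
    proof (rule insert.IH)
      fix m' assume "m' \<in> S'"
      then obtain m where m: "m \<in> S" "m' = m div p ^ multiplicity p m" by (auto simp: S'_def)
      have m0: "m > 0" "prime_factors m \<subseteq> insert p P" using insert.prems(4)[OF m(1)] by auto
      have "prime_factors m' \<subseteq> P"
      proof (cases "p \<in> prime_factors m")
        case True
        thus ?thesis using prime_factors_remove_prime(1)[OF m0(1) True] m0(2) m(2) by auto
      next
        case False
        hence "multiplicity p m = 0" using m0 p
          by (simp add: in_prime_factors_iff not_dvd_imp_multiplicity_0)
        thus ?thesis using m m0 False by auto
      qed
      thus "m' > 0 \<and> prime_factors m' \<subseteq> P" using pos[OF m(1)] m(2) by simp
    qed (use insert in \<open>auto simp: S'_def\<close>)
  qed (use insert in \<open>auto intro!: sum_nonneg nonneg simp: less_imp_le\<close>)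
  also have "\<dots> = (\<Prod>p\<in>insert p P. 1 / (1 - h p))" using insert by simp
  finally show ?case .
qed

text \<open>The product of \<open>1 + a + 4 * a ^ 2\<close> and \<open>1 - a\<close> exceeds 1 by
  \<open>a ^ 2 * (3 - 4 * a)\<close>, hence the limit 3/4. A limit of 1/2 would be too small for
  Rankin's weight at the prime 2.\<close>

lemma inverse_one_minus_le_exp:
  fixes a :: real
  assumes "0 \<le> a" "a \<le> 3 / 4"
  shows "1 / (1 - a) \<le> exp (a + 4 * a\<^sup>2)"
proof -
  have "0 \<le> a\<^sup>2 * (3 - 4 * a)" using assms by (intro mult_nonneg_nonneg) auto
  hence "1 \<le> (1 + (a + 4 * a\<^sup>2)) * (1 - a)"
    by (simp add: algebra_simps power2_eq_square power3_eq_cube)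
  hence "1 / (1 - a) \<le> 1 + (a + 4 * a\<^sup>2)" using assms by (simp add: pos_divide_le_eq)
  also have "\<dots> \<le> exp (a + 4 * a\<^sup>2)" by (rule exp_ge_add_one_self)
  finally show ?thesis .
qed

lemma euler_product_exp_bound:
  fixes h :: "nat \<Rightarrow> real"
  assumes "finite P" "\<And>p. p \<in> P \<Longrightarrow> prime p"
    and nonneg: "\<And>n. h n \<ge> 0" and h1: "h 1 = 1"
    and mult: "\<And>a b. a > 0 \<Longrightarrow> b > 0 \<Longrightarrow> h (a * b) = h a * h b"
    and le: "\<And>p. p \<in> P \<Longrightarrow> h p \<le> 3 / 4"
    and "finite S" "\<And>m. m \<in> S \<Longrightarrow> m > 0 \<and> prime_factors m \<subseteq> P"
  shows "(\<Sum>m\<in>S. h m) \<le> exp (\<Sum>p\<in>P. h p + 4 * (h p)\<^sup>2)"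
proof -
  have "(\<Sum>m\<in>S. h m) \<le> (\<Prod>p\<in>P. 1 / (1 - h p))"
    by (rule euler_product_bound) (use assms in \<open>auto intro: le_less_trans[OF le]\<close>)
  also have "\<dots> \<le> (\<Prod>p\<in>P. exp (h p + 4 * (h p)\<^sup>2))"
  proof (intro prod_mono conjI)
    fix p assume "p \<in> P"
    thus "0 \<le> 1 / (1 - h p)" using le[of p] by simp
    show "1 / (1 - h p) \<le> exp (h p + 4 * (h p)\<^sup>2)"
      by (rule inverse_one_minus_le_exp[OF nonneg le[OF \<open>p \<in> P\<close>]])
  qed
  also have "\<dots> = exp (\<Sum>p\<in>P. h p + 4 * (h p)\<^sup>2)" using assms(1) by (simp add: exp_sum)
  finally show ?thesis .
qed

lemma sum_inverse_squares_le:
  assumes "finite A"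
  shows "(\<Sum>n\<in>A. 1 / real n ^ 2) \<le> (\<Sum>n. 1 / real n ^ 2)"
proof (rule sum_le_suminf)
  show "summable (\<lambda>n. 1 / real n ^ 2)"
    using inverse_power_summable[of 2, where ?'a = real] by (simp add: inverse_eq_divide)
qed (use assms in auto)

text \<open>Counting is reduced to summing \<open>ln n\<close>, which can be opened as a divisor sum
  of \<open>mangoldt\<close>. The loss is the sum of \<open>ln (y / n)\<close>, at most
  \<open>y\<close> by the lower bound for the factorial.\<close>

lemma card_mult_ln_le:
  assumes "A \<subseteq> {1..y}"
  shows "real (card A) * ln (real y) \<le> (\<Sum>n\<in>A. ln (real n)) + real y"
proof -
  have "real (card A) * ln (real y) - (\<Sum>n\<in>A. ln (real n)) = (\<Sum>n\<in>A. ln (real y) - ln (real n))"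
    by (simp add: sum_subtractf)
  also have "\<dots> = (\<Sum>n\<in>A. ln (real y / real n))"
    using assms by (intro sum.cong refl) (auto simp: ln_div subset_iff)
  also have "\<dots> \<le> (\<Sum>n=1..y. ln (real y / real n))"
    using assms by (intro sum_mono2) (auto intro!: ln_ge_zero)
  also have "\<dots> \<le> real y" by (rule sum_ln_ratio_le)
  finally show ?thesis by simp
qed

text \<open>For a fixed cofactor \<open>m\<close> in \<open>B\<close>, Chebyshev bounds the sum over
  \<open>d <= y div m\<close> by \<open>4 * y / m\<close>.\<close>

lemma sum_mangoldt_cofactor_le:
  "(\<Sum>n=1..y. \<Sum>d | d dvd n \<and> n div d \<in> B. mangoldt d :: real) \<le> 4 * real y * (\<Sum>m | m \<in> {1..y} \<and> m \<in> B. 1 / real m)"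
proof -
  define F where "F m d = (if m \<in> B then mangoldt d else 0 :: real)" for m d :: nat
  have "(\<Sum>n=1..y. \<Sum>d | d dvd n \<and> n div d \<in> B. mangoldt d :: real) = (\<Sum>n=1..y. \<Sum>d | d dvd n. F d (n div d))"
  proof (rule sum.cong[OF refl])
    fix n assume n: "n \<in> {1..y}"
    have "(\<Sum>d | d dvd n. F d (n div d)) = (\<Sum>d | d dvd n. F (n div d) d)"
      using n by (intro sum.reindex_bij_witness[where i="\<lambda>d. n div d" and j="\<lambda>d. n div d"]) auto
    also have "\<dots> = (\<Sum>d | d dvd n \<and> n div d \<in> B. mangoldt d)"
      using n by (intro sum.mono_neutral_cong_right) (auto simp: F_def)
    finally show "(\<Sum>d | d dvd n \<and> n div d \<in> B. mangoldt d :: real) = (\<Sum>d | d dvd n. F d (n div d))" by simp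
  qed
  also have "\<dots> = (\<Sum>m=1..y. \<Sum>d=1..y div m. F m d)" by (rule sum_divisors_swap)
  also have "\<dots> \<le> (\<Sum>m=1..y. if m \<in> B then 4 * real y * (1 / real m) else 0)"
  proof (intro sum_mono)
    fix m
    have "(\<Sum>d=1..y div m. mangoldt d) \<le> 4 * real (y div m)" by (rule chebyshev_mangoldt)
    also have "\<dots> \<le> 4 * (real y / real m)" using real_nat_div_le[of y m] by simp
    finally show "(\<Sum>d=1..y div m. F m d) \<le> (if m \<in> B then 4 * real y * (1 / real m) else 0)"
      by (simp add: F_def)
  qed
  also have "\<dots> = 4 * real y * (\<Sum>m | m \<in> {1..y} \<and> m \<in> B. 1 / real m)"
    by (subst sum.inter_filter[symmetric]) (auto simp: sum_distrib_left)
  finally show ?thesis .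
qed

section \<open>Rough numbers\<close>

definition rough_upto :: "nat \<Rightarrow> nat \<Rightarrow> nat set" where
  "rough_upto y t = {n \<in> {1..y}. \<forall>p\<in>prime_factors n. t < p}"

lemma finite_rough_upto [simp]: "finite (rough_upto y t)"
  by (simp add: rough_upto_def)

text \<open>Euler product over the primes in \<open>(t, y]\<close>: the reciprocals exponentiate to
  \<open>ln y / ln t\<close>, and the squares contribute a bounded factor.\<close>

lemma sum_inverse_rough_le:
  obtains C where "C \<ge> 0" "\<And>t y. 2 \<le> t \<Longrightarrow> t \<le> y \<Longrightarrow>
    (\<Sum>m\<in>rough_upto y t. 1 / real m) \<le> C * (ln (real y) / ln (real t))"
proof -
  obtain C where C: "C \<ge> 0" "\<And>t y. 2 \<le> t \<Longrightarrow> t \<le> y \<Longrightarrow>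
    (\<Sum>p | prime p \<and> t < p \<and> p \<le> y. 1 / real p) \<le> ln (ln (real y)) - ln (ln (real t)) + C"
    by (rule mertens_second) metis
  define K where "K = (\<Sum>n. 1 / real n ^ 2)"
  have "(\<Sum>m\<in>rough_upto y t. 1 / real m) \<le> exp (C + 4 * K) * (ln (real y) / ln (real t))"
    if ty: "2 \<le> t" "t \<le> y" for t y
  proof -
    let ?P = "{p. prime p \<and> t < p \<and> p \<le> y}"
    have "(\<Sum>m\<in>rough_upto y t. 1 / real m) \<le> exp (\<Sum>p\<in>?P. 1 / real p + 4 * (1 / real p)\<^sup>2)"
    proof (rule euler_product_exp_bound)
      show "1 / real p \<le> 3 / 4" if "p \<in> ?P" for p
      proof -
        have "real p \<ge> 2" using that ty by auto
        thus ?thesis by (simp add: field_simps)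
      qed
      show "m > 0 \<and> prime_factors m \<subseteq> ?P" if "m \<in> rough_upto y t" for m
        using that by (auto simp: rough_upto_def in_prime_factors_iff dest!: dvd_imp_le)
    qed auto
    also have "\<dots> \<le> exp ((ln (ln (real y)) - ln (ln (real t)) + C) + 4 * K)"
      using C(2)[OF ty] sum_inverse_squares_le[of ?P]
      by (simp add: sum.distrib sum_distrib_left[symmetric] power_one_over[symmetric] K_def)
    also have "\<dots> = exp (C + 4 * K) * (ln (real y) / ln (real t))"
      using ty by (simp add: exp_add exp_diff)
    finally show ?thesis .
  qed
  thus ?thesis using that[of "exp (C + 4 * K)"] by simp
qed

text \<open>An upper-bound sieve by logarithmic weights. When \<open>ln n\<close> is opened as a sum
  of \<open>mangoldt d\<close>, the cofactors \<open>n div d\<close> are again rough, so Chebyshev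
  gives \<open>4 * y\<close> times their harmonic sum O(ln y / ln t); then \<open>ln y\<close> is
  divided out. The additive 1 stands for \<open>n = 1\<close>, the only candidate left if
  \<open>y <= t\<close>.\<close>

lemma card_rough_le:
  obtains C where "C \<ge> 0" "\<And>t y. 2 \<le> t \<Longrightarrow> real (card (rough_upto y t)) \<le> C * (real y / ln (real t)) + 1"
proof -
  obtain C where C: "C \<ge> 0" "\<And>t y. 2 \<le> t \<Longrightarrow> t \<le> y \<Longrightarrow>
    (\<Sum>m\<in>rough_upto y t. 1 / real m) \<le> C * (ln (real y) / ln (real t))"
    using sum_inverse_rough_le by blast
  have "real (card (rough_upto y t)) \<le> (4 * C + 1) * (real y / ln (real t)) + 1"
    if t: "2 \<le> t" for t y
  proof (cases "t < y")
    case False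
    have "rough_upto y t \<subseteq> {1}"
    proof
      fix n assume n: "n \<in> rough_upto y t"
      have "prime_factors n = {}"
      proof (rule ccontr)
        assume "prime_factors n \<noteq> {}"
        then obtain p where p: "p \<in> prime_factors n" by blast
        hence "p \<le> n" using n by (auto simp: in_prime_factors_iff rough_upto_def dest: dvd_imp_le)
        thus False using n p False by (auto simp: rough_upto_def)
      qed
      thus "n \<in> {1}" using n by (auto simp: prime_factorization_empty_iff rough_upto_def)
    qed
    hence "card (rough_upto y t) \<le> 1" using card_mono[of "{1::nat}"] by fastforce
    moreover have "(4 * C + 1) * (real y / ln (real t)) \<ge> 0" using t C(1) by simp
    ultimately show ?thesis by linarith
  next
    case True
    have lny: "ln (real y) > 0" and lnt: "ln (real t) > 0" using t True by auto
    let ?R = "rough_upto y t"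
    have card: "real (card ?R) * ln (real y) \<le> (\<Sum>n\<in>?R. ln (real n)) + real y"
      by (rule card_mult_ln_le) (auto simp: rough_upto_def)
    have "(\<Sum>n\<in>?R. ln (real n)) = (\<Sum>n\<in>?R. \<Sum>d | d dvd n. mangoldt d)"
      by (intro sum.cong refl) (use mangoldt_sum[where ?'a = real] in \<open>auto simp: rough_upto_def\<close>)
    also have "\<dots> = (\<Sum>n\<in>?R. \<Sum>d | d dvd n \<and> n div d \<in> ?R. mangoldt d)"
    proof (intro sum.cong refl)
      fix n d assume n: "n \<in> ?R"
      have "n div d \<in> ?R" if "d dvd n" for d
      proof -
        have "n div d \<le> y" using n div_le_dividend[of n d] by (auto simp: rough_upto_def simp del: div_le_dividend)
        moreover have "n div d dvd n" using that by auto
        hence "prime_factors (n div d) \<subseteq> prime_factors n" using n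
          by (intro dvd_prime_factors) (auto simp: rough_upto_def)
        moreover have "n div d > 0" using that n by (auto simp: rough_upto_def elim!: dvdE)
        ultimately show ?thesis using n by (auto simp: rough_upto_def)
      qed
      thus "{d. d dvd n} = {d. d dvd n \<and> n div d \<in> ?R}" by blast
    qed
    also have "\<dots> \<le> (\<Sum>n=1..y. \<Sum>d | d dvd n \<and> n div d \<in> ?R. mangoldt d)"
      by (intro sum_mono2) (auto simp: rough_upto_def intro!: sum_nonneg mangoldt_nonneg)
    also have "\<dots> \<le> 4 * real y * (\<Sum>m | m \<in> {1..y} \<and> m \<in> ?R. 1 / real m)"
      by (rule sum_mangoldt_cofactor_le)
    also have "{m. m \<in> {1..y} \<and> m \<in> ?R} = ?R" by (auto simp: rough_upto_def)
    also have "4 * real y * (\<Sum>m\<in>?R. 1 / real m) \<le> 4 * real y * (C * (ln (real y) / ln (real t)))"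
      using t True by (intro mult_left_mono C(2)) auto
    finally have "(\<Sum>n\<in>?R. ln (real n)) \<le> 4 * real y * (C * (ln (real y) / ln (real t)))" .
    moreover have "real y \<le> real y * (ln (real y) / ln (real t))"
      using t True by (auto simp: field_simps)
    ultimately have "real (card ?R) * ln (real y) \<le> ((4 * C + 1) * (real y / ln (real t))) * ln (real y)"
      using card by (simp add: algebra_simps)
    hence "real (card ?R) \<le> (4 * C + 1) * (real y / ln (real t))"
      using lny by (rule mult_right_le_imp_le)
    thus ?thesis by simp
  qed
  thus ?thesis using that[of "4 * C + 1"] C(1) by simp
qed

section \<open>Smooth numbers\<close>

lemma exp_le_one_plus_double:
  fixes x :: real
  assumes "0 \<le> x" "x \<le> 1"
  shows "exp x \<le> 1 + 2 * x"
proof -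
  have "x\<^sup>2 \<le> x" using assms by (simp add: power2_eq_square mult_left_le)
  thus ?thesis using exp_bound[OF assms] by simp
qed

lemma sum_prime_reciprocals_le:
  obtains C where "C \<ge> 0" "\<And>y. 2 \<le> y \<Longrightarrow>
    (\<Sum>p | prime p \<and> p \<le> y. 1 / real p) \<le> ln (ln (real y)) + C"
proof -
  obtain C where C: "C \<ge> 0" "\<And>t y. 2 \<le> t \<Longrightarrow> t \<le> y \<Longrightarrow>
    (\<Sum>p | prime p \<and> t < p \<and> p \<le> y. 1 / real p) \<le> ln (ln (real y)) - ln (ln (real t)) + C"
    by (rule mertens_second) metis
  have "(\<Sum>p | prime p \<and> p \<le> y. 1 / real p) \<le> ln (ln (real y)) + (C + 1 + \<bar>ln (ln 2)\<bar>)" if y: "2 \<le> y" for y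
  proof -
    have "{p. prime p \<and> p \<le> y} = insert 2 {p. prime p \<and> 2 < p \<and> p \<le> y}"
      using y by (auto dest: prime_ge_2_nat simp: le_less)
    hence "(\<Sum>p | prime p \<and> p \<le> y. 1 / real p) = 1 / 2 + (\<Sum>p | prime p \<and> 2 < p \<and> p \<le> y. 1 / real p)"
      by simp
    thus ?thesis using C(2)[of 2 y] y by simp
  qed
  thus ?thesis using that[of "C + 1 + \<bar>ln (ln 2)\<bar>"] C(1) by simp
qed

text \<open>Rankin's trick with exponent \<open>1 - 1 / ln T\<close>, where \<open>T = exp (ln y / (2 * ln (ln y)))\<close>.\<close>

lemma card_smooth_le:
  obtains C where "C \<ge> 0" "\<forall>\<^sub>F y in sequentially.
    real (card {m \<in> {1..y}. \<forall>p\<in>prime_factors m. real p \<le> exp (ln (real y) / (2 * ln (ln (real y))))})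
      \<le> C * (real y / ln (real y))"
proof -
  obtain C where C: "C \<ge> 0" "\<And>y. 2 \<le> y \<Longrightarrow>
    (\<Sum>p | prime p \<and> p \<le> y. 1 / real p) \<le> ln (ln (real y)) + C"
    using sum_prime_reciprocals_le by blast
  obtain B where B: "\<And>N. \<bar>(\<Sum>n=1..N. log_prime_ratio n) - ln (real N)\<bar> \<le> B"
    using mertens_first by blast
  have B0: "B \<ge> 0" using B[of 0] by simp
  define K where "K = (\<Sum>n. 1 / real n ^ 2)"
  \<comment> \<open>The exponent collects what the Euler product has beyond
    \<open>ln (1 / e)\<close>: \<open>C\<close> from the sum of \<open>1 / p\<close>,
    \<open>2 * (1 + B)\<close> from the first-order effect of the shift \<open>e\<close>, and
    \<open>36 * K\<close> from the squares, since \<open>h p <= 3 / p\<close>.\<close>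
  define D where "D = exp (C + 2 + 2 * B + 36 * K)"
  have "\<forall>\<^sub>F y in sequentially. ln (ln (real y)) \<ge> 1 \<and> 2 * ln (ln (real y)) / ln (real y) \<le> 1 / 8 \<and> ln (real y) \<ge> 1"
    by (intro eventually_conj; real_asymp)
  hence "\<forall>\<^sub>F y in sequentially.
    real (card {m \<in> {1..y}. \<forall>p\<in>prime_factors m. real p \<le> exp (ln (real y) / (2 * ln (ln (real y))))})
      \<le> D * (real y / ln (real y))"
  proof eventually_elim
    case (elim y)
    define L where "L = ln (real y)"
    define LL where "LL = ln L"
    define e where "e = 2 * LL / L"
    define T where "T = exp (L / (2 * LL))"
    define t where "t = nat \<lfloor>T\<rfloor>"
    let ?S = "{m \<in> {1..y}. \<forall>p\<in>prime_factors m. real p \<le> T}"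
    let ?P = "{p. prime p \<and> p \<le> t}"
    define h where "h n = real n powr (e - 1)" for n :: nat
    from elim have L: "L \<ge> 1" and LL: "LL \<ge> 1" and e: "e \<le> 1 / 8" by (auto simp: L_def LL_def e_def)
    have y: "real y > 0" using L by (cases "y = 0") (auto simp: L_def)
    have e0: "e > 0" using L LL by (simp add: e_def)
    have lnT: "ln T = 1 / e" using L LL by (simp add: T_def e_def)
    have "1 / e \<ge> 8" using e e0 by (simp add: field_simps)
    hence "T \<ge> exp 8" using lnT by (metis exp_le_cancel_iff exp_ln T_def exp_gt_zero)
    moreover have "exp 8 \<ge> 1 + (8::real)" by (rule exp_ge_add_one_self)
    ultimately have T: "T \<ge> 9" by linarith
    hence t: "t \<ge> 2" and tT: "real t \<le> T" by (auto simp: t_def le_nat_floor)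
    have le_t: "p \<le> t \<longleftrightarrow> real p \<le> T" for p :: nat
      using T by (auto simp: t_def le_nat_iff le_floor_iff)
    have lnt: "ln (real t) \<le> 1 / e" using tT t unfolding lnT[symmetric] by simp
    have hp: "h p \<le> 1 / real p * (1 + 2 * (e * ln (real p)))" "e * ln (real p) \<le> 1" if p: "prime p" "p \<le> t" for p
    proof -
      have p2: "p \<ge> 2" using p prime_ge_2_nat by blast
      have "ln (real p) \<le> ln (real t)" using p p2 by simp
      hence "ln (real p) \<le> 1 / e" using lnt by simp
      thus le1: "e * ln (real p) \<le> 1" using e0 by (simp add: field_simps)
      have "h p = exp (e * ln (real p)) / real p"
        using p2 by (simp add: h_def powr_def left_diff_distrib exp_diff)
      also have "\<dots> \<le> (1 + 2 * (e * ln (real p))) / real p"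
        using p2 e0 le1 by (intro divide_right_mono exp_le_one_plus_double) auto
      finally show "h p \<le> 1 / real p * (1 + 2 * (e * ln (real p)))" by simp
    qed
    have "(\<Sum>m\<in>?S. h m) \<le> exp (\<Sum>p\<in>?P. h p + 4 * (h p)\<^sup>2)"
    proof (rule euler_product_exp_bound)
      \<comment> \<open>With \<open>e <= 1 / 8\<close>, the factor \<open>1 + 2 * (e * ln p)\<close>
        is at most \<open>1 + (p - 1) / 4\<close>, which stays below \<open>3 / 4 * p\<close> for
        \<open>p >= 2\<close>.\<close>
      show "h p \<le> 3 / 4" if "p \<in> ?P" for p
      proof -
        have p: "prime p" "p \<le> t" using that by auto
        have p2: "real p \<ge> 2" using p prime_ge_2_nat by force
        have "ln (real p) \<le> real p - 1" using p2 by (intro ln_le_minus_one) auto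
        hence "e * ln (real p) \<le> (1 / 8) * (real p - 1)" using e e0 p2 by (intro mult_mono) auto
        hence "1 + 2 * (e * ln (real p)) \<le> 3 / 4 * real p" using p2 by simp
        hence "1 / real p * (1 + 2 * (e * ln (real p))) \<le> 1 / real p * (3 / 4 * real p)"
          by (intro mult_left_mono) auto
        also have "\<dots> = 3 / 4" using p2 by simp
        finally show ?thesis using hp(1)[OF p] by linarith
      qed
      show "m > 0 \<and> prime_factors m \<subseteq> ?P" if "m \<in> ?S" for m
        using that by (auto simp: in_prime_factors_iff le_t)
    qed (auto simp: h_def powr_mult)
    also have "(\<Sum>p\<in>?P. h p + 4 * (h p)\<^sup>2) \<le> (\<Sum>p\<in>?P. 1 / real p + 2 * e * (ln (real p) / real p) + 36 * (1 / real p ^ 2))"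
    proof (intro sum_mono add_mono)
      fix p assume "p \<in> ?P"
      hence p: "prime p" "p \<le> t" by auto
      show "h p \<le> 1 / real p + 2 * e * (ln (real p) / real p)"
        using hp(1)[OF p] by (simp add: algebra_simps add_divide_distrib)
      have "h p \<le> 1 / real p * 3"
        using hp(1)[OF p] mult_left_mono[of "1 + 2 * (e * ln (real p))" 3 "1 / real p"] hp(2)[OF p] by simp
      hence "(h p)\<^sup>2 \<le> (1 / real p * 3)\<^sup>2" by (intro power_mono) (auto simp: h_def)
      thus "4 * (h p)\<^sup>2 \<le> 36 * (1 / real p ^ 2)" by (simp add: power_divide)
    qed
    also have "\<dots> = (\<Sum>p\<in>?P. 1 / real p) + 2 * e * (\<Sum>p\<in>?P. ln (real p) / real p) + 36 * (\<Sum>p\<in>?P. 1 / real p ^ 2)"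
      by (simp only: sum.distrib sum_distrib_left)
    also have "\<dots> \<le> (ln (1 / e) + C) + 2 * (1 + B) + 36 * K"
    proof (intro add_mono)
      have "ln (ln (real t)) \<le> ln (1 / e)" using lnt t e0 by (subst ln_le_cancel_iff) auto
      thus "(\<Sum>p\<in>?P. 1 / real p) \<le> ln (1 / e) + C" using C(2)[OF t] by linarith
      have "(\<Sum>p\<in>?P. ln (real p) / real p) = (\<Sum>n=1..t. log_prime_ratio n)"
        by (intro sum.mono_neutral_cong_left) (auto simp: log_prime_ratio_def dest: prime_gt_0_nat)
      also have "\<dots> \<le> 1 / e + B" using B[of t] lnt by linarith
      finally have "e * (\<Sum>p\<in>?P. ln (real p) / real p) \<le> e * (1 / e + B)" using e0 by simp
      also have "\<dots> = 1 + e * B" using e0 by (simp add: field_simps)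
      also have "e * B \<le> B" using e B0 mult_right_mono[of e 1 B] by simp
      finally show "2 * e * (\<Sum>p\<in>?P. ln (real p) / real p) \<le> 2 * (1 + B)" by simp
      show "36 * (\<Sum>p\<in>?P. 1 / real p ^ 2) \<le> 36 * K"
        unfolding K_def by (intro mult_left_mono sum_inverse_squares_le) auto
    qed
    also have "exp \<dots> = exp (ln (1 / e)) * D" by (simp add: D_def exp_add[symmetric] algebra_simps)
    also have "exp (ln (1 / e)) = 1 / e" using e0 by simp
    finally have sum_h: "(\<Sum>m\<in>?S. h m) \<le> 1 / e * D" by simp
    \<comment> \<open>Rankin: 1 is at most \<open>(y / m) powr (1 - e)\<close>. The choice of
      \<open>e\<close> makes \<open>y powr e = (ln y) ^ 2\<close>; one factor \<open>ln y\<close>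
      pays for \<open>1 / e\<close>, the other is the saving.\<close>
    have "real (card ?S) = (\<Sum>m\<in>?S. 1)" by simp
    also have "\<dots> \<le> (\<Sum>m\<in>?S. real y powr (1 - e) * h m)"
    proof (intro sum_mono)
      fix m assume "m \<in> ?S"
      hence m: "real m > 0" "real m \<le> real y" by auto
      have "real m powr (1 - e) \<le> real y powr (1 - e)" using m e by (intro powr_mono2) auto
      hence "real m powr (1 - e) * h m \<le> real y powr (1 - e) * h m"
        by (intro mult_right_mono) (auto simp: h_def)
      moreover have "real m powr (1 - e) * h m = 1" using m by (simp add: h_def powr_add[symmetric])
      ultimately show "1 \<le> real y powr (1 - e) * h m" by simp
    qed
    also have "\<dots> = real y powr (1 - e) * (\<Sum>m\<in>?S. h m)" by (simp add: sum_distrib_left)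
    also have "\<dots> \<le> real y powr (1 - e) * (1 / e * D)" by (intro mult_left_mono sum_h) auto
    also have "real y powr (1 - e) = real y / exp (2 * LL)"
    proof -
      have "e * L = 2 * LL" using L by (simp add: e_def)
      hence "real y powr e = exp (2 * LL)" using y by (simp add: powr_def L_def)
      thus ?thesis using y by (simp add: powr_diff)
    qed
    also have "exp (2 * LL) = L\<^sup>2" using L by (simp add: LL_def exp_double)
    also have "real y / L\<^sup>2 * (1 / e * D) = D * (real y / L) / (2 * LL)"
      using L LL by (simp add: e_def field_simps power2_eq_square)
    also have "\<dots> \<le> D * (real y / L) / 1"
      using LL L by (intro divide_left_mono) (auto simp: D_def)
    finally show ?case by (simp add: T_def L_def LL_def)
  qed
  thus ?thesis using that[of D] by (simp add: D_def)
qed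

section \<open>Integers with a given number of prime factors\<close>

lemma sum_primepow_reciprocals_le:
  obtains C where "C \<ge> 0" "\<And>y. 2 \<le> y \<Longrightarrow>
    (\<Sum>q | q \<in> {1..y} \<and> primepow q. 1 / real q) \<le> ln (ln (real y)) + C"
proof -
  obtain C where C: "C \<ge> 0" "\<And>y. 2 \<le> y \<Longrightarrow>
    (\<Sum>p | prime p \<and> p \<le> y. 1 / real p) \<le> ln (ln (real y)) + C"
    using sum_prime_reciprocals_le by blast
  obtain H where H: "H \<ge> 0" "\<And>N. (\<Sum>n | n \<in> {1..N} \<and> \<not> prime n. mangoldt n / real n) \<le> H"
    using sum_mangoldt_nonprime_bounded by blast
  have "(\<Sum>q | q \<in> {1..y} \<and> primepow q. 1 / real q) \<le> ln (ln (real y)) + (C + H / ln 2)"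
    if y: "y \<ge> 2" for y
  proof -
    have "(\<Sum>q | q \<in> {1..y} \<and> primepow q. 1 / real q) =
        (\<Sum>q | prime q \<and> q \<le> y. 1 / real q) + (\<Sum>q | q \<in> {1..y} \<and> primepow q \<and> \<not> prime q. 1 / real q)"
      by (subst sum.union_disjoint[symmetric]) (auto intro!: sum.cong dest: prime_gt_0_nat)
    also have "(\<Sum>q | q \<in> {1..y} \<and> primepow q \<and> \<not> prime q. 1 / real q)
        \<le> (\<Sum>q | q \<in> {1..y} \<and> primepow q \<and> \<not> prime q. mangoldt q / real q / ln 2)"
    proof (intro sum_mono)
      fix q assume q: "q \<in> {q \<in> {1..y}. primepow q \<and> \<not> prime q}"
      hence "prime (aprimedivisor q)" using primepow_gt_Suc_0[of q] by (intro prime_aprimedivisor') auto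
      hence "aprimedivisor q \<ge> 2" by (rule prime_ge_2_nat)
      hence "ln 2 \<le> (mangoldt q :: real)" using q by (auto simp: mangoldt_def)
      thus "1 / real q \<le> mangoldt q / real q / ln 2" using q by (simp add: field_simps)
    qed
    also have "\<dots> \<le> (\<Sum>q | q \<in> {1..y} \<and> \<not> prime q. mangoldt q / real q / ln 2)"
      by (intro sum_mono2) (auto simp: mangoldt_nonneg)
    also have "\<dots> \<le> H / ln 2"
      unfolding sum_divide_distrib[symmetric] using H(2)[of y] by (intro divide_right_mono) auto
    finally show ?thesis using C(2)[OF y] by linarith
  qed
  thus ?thesis using that[of "C + H / ln 2"] C(1) H(1) by simp
qed

text \<open>Splitting off the full power of the largest prime maps \<open>m\<close> injectively to a
  prime power and a number with one prime factor fewer. The order of the primes is forgotten; the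
  factor \<open>1 / s!\<close> lost thereby is harmless for bounded \<open>s\<close>.\<close>

lemma sum_reciprocals_omega_le:
  "(\<Sum>m | m \<in> {1..N} \<and> omega m = s. 1 / real m) \<le> (\<Sum>q | q \<in> {1..N} \<and> primepow q. 1 / real q) ^ s"
proof (induction s)
  case 0
  have "{m. m \<in> {1..N} \<and> omega m = 0} \<subseteq> {1}"
    by (auto simp: omega_def prime_factorization_empty_iff)
  hence "(\<Sum>m | m \<in> {1..N} \<and> omega m = 0. 1 / real m) \<le> (\<Sum>m\<in>{1::nat}. 1 / real m)"
    by (intro sum_mono2) auto
  thus ?case by simp
next
  case (Suc s)
  let ?Q = "{q. q \<in> {1..N} \<and> primepow q}"
  let ?A = "\<lambda>s. {m. m \<in> {1..N} \<and> omega m = s}"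
  define p where "p m = Max (prime_factors m)" for m :: nat
  define \<phi> where "\<phi> m = (p m ^ multiplicity (p m) m, m div p m ^ multiplicity (p m) m)" for m
  have pm: "p m \<in> prime_factors m" if "m \<in> ?A (Suc s)" for m
  proof -
    have "prime_factors m \<noteq> {}" using that by (auto simp: omega_def)
    thus ?thesis unfolding p_def by (intro Max_in) auto
  qed
  have prod: "fst (\<phi> m) * snd (\<phi> m) = m" for m by (simp add: \<phi>_def multiplicity_dvd)
  have sub: "\<phi> ` ?A (Suc s) \<subseteq> ?Q \<times> ?A s"
  proof
    fix x assume "x \<in> \<phi> ` ?A (Suc s)"
    then obtain m where m: "m \<in> ?A (Suc s)" "x = \<phi> m" by blast
    have m0: "m > 0" using m by auto
    note r = prime_factors_remove_prime[OF m0 pm[OF m(1)]]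
    have pp: "primepow (fst (\<phi> m))" using r(3) pm[OF m(1)] by (simp add: \<phi>_def in_prime_factors_iff)
    have "omega (snd (\<phi> m)) = s"
      using m(1) pm[OF m(1)] r(1) by (simp add: omega_def \<phi>_def)
    moreover have "fst (\<phi> m) > 0" "snd (\<phi> m) > 0" using prod[of m] m0 by (metis mult_is_0 neq0_conv)+
    moreover have "fst (\<phi> m) \<le> N" "snd (\<phi> m) \<le> N"
      using prod[of m] m(1) dvd_imp_le[OF _ m0] dvd_triv_left dvd_triv_right
      by (metis (no_types, lifting) atLeastAtMost_iff le_trans mem_Collect_eq)+
    ultimately show "x \<in> ?Q \<times> ?A s" using pp m(2) by (auto simp: mem_Times_iff Suc_le_eq)
  qed
  have "(\<Sum>m\<in>?A (Suc s). 1 / real m) = (\<Sum>m\<in>?A (Suc s). (\<lambda>(q,m). 1 / real q * (1 / real m)) (\<phi> m))"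
  proof (intro sum.cong refl)
    fix m
    show "1 / real m = (\<lambda>(q,m). 1 / real q * (1 / real m)) (\<phi> m)"
      by (subst prod[of m, symmetric]) (simp add: case_prod_beta del: of_nat_div)
  qed
  also have "\<dots> = (\<Sum>x\<in>\<phi> ` ?A (Suc s). (\<lambda>(q,m). 1 / real q * (1 / real m)) x)"
  proof (subst sum.reindex)
    show "inj_on \<phi> (?A (Suc s))"
      by (rule inj_on_inverseI[where g = "\<lambda>x. fst x * snd x"]) (rule prod)
  qed simp
  also have "\<dots> \<le> (\<Sum>x\<in>?Q \<times> ?A s. (\<lambda>(q,m). 1 / real q * (1 / real m)) x)"
    using sub by (intro sum_mono2) auto
  also have "\<dots> = (\<Sum>q\<in>?Q. 1 / real q) * (\<Sum>m\<in>?A s. 1 / real m)"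
    by (simp add: sum_product sum.cartesian_product)
  also have "\<dots> \<le> (\<Sum>q\<in>?Q. 1 / real q) * (\<Sum>q\<in>?Q. 1 / real q) ^ s"
    by (intro mult_left_mono Suc.IH sum_nonneg) auto
  finally show ?case by simp
qed

text \<open>The threshold is 27 = 3 ^ 3 because \<open>exp 1 <= 3\<close>. With
  \<open>ln (ln N) >= 1\<close>, constants and lower powers can be absorbed into higher powers of
  \<open>ln (ln N)\<close>.\<close>

lemma ln_ln_ge_1:
  assumes "N \<ge> (27::real)"
  shows "ln (ln N) \<ge> 1" "ln N \<ge> 3"
proof -
  have "exp 3 = exp (1::real) ^ 3" by (simp add: exp_of_nat_mult[symmetric])
  also have "\<dots> \<le> 3 ^ 3" using exp_le by (intro power_mono) auto
  finally have "exp 3 \<le> N" using assms by simp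
  thus L: "ln N \<ge> 3" using assms by (simp add: ln_ge_iff)
  show "ln (ln N) \<ge> 1" using L exp_le by (subst ln_ge_iff) auto
qed

lemma sum_reciprocals_omega_loglog:
  obtains C where "C \<ge> 0" "\<And>N s. 27 \<le> N \<Longrightarrow>
    (\<Sum>m | m \<in> {1..N} \<and> omega m = s. 1 / real m) \<le> C ^ s * ln (ln (real N)) ^ s"
proof -
  obtain C where C: "C \<ge> 0" "\<And>y. 2 \<le> y \<Longrightarrow>
    (\<Sum>q | q \<in> {1..y} \<and> primepow q. 1 / real q) \<le> ln (ln (real y)) + C"
    using sum_primepow_reciprocals_le by blast
  have "(\<Sum>m | m \<in> {1..N} \<and> omega m = s. 1 / real m) \<le> (1 + C) ^ s * ln (ln (real N)) ^ s"
    if N: "27 \<le> N" for N s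
  proof -
    have "C * 1 \<le> C * ln (ln (real N))"
      using ln_ln_ge_1[of "real N"] N C(1) by (intro mult_left_mono) auto
    hence "(\<Sum>q | q \<in> {1..N} \<and> primepow q. 1 / real q) \<le> (1 + C) * ln (ln (real N))"
      using C(2)[of N] N by (simp add: distrib_right)
    hence "(\<Sum>q | q \<in> {1..N} \<and> primepow q. 1 / real q) ^ s \<le> ((1 + C) * ln (ln (real N))) ^ s"
      by (intro power_mono sum_nonneg) auto
    thus ?thesis using sum_reciprocals_omega_le[where N = N and s = s]
      by (simp only: power_mult_distrib)
  qed
  thus ?thesis using that[of "1 + C"] C(1) by simp
qed

text \<open>A prime \<open>p\<close> is represented by its full power in \<open>m\<close>: dividing
  that out lowers \<open>omega\<close> by exactly one, whereas dividing by \<open>p\<close> itself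
  need not.\<close>

lemma sum_ln_prime_factors_le:
  assumes "m > 0" "omega m = Suc s"
  shows "(\<Sum>p\<in>prime_factors m. ln (real p)) \<le> (\<Sum>d | d dvd m \<and> m div d \<in> {n. omega n = s}. mangoldt d)"
proof -
  define q where "q p = p ^ multiplicity p m" for p
  have "(\<Sum>p\<in>prime_factors m. ln (real p)) = (\<Sum>p\<in>prime_factors m. mangoldt (q p))"
    using prime_factors_remove_prime(3)[OF assms(1)]
    by (intro sum.cong refl) (auto simp: q_def in_prime_factors_iff)
  also have "\<dots> = (\<Sum>d\<in>q ` prime_factors m. mangoldt d)"
  proof (subst sum.reindex)
    show "inj_on q (prime_factors m)"
    proof (rule inj_on_inverseI[where g = aprimedivisor])
      fix p assume p: "p \<in> prime_factors m"
      thus "aprimedivisor (q p) = p"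
        using prime_factors_remove_prime(3)[OF assms(1) p] unfolding q_def
        by (intro aprimedivisor_prime_power) auto
    qed
  qed simp
  also have "\<dots> \<le> (\<Sum>d | d dvd m \<and> m div d \<in> {n. omega n = s}. mangoldt d)"
  proof (intro sum_mono2)
    show "finite {d. d dvd m \<and> m div d \<in> {n. omega n = s}}"
      using assms(1) by (intro finite_subset[OF _ finite_divisors_nat[of m]]) auto
    show "q ` prime_factors m \<subseteq> {d. d dvd m \<and> m div d \<in> {n. omega n = s}}"
      using prime_factors_remove_prime(1)[OF assms(1)] assms(2)
      by (auto simp: q_def multiplicity_dvd omega_def)
  qed (rule mangoldt_nonneg)
  finally show ?thesis .
qed

text \<open>Landau's upper bound, by the method of \<open>card_rough_le\<close>. The primes in
  \<open>ln m\<close> lead to cofactors with one prime factor fewer, whose harmonic sum is bounded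
  by a power of \<open>ln (ln N)\<close>; the proper prime powers give only O(N). For
  \<open>s = 0\<close> the truncated \<open>s - 1\<close> is 0 and the set has at most one
  element.\<close>

lemma card_omega_le:
  obtains C where "C \<ge> 0" "\<And>N. 27 \<le> N \<Longrightarrow>
    real (card {m \<in> {1..N}. omega m = s}) \<le> C * (real N * ln (ln (real N)) ^ (s - 1) / ln (real N))"
proof (cases s)
  case 0
  have "real (card {m \<in> {1..N}. omega m = s}) \<le> 1 * (real N * ln (ln (real N)) ^ (s - 1) / ln (real N))"
    if N: "27 \<le> N" for N
  proof -
    have "{m \<in> {1..N}. omega m = s} \<subseteq> {1}"
      using 0 by (auto simp: omega_def prime_factorization_empty_iff)
    hence "card {m \<in> {1..N}. omega m = s} \<le> 1" using card_mono[of "{1::nat}"] by fastforce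
    moreover have "ln (real N) \<le> real N" using N ln_le_minus_one[of "real N"] by simp
    hence "1 \<le> real N / ln (real N)" using N by simp
    ultimately show ?thesis using 0 by simp
  qed
  thus ?thesis using that[of 1] by simp
next
  case (Suc r)
  obtain C where C: "C \<ge> 0" "\<And>N s. 27 \<le> N \<Longrightarrow>
      (\<Sum>m | m \<in> {1..N} \<and> omega m = s. 1 / real m) \<le> C ^ s * ln (ln (real N)) ^ s"
    using sum_reciprocals_omega_loglog by blast
  obtain H where H: "H \<ge> 0" "\<And>N. (\<Sum>n | n \<in> {1..N} \<and> \<not> prime n. mangoldt n / real n) \<le> H"
    using sum_mangoldt_nonprime_bounded by blast
  have "real (card {m \<in> {1..N}. omega m = s}) \<le> (4 * C ^ r + H + 1) * (real N * ln (ln (real N)) ^ (s - 1) / ln (real N))"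
    if N: "27 \<le> N" for N
  proof -
    let ?A = "{m \<in> {1..N}. omega m = s}"
    let ?LL = "ln (ln (real N)) ^ r"
    have LL: "?LL \<ge> 1" and L: "ln (real N) > 0"
      using ln_ln_ge_1[of "real N"] N by (auto intro: one_le_power)
    define F where "F e m = (if prime e then 0 else mangoldt e :: real)" for e m :: nat
    have "(\<Sum>m\<in>?A. ln (real m)) \<le>
        (\<Sum>m\<in>?A. (\<Sum>d | d dvd m \<and> m div d \<in> {n. omega n = r}. mangoldt d) + (\<Sum>e | e dvd m. F e (m div e)))"
    proof (intro sum_mono)
      fix m assume m: "m \<in> ?A"
      hence m0: "m > 0" by auto
      have "ln (real m) = (\<Sum>d | d dvd m. mangoldt d)"
        using mangoldt_sum[of m, where ?'a = real] m0 by simp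
      also have "\<dots> = (\<Sum>d | d dvd m. (if prime d then ln (real d) else 0) + F d (m div d))"
        by (intro sum.cong refl) (auto simp: F_def)
      also have "\<dots> = (\<Sum>d | d dvd m. if prime d then ln (real d) else 0) + (\<Sum>d | d dvd m. F d (m div d))"
        by (rule sum.distrib)
      also have "(\<Sum>d | d dvd m. if prime d then ln (real d) else 0) = (\<Sum>p\<in>prime_factors m. ln (real p))"
        using m0 by (intro sum.mono_neutral_cong_right) (auto simp: in_prime_factors_iff)
      also have "\<dots> \<le> (\<Sum>d | d dvd m \<and> m div d \<in> {n. omega n = r}. mangoldt d)"
        using m m0 Suc by (intro sum_ln_prime_factors_le) auto
      finally show "ln (real m) \<le> (\<Sum>d | d dvd m \<and> m div d \<in> {n. omega n = r}. mangoldt d) + (\<Sum>e | e dvd m. F e (m div e))"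
        by simp
    qed
    also have "\<dots> \<le> (\<Sum>m=1..N. (\<Sum>d | d dvd m \<and> m div d \<in> {n. omega n = r}. mangoldt d) + (\<Sum>e | e dvd m. F e (m div e)))"
      by (intro sum_mono2) (auto simp: F_def intro!: add_nonneg_nonneg sum_nonneg mangoldt_nonneg)
    also have "\<dots> = (\<Sum>m=1..N. \<Sum>d | d dvd m \<and> m div d \<in> {n. omega n = r}. mangoldt d)
        + (\<Sum>m=1..N. \<Sum>e | e dvd m. F e (m div e))" by (rule sum.distrib)
    also have "(\<Sum>m=1..N. \<Sum>d | d dvd m \<and> m div d \<in> {n. omega n = r}. mangoldt d :: real)
        \<le> 4 * real N * (\<Sum>m | m \<in> {1..N} \<and> m \<in> {n. omega n = r}. 1 / real m)"
      by (rule sum_mangoldt_cofactor_le)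
    also have "\<dots> \<le> 4 * real N * (C ^ r * ?LL)"
      using C(2)[OF N, of r] by (intro mult_left_mono) auto
    also have "(\<Sum>m=1..N. \<Sum>e | e dvd m. F e (m div e)) = (\<Sum>e=1..N. \<Sum>m=1..N div e. F e m)"
      by (rule sum_divisors_swap)
    also have "\<dots> \<le> (\<Sum>e=1..N. if \<not> prime e then real N * (mangoldt e / real e) else 0)"
    proof (intro sum_mono)
      fix e
      have "mangoldt e * real (N div e) \<le> mangoldt e * (real N / real e)"
        by (intro mult_left_mono mangoldt_nonneg real_nat_div_le)
      thus "(\<Sum>m=1..N div e. F e m) \<le> (if \<not> prime e then real N * (mangoldt e / real e) else 0)"
        by (simp add: F_def mult.commute)
    qed
    also have "\<dots> = real N * (\<Sum>n | n \<in> {1..N} \<and> \<not> prime n. mangoldt n / real n)"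
      by (subst sum.inter_filter[symmetric]) (auto simp: sum_distrib_left)
    also have "\<dots> \<le> real N * H" using H(2)[of N] by (intro mult_left_mono) auto
    finally have "(\<Sum>m\<in>?A. ln (real m)) \<le> 4 * real N * (C ^ r * ?LL) + real N * H" by simp
    moreover have "real (card ?A) * ln (real N) \<le> (\<Sum>m\<in>?A. ln (real m)) + real N"
      by (rule card_mult_ln_le) auto
    moreover have "real N * (H + 1) * 1 \<le> real N * (H + 1) * ?LL"
      using LL H(1) by (intro mult_left_mono) auto
    ultimately have "real (card ?A) * ln (real N) \<le> (4 * C ^ r + H + 1) * (real N * ?LL)"
      by (simp add: algebra_simps)
    thus ?thesis using L Suc by (simp add: pos_le_divide_eq)
  qed
  thus ?thesis using that[of "4 * C ^ r + H + 1"] C(1) H(1) by simp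
qed

section \<open>Duality between smallest and largest prime factors\<close>

abbreviation \<mu> :: "nat \<Rightarrow> real" where
  "\<mu> n \<equiv> real_of_int (moebius_mu n)"

lemma prime_factorization_prod_primes:
  fixes T :: "nat set"
  assumes "finite T" "\<And>p. p \<in> T \<Longrightarrow> prime p"
  shows "prime_factorization (\<Prod>T) = mset_set T"
proof -
  have "\<Prod>T = prod_mset (mset_set T)" using prod_unfold_prod_mset[of "\<lambda>x. x" T] by simp
  thus ?thesis using assms by (simp, intro prime_factorization_prod_mset_primes) auto
qed

lemma sum_moebius_conv_subsets:
  fixes G :: "nat set \<Rightarrow> real"
  assumes "m > 0"
  shows "(\<Sum>d | d dvd m. \<mu> d * G (prime_factors d)) =
         (\<Sum>T\<in>Pow (prime_factors m). (-1) ^ card T * G T)"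
proof -
  have "(\<Sum>d | d dvd m. \<mu> d * G (prime_factors d)) =
        (\<Sum>d | d dvd m \<and> squarefree d. (-1) ^ card (prime_factors d) * G (prime_factors d))"
    using assms by (intro sum.mono_neutral_cong_right) (auto simp: moebius_mu_def)
  also have "\<dots> = (\<Sum>T\<in>Pow (prime_factors m). (-1) ^ card T * G T)"
  proof (rule sum.reindex_bij_witness[where i = "\<lambda>T. \<Prod>T" and j = prime_factors])
    fix d assume "d \<in> {d. d dvd m \<and> squarefree d}"
    hence d: "d dvd m" "squarefree d" "d > 0" using assms by (auto intro: Nat.gr0I)
    show "prime_factors d \<in> Pow (prime_factors m)"
      using d assms dvd_prime_factors[of m d] by auto
    have "d = (\<Prod>p\<in>prime_factors d. p ^ multiplicity p d)"
      using d by (intro prime_factorization_nat) auto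
    also have "\<dots> = (\<Prod>p\<in>prime_factors d. p)"
      using d by (intro prod.cong refl) (auto simp: squarefree_factorial_semiring')
    finally show "\<Prod>(prime_factors d) = d" by simp
  next
    fix T assume "T \<in> Pow (prime_factors m)"
    hence T: "T \<subseteq> prime_factors m" "finite T" "\<And>p. p \<in> T \<Longrightarrow> prime p"
      by (auto intro: finite_subset)
    note pf = prime_factorization_prod_primes[OF T(2,3)]
    show *: "prime_factors (\<Prod>T) = T" using T by (simp add: pf)
    have sqf: "squarefree (\<Prod>T)"
      using T by (intro squarefree_prod_coprime) (auto intro: primes_coprime squarefree_prime)
    have "\<Prod>T dvd (\<Prod>p\<in>prime_factors m. p)"
      by (rule prod_dvd_prod_subset) (use T in auto)
    also have "\<dots> dvd (\<Prod>p\<in>prime_factors m. p ^ multiplicity p m)"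
      using assms prime_factors_remove_prime(3)[OF assms] by (intro prod_dvd_prod) (auto intro!: dvd_power)
    also have "\<dots> = m" using assms by (intro prime_factorization_nat[symmetric])
    finally show "\<Prod>T \<in> {d. d dvd m \<and> squarefree d}" using sqf by simp
  qed auto
  finally show ?thesis .
qed

lemma sum_Pow_card:
  fixes h :: "nat \<Rightarrow> real"
  assumes "finite B"
  shows "(\<Sum>T\<in>Pow B. h (card T)) = (\<Sum>t\<le>card B. real (card B choose t) * h t)"
proof -
  have "(\<Sum>T\<in>Pow B. h (card T)) = (\<Sum>t\<in>{..card B}. \<Sum>T\<in>{T. T \<in> Pow B \<and> card T = t}. h (card T))"
    using assms by (intro sum.group[symmetric]) (auto intro: card_mono)
  also have "\<dots> = (\<Sum>t\<le>card B. real (card B choose t) * h t)"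
  proof (intro sum.cong refl)
    fix t
    show "(\<Sum>T\<in>{T. T \<in> Pow B \<and> card T = t}. h (card T)) = real (card B choose t) * h t"
      using n_subsets[OF assms, of t] by simp
  qed
  finally show ?thesis .
qed

lemma sum_Pow_minus_one:
  assumes "finite B"
  shows "(\<Sum>T\<in>Pow B. (-1) ^ card T) = (if B = {} then 1 else 0 :: real)"
proof (cases "B = {}")
  case False
  hence "card B > 0" using assms by (simp add: card_gt_0_iff)
  thus ?thesis using sum_Pow_card[OF assms, of "\<lambda>t. (-1) ^ t"] False
      choose_alternating_sum[of "card B", where ?'a = real] by (simp add: mult.commute)
qed simp

lemma sum_moebius_divisors:
  assumes "m > 0"
  shows "(\<Sum>d | d dvd m. \<mu> d) = (if m = 1 then 1 else 0)"
  using sum_moebius_conv_subsets[OF assms, of "\<lambda>_. 1"] sum_Pow_minus_one[of "prime_factors m"] assms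
  by (simp add: prime_factorization_empty_iff)

lemma sum_moebius_rough_divisors:
  assumes "m > 0"
  shows "(\<Sum>d | d dvd m \<and> (\<forall>p\<in>prime_factors d. t < p). \<mu> d) =
         (if \<forall>p\<in>prime_factors m. p \<le> t then 1 else 0)"
proof -
  let ?G = "\<lambda>T. if \<forall>p\<in>T. t < p then 1 else 0 :: real"
  let ?B = "{p \<in> prime_factors m. t < p}"
  have "(\<Sum>d | d dvd m \<and> (\<forall>p\<in>prime_factors d. t < p). \<mu> d) =
        (\<Sum>d | d dvd m. \<mu> d * ?G (prime_factors d))"
    using assms by (intro sum.mono_neutral_cong_left) auto
  also have "\<dots> = (\<Sum>T\<in>Pow (prime_factors m). (-1) ^ card T * ?G T)"
    by (rule sum_moebius_conv_subsets[OF assms])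
  also have "\<dots> = (\<Sum>T\<in>Pow ?B. (-1) ^ card T)"
    by (intro sum.mono_neutral_cong_right) auto
  also have "\<dots> = (if ?B = {} then 1 else 0)" by (rule sum_Pow_minus_one) auto
  also have "?B = {} \<longleftrightarrow> (\<forall>p\<in>prime_factors m. p \<le> t)" by (auto simp: not_less)
  finally show ?thesis .
qed

text \<open>Up to sign this is the \<open>s\<close>-th finite difference of \<open>g\<close> at 1.
  In the duality, \<open>t\<close> is the number of primes chosen among the \<open>s\<close> larger
  ones to form, together with the prime in question, the prime factors of a squarefree
  divisor.\<close>

definition duality_coeff :: "(nat \<Rightarrow> real) \<Rightarrow> nat \<Rightarrow> real" where
  "duality_coeff g s = - (\<Sum>t\<le>s. real (s choose t) * ((-1) ^ t * g (t + 1)))"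

lemma sum_nonempty_subsets_by_Min:
  fixes H :: "nat set \<Rightarrow> real"
  assumes "finite A"
  shows "(\<Sum>T\<in>Pow A - {{}}. H T) = (\<Sum>p\<in>A. \<Sum>U\<in>Pow {q \<in> A. p < q}. H (insert p U))"
proof -
  have Min: "Min (insert p U) = p" if "U \<in> Pow {q \<in> A. p < q}" for p U
    using that assms by (intro Min_eqI) (auto intro: finite_subset)
  have "(\<Sum>T\<in>Pow A - {{}}. H T) = (\<Sum>(p,U)\<in>(SIGMA p:A. Pow {q \<in> A. p < q}). H (insert p U))"
  proof (rule sum.reindex_bij_witness[where i = "\<lambda>(p,U). insert p U" and j = "\<lambda>T. (Min T, T - {Min T})"])
    fix T assume T: "T \<in> Pow A - {{}}"
    hence fin: "finite T" "T \<noteq> {}" "T \<subseteq> A" using assms by (auto intro: finite_subset)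
    have m: "Min T \<in> T" using fin by (intro Min_in)
    hence "Min T \<in> A" using fin by blast
    show "(case (Min T, T - {Min T}) of (p, U) \<Rightarrow> insert p U) = T" using m by auto
    show "(Min T, T - {Min T}) \<in> (SIGMA p:A. Pow {q \<in> A. p < q})"
      using m fin Min_le[OF fin(1)] \<open>Min T \<in> A\<close> by (auto simp: order.strict_iff_order)
    show "(case (Min T, T - {Min T}) of (p, U) \<Rightarrow> H (insert p U)) = H T" using m by (simp add: insert_absorb)
  next
    fix x assume "x \<in> (SIGMA p:A. Pow {q \<in> A. p < q})"
    then obtain p U where x: "x = (p, U)" "p \<in> A" "U \<in> Pow {q \<in> A. p < q}" by blast
    have "p \<notin> U" using x by auto
    thus "(Min (case x of (p, U) \<Rightarrow> insert p U), (case x of (p, U) \<Rightarrow> insert p U) -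
            {Min (case x of (p, U) \<Rightarrow> insert p U)}) = x"
      using Min[OF x(3)] x(1) by simp
    show "(case x of (p, U) \<Rightarrow> insert p U) \<in> Pow A - {{}}" using x by auto
  qed
  also have "\<dots> = (\<Sum>p\<in>A. \<Sum>U\<in>Pow {q \<in> A. p < q}. H (insert p U))"
    using assms by (subst sum.Sigma) auto
  finally show ?thesis .
qed

text \<open>Alladi's duality: summing over the smallest prime factor of the divisors of \<open>m\<close>
  becomes a sum over the prime factors of \<open>m\<close> weighted by how many larger prime factors there are.\<close>

lemma smallest_largest_duality:
  fixes f g :: "nat \<Rightarrow> real"
  assumes "m > 0"
  shows "(\<Sum>n | n dvd m \<and> 2 \<le> n. \<mu> n * g (omega n) * f (smallest_prime_factor n))
       = (\<Sum>p\<in>prime_factors m. f p * duality_coeff g (card {q \<in> prime_factors m. p < q}))"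
proof -
  let ?G = "\<lambda>T. if T = {} then 0 else g (card T) * f (Min T)"
  let ?A = "prime_factors m"
  have "(\<Sum>n | n dvd m \<and> 2 \<le> n. \<mu> n * g (omega n) * f (smallest_prime_factor n))
      = (\<Sum>n | n dvd m. \<mu> n * ?G (prime_factors n))"
  proof (intro sum.mono_neutral_cong_left)
    show "\<forall>n\<in>{n. n dvd m} - {n. n dvd m \<and> 2 \<le> n}. \<mu> n * ?G (prime_factors n) = 0"
    proof
      fix n assume "n \<in> {n. n dvd m} - {n. n dvd m \<and> 2 \<le> n}"
      hence "n = 0 \<or> n = 1" by auto
      thus "\<mu> n * ?G (prime_factors n) = 0" by auto
    qed
    fix n assume "n \<in> {n. n dvd m \<and> 2 \<le> n}"
    hence "n \<ge> 2" by auto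
    hence "prime_factors n \<noteq> {}" by (auto simp: prime_factorization_empty_iff)
    thus "\<mu> n * g (omega n) * f (smallest_prime_factor n) =
        \<mu> n * ?G (prime_factors n)"
      by (simp add: omega_def smallest_prime_factor_def)
  qed (use assms in auto)
  also have "\<dots> = (\<Sum>T\<in>Pow ?A. (-1) ^ card T * ?G T)"
    by (rule sum_moebius_conv_subsets[OF assms])
  also have "\<dots> = (\<Sum>T\<in>Pow ?A - {{}}. (-1) ^ card T * (g (card T) * f (Min T)))"
    by (intro sum.mono_neutral_cong_right) auto
  also have "\<dots> = (\<Sum>p\<in>?A. \<Sum>U\<in>Pow {q \<in> ?A. p < q}. (-1) ^ card (insert p U) * (g (card (insert p U)) * f (Min (insert p U))))"
    by (intro sum_nonempty_subsets_by_Min) auto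
  also have "\<dots> = (\<Sum>p\<in>?A. f p * duality_coeff g (card {q \<in> ?A. p < q}))"
  proof (intro sum.cong refl)
    fix p assume p: "p \<in> ?A"
    let ?B = "{q \<in> ?A. p < q}"
    have "(\<Sum>U\<in>Pow ?B. (-1) ^ card (insert p U) * (g (card (insert p U)) * f (Min (insert p U)))) =
        (\<Sum>U\<in>Pow ?B. - f p * ((-1) ^ card U * g (card U + 1)))"
    proof (rule sum.cong[OF refl])
      fix U assume U: "U \<in> Pow ?B"
      hence fin: "finite U" "p \<notin> U" by (auto intro: finite_subset)
      have "Min (insert p U) = p" using U fin by (intro Min_eqI) auto
      thus "(-1) ^ card (insert p U) * (g (card (insert p U)) * f (Min (insert p U))) =
          - f p * ((-1) ^ card U * g (card U + 1))" using fin by simp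
    qed
    also have "\<dots> = - f p * (\<Sum>U\<in>Pow ?B. (-1) ^ card U * g (card U + 1))"
      by (rule sum_distrib_left[symmetric])
    also have "(\<Sum>U\<in>Pow ?B. (-1) ^ card U * g (card U + 1)) =
        (\<Sum>t\<le>card ?B. real (card ?B choose t) * ((-1) ^ t * g (t + 1)))"
      by (rule sum_Pow_card) auto
    finally show "(\<Sum>U\<in>Pow ?B. (-1) ^ card (insert p U) * (g (card (insert p U)) * f (Min (insert p U)))) =
        f p * duality_coeff g (card ?B)" by (simp add: duality_coeff_def)
  qed
  finally show ?thesis .
qed

text \<open>With \<open>g = 1\<close> only the prime without larger ones survives: the classical
  duality of largest and smallest prime factors.\<close>

lemma duality_coeff_const: "duality_coeff (\<lambda>_. 1) s = (if s = 0 then -1 else 0)"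
proof (cases "s = 0")
  case False
  thus ?thesis using choose_alternating_sum[of s, where ?'a = real]
    by (simp add: duality_coeff_def mult.commute)
qed (simp add: duality_coeff_def)

text \<open>Induction on the degree: one factor \<open>t + a\<close> is split, and \<open>t\<close>
  is absorbed into the binomial coefficient, which lowers \<open>s\<close> by one and shifts the
  index. The shift changes \<open>a\<close>, which therefore has to be arbitrary.\<close>

lemma alternating_binomial_power_eq_0:
  fixes a :: real
  assumes "d < s"
  shows "(\<Sum>t\<le>s. real (s choose t) * ((-1) ^ t * (real t + a) ^ d)) = 0"
  using assms
proof (induction d arbitrary: s a)
  case 0
  thus ?case using choose_alternating_sum[of s, where ?'a = real] by (simp add: mult.commute)
next
  case (Suc d)
  then obtain r where s: "s = Suc r" "d < r" by (cases s) auto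
  have "(\<Sum>t\<le>s. real (s choose t) * ((-1) ^ t * (real t + a) ^ Suc d)) =
      (\<Sum>t\<le>s. a * (real (s choose t) * ((-1) ^ t * (real t + a) ^ d)) +
        (real t * real (s choose t)) * ((-1) ^ t * (real t + a) ^ d))"
    by (intro sum.cong refl) (simp add: algebra_simps)
  also have "\<dots> = a * (\<Sum>t\<le>s. real (s choose t) * ((-1) ^ t * (real t + a) ^ d)) +
      (\<Sum>t\<le>s. (real t * real (s choose t)) * ((-1) ^ t * (real t + a) ^ d))"
    by (simp only: sum.distrib sum_distrib_left)
  also have "(\<Sum>t\<le>s. real (s choose t) * ((-1) ^ t * (real t + a) ^ d)) = 0"
    using Suc.IH[of s a] Suc.prems by simp
  also have "(\<Sum>t\<le>s. (real t * real (s choose t)) * ((-1) ^ t * (real t + a) ^ d)) =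
      (\<Sum>t\<le>r. (real (Suc t) * real (s choose Suc t)) * ((-1) ^ Suc t * (real (Suc t) + a) ^ d))"
    unfolding s(1) by (subst sum.atMost_Suc_shift) simp
  also have "\<dots> = (\<Sum>t\<le>r. - real s * (real (r choose t) * ((-1) ^ t * (real t + (1 + a)) ^ d)))"
  proof (intro sum.cong refl)
    fix t
    have "real (Suc t) * real (s choose Suc t) = real s * real (r choose t)"
      unfolding s(1) using binomial_absorption[of t "Suc r"] by (metis diff_Suc_1 of_nat_mult)
    thus "(real (Suc t) * real (s choose Suc t)) * ((-1) ^ Suc t * (real (Suc t) + a) ^ d) =
        - real s * (real (r choose t) * ((-1) ^ t * (real t + (1 + a)) ^ d))"
      by (simp add: algebra_simps)
  qed
  also have "\<dots> = - real s * (\<Sum>t\<le>r. real (r choose t) * ((-1) ^ t * (real t + (1 + a)) ^ d))"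
    by (rule sum_distrib_left[symmetric])
  also have "\<dots> = 0" using Suc.IH[OF s(2), of "1 + a"] by simp
  finally show ?case by simp
qed

lemma duality_coeff_power_eq_0:
  assumes "d < s"
  shows "duality_coeff (\<lambda>n. real n ^ d) s = 0"
  using alternating_binomial_power_eq_0[OF assms, of 1] by (simp add: duality_coeff_def add.commute)

text \<open>By the hockey-stick identity the coefficients \<open>s choose t\<close> with
  \<open>s < k\<close> add up to \<open>k choose Suc t\<close>. This turns the sum into a
  \<open>k\<close>-th difference of \<open>t ^ (k - 1)\<close> at 0; the missing term
  \<open>t = 0\<close> vanishes because \<open>k >= 2\<close>.\<close>

lemma sum_duality_coeff_power:
  assumes "k \<ge> 2"
  shows "(\<Sum>s<k. duality_coeff (\<lambda>n. real n ^ (k - 1)) s) = 0"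
proof -
  have "(\<Sum>s<k. duality_coeff (\<lambda>n. real n ^ (k - 1)) s)
      = - (\<Sum>s<k. \<Sum>t<k. real (s choose t) * ((-1) ^ t * real (t + 1) ^ (k - 1)))"
    unfolding duality_coeff_def sum_negf
    by (intro arg_cong[of _ _ uminus] sum.cong refl sum.mono_neutral_left) auto
  also have "\<dots> = - (\<Sum>t<k. (\<Sum>s<k. real (s choose t)) * ((-1) ^ t * real (t + 1) ^ (k - 1)))"
    by (subst sum.swap) (simp add: sum_distrib_right)
  also have "\<dots> = (\<Sum>t<k. real (k choose Suc t) * ((-1) ^ Suc t * real (Suc t) ^ (k - 1)))"
  proof -
    obtain r where k: "k = Suc r" using assms by (cases k) auto
    have "(\<Sum>s<k. real (s choose t)) = real (k choose Suc t)" for t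
      using sum_choose_upper[of t r] unfolding k lessThan_Suc_atMost by (metis of_nat_sum)
    thus ?thesis by (simp add: sum_negf[symmetric])
  qed
  also have "\<dots> = (\<Sum>t\<le>k. real (k choose t) * ((-1) ^ t * (real t + 0) ^ (k - 1)))"
  proof -
    obtain r where k: "k = Suc r" using assms by (cases k) auto
    show ?thesis using assms unfolding k lessThan_Suc_atMost
      by (subst sum.atMost_Suc_shift) simp
  qed
  also have "\<dots> = 0" using assms by (intro alternating_binomial_power_eq_0) auto
  finally show ?thesis .
qed

section \<open>Uniform boundedness of Moebius sums with weight 1 / d\<close>

definition rough_moebius_sum :: "nat \<Rightarrow> nat \<Rightarrow> real" where
  "rough_moebius_sum t v = (\<Sum>d\<in>rough_upto v t. \<mu> d / real d)"

lemma abs_moebius_le_1: "\<bar>\<mu> d\<bar> \<le> 1"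
  by (simp add: moebius_mu_def)

text \<open>The sum \<open>X\<close> of \<open>\<mu> d * (v div d)\<close> over rough
  \<open>d\<close> counts the \<open>n <= v\<close> without prime factors above \<open>t\<close>, so
  it lies between 0 and \<open>v\<close>. Replacing \<open>v div d\<close> by \<open>v / d\<close>
  costs at most 1 for each \<open>d\<close>, again at most \<open>v\<close> in total.\<close>

lemma abs_rough_moebius_sum_le: "\<bar>rough_moebius_sum t v\<bar> \<le> 2"
proof (cases "v = 0")
  case True
  thus ?thesis by (simp add: rough_moebius_sum_def rough_upto_def)
next
  case False
  let ?R = "rough_upto v t"
  define F where "F d m = (if \<forall>p\<in>prime_factors d. t < p then \<mu> d else 0)" for d m :: nat
  define X where "X = (\<Sum>n=1..v. \<Sum>d | d dvd n. F d (n div d))"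
  have X: "X = (\<Sum>n=1..v. if \<forall>p\<in>prime_factors n. p \<le> t then 1 else 0)"
    unfolding X_def
  proof (rule sum.cong[OF refl])
    fix n assume "n \<in> {1..v}"
    hence n: "n > 0" by auto
    have "(\<Sum>d | d dvd n. F d (n div d)) = (\<Sum>d | d dvd n \<and> (\<forall>p\<in>prime_factors d. t < p). \<mu> d)"
      using n by (intro sum.mono_neutral_cong_right) (auto simp: F_def)
    thus "(\<Sum>d | d dvd n. F d (n div d)) = (if \<forall>p\<in>prime_factors n. p \<le> t then 1 else 0)"
      using sum_moebius_rough_divisors[OF n] by simp
  qed
  have X0: "X \<ge> 0" unfolding X by (intro sum_nonneg) auto
  have "X \<le> (\<Sum>n=1..v. 1)" unfolding X by (intro sum_mono) auto
  hence Xv: "X \<le> real v" by simp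
  have "X = (\<Sum>d=1..v. \<Sum>m=1..v div d. F d m)" unfolding X_def by (rule sum_divisors_swap)
  also have "\<dots> = (\<Sum>d\<in>?R. \<mu> d * real (v div d))"
    by (intro sum.mono_neutral_cong_right) (auto simp: F_def rough_upto_def)
  finally have X2: "X = (\<Sum>d\<in>?R. \<mu> d * real (v div d))" .
  have "\<bar>real v * rough_moebius_sum t v - X\<bar> = \<bar>\<Sum>d\<in>?R. \<mu> d * (real v / real d - real (v div d))\<bar>"
    by (simp add: X2 rough_moebius_sum_def sum_distrib_left sum_subtractf[symmetric] algebra_simps)
  also have "\<dots> \<le> (\<Sum>d\<in>?R. \<bar>\<mu> d * (real v / real d - real (v div d))\<bar>)"
    by (rule sum_abs)
  also have "\<dots> \<le> (\<Sum>d\<in>?R. 1)"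
  proof (intro sum_mono)
    fix d
    have "\<bar>real v / real d - real (v div d)\<bar> \<le> 1"
      using real_nat_div_le[of v d] real_div_nat_less[of v d] by linarith
    thus "\<bar>\<mu> d * (real v / real d - real (v div d))\<bar> \<le> 1"
      using abs_moebius_le_1[of d] by (simp add: abs_mult mult_le_one)
  qed
  also have "\<dots> \<le> real v"
    using card_mono[of "{1..v}" ?R] by (simp add: rough_upto_def subset_iff)
  finally have "\<bar>real v * rough_moebius_sum t v\<bar> \<le> 2 * real v" using X0 Xv by linarith
  hence "real v * \<bar>rough_moebius_sum t v\<bar> \<le> real v * 2" by (simp add: abs_mult)
  thus ?thesis using False by simp
qed

section \<open>Moebius sums over rough numbers\<close>

text \<open>In the block \<open>2 ^ i <= y div d < 2 ^ (i + 1)\<close> the weight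
  \<open>1 / d\<close> is at most \<open>2 ^ (i + 1) / y\<close>. The condition on \<open>K\<close>
  counts the \<open>d\<close> in \<open>D\<close> with \<open>2 ^ i <= y div d\<close>, that is
  \<open>d <= y / 2 ^ i\<close>, the form in which counting theorems supply it.\<close>

lemma dyadic_sum_le:
  fixes h K :: "nat \<Rightarrow> real"
  assumes D: "D \<subseteq> {1..y}" "\<And>d. d \<in> D \<Longrightarrow> 2 ^ a \<le> y div d \<and> y div d < 2 ^ b"
    and h0: "\<And>n. h n \<ge> 0" and h: "\<And>m n. 2 ^ a \<le> m \<Longrightarrow> m \<le> n \<Longrightarrow> h n \<le> h m"
    and K0: "\<And>i. K i \<ge> 0" and K: "\<And>i. a \<le> i \<Longrightarrow> i < b \<Longrightarrow> real (card {d \<in> D. 2 ^ i \<le> y div d}) \<le> K i * (real y / 2 ^ i)"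
  shows "(\<Sum>d\<in>D. h (y div d) / real d) \<le> (\<Sum>i=a..<b. 2 * K i * h (2 ^ i))"
proof -
  have fin: "finite D" using D(1) finite_subset by blast
  define lg where "lg d = (THE i. 2 ^ i \<le> y div d \<and> y div d < 2 ^ Suc i)" for d
  have lg: "2 ^ lg d \<le> y div d \<and> y div d < 2 ^ Suc (lg d)" if "d \<in> D" for d
    unfolding lg_def
  proof (rule theI')
    have "1 \<le> y div d" using D(2)[OF that] by (metis le_trans one_le_numeral one_le_power)
    then obtain i where i: "2 ^ i \<le> y div d" "y div d < 2 ^ (i + 1)"
      using ex_power_ivl1[of 2 "y div d"] by auto
    show "\<exists>!i. 2 ^ i \<le> y div d \<and> y div d < 2 ^ Suc i"
    proof (rule ex1I[of _ i])
      fix j assume j: "2 ^ j \<le> y div d \<and> y div d < 2 ^ Suc j"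
      have "(2::nat) ^ j < 2 ^ Suc i" "(2::nat) ^ i < 2 ^ Suc j" using i j by auto
      hence "j < Suc i" "i < Suc j" by (metis one_less_numeral_iff power_less_imp_less_exp semiring_norm(76))+
      thus "j = i" by simp
    qed (use i in simp)
  qed
  have range: "lg d \<in> {a..<b}" if d: "d \<in> D" for d
  proof -
    have "(2::nat) ^ a < 2 ^ Suc (lg d)" "(2::nat) ^ lg d < 2 ^ b"
      using lg[OF d] D(2)[OF d] le_less_trans by blast+
    hence "a < Suc (lg d)" "lg d < b" by (metis one_less_numeral_iff power_less_imp_less_exp semiring_norm(76))+
    thus ?thesis by simp
  qed
  have "(\<Sum>d\<in>D. h (y div d) / real d) = (\<Sum>i\<in>{a..<b}. \<Sum>d\<in>{d \<in> D. lg d = i}. h (y div d) / real d)"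
    using fin range by (intro sum.group[symmetric]) auto
  also have "\<dots> \<le> (\<Sum>i\<in>{a..<b}. 2 * K i * h (2 ^ i))"
  proof (intro sum_mono)
    fix i assume i: "i \<in> {a..<b}"
    have "(\<Sum>d\<in>{d \<in> D. lg d = i}. h (y div d) / real d) \<le> (\<Sum>d\<in>{d \<in> D. lg d = i}. h (2 ^ i) * (2 ^ Suc i / real y))"
    proof (intro sum_mono)
      fix d assume "d \<in> {d \<in> D. lg d = i}"
      hence d: "d \<in> D" "2 ^ i \<le> y div d" "y div d < 2 ^ Suc i" using lg[of d] by auto
      have d0: "d > 0" and y0: "y > 0" using d(1) D(1) by auto
      have "y < 2 ^ Suc i * d" using d(3) d0 by (simp only: div_less_iff_less_mult)
      hence "real y < 2 ^ Suc i * real d" by (metis of_nat_less_iff of_nat_mult of_nat_numeral of_nat_power)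
      hence "1 / real d \<le> 2 ^ Suc i / real y" using d0 y0 by (simp add: field_simps)
      moreover have "(2::nat) ^ a \<le> 2 ^ i" using i by (intro power_increasing) auto
      hence "h (y div d) \<le> h (2 ^ i)" using d(2) h by blast
      ultimately have "h (y div d) * (1 / real d) \<le> h (2 ^ i) * (2 ^ Suc i / real y)"
        using h0 by (intro mult_mono) auto
      thus "h (y div d) / real d \<le> h (2 ^ i) * (2 ^ Suc i / real y)" by simp
    qed
    also have "\<dots> = real (card {d \<in> D. lg d = i}) * (h (2 ^ i) * (2 ^ Suc i / real y))" by simp
    also have "\<dots> \<le> (K i * (real y / 2 ^ i)) * (h (2 ^ i) * (2 ^ Suc i / real y))"
    proof (intro mult_right_mono)
      have "card {d \<in> D. lg d = i} \<le> card {d \<in> D. 2 ^ i \<le> y div d}"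
        using fin lg by (intro card_mono) auto
      thus "real (card {d \<in> D. lg d = i}) \<le> K i * (real y / 2 ^ i)" using K[of i] i by auto
    qed (auto simp: h0)
    also have "\<dots> \<le> 2 * K i * h (2 ^ i)"
      using K0[of i] h0[of "2 ^ i"] by simp
    finally show "(\<Sum>d\<in>{d \<in> D. lg d = i}. h (y div d) / real d) \<le> 2 * K i * h (2 ^ i)" .
  qed
  finally show ?thesis .
qed

lemma moebius_mult_prime:
  assumes "prime q" "\<not> q dvd d"
  shows "moebius_mu (q * d) = - moebius_mu d"
proof -
  have d0: "d \<noteq> 0" using assms by (metis dvd_0_right)
  have cop: "coprime q d" using assms by (simp add: prime_imp_coprime)
  have sqf: "squarefree (q * d) \<longleftrightarrow> squarefree d"
    using squarefree_mult_coprime[OF cop squarefree_prime[OF assms(1)]] squarefree_multD[of q d] by blast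
  have "prime_factors (q * d) = insert q (prime_factors d)"
    using assms d0 by (subst prime_factors_product) (auto simp: prime_prime_factors)
  moreover have "q \<notin> prime_factors d" using assms by auto
  ultimately show ?thesis using sqf by (simp add: moebius_mu_def)
qed

text \<open>The filter on the left selects the \<open>d\<close> with smallest prime factor
  \<open>q\<close>. Those divisible by \<open>q ^ 2\<close> have Moebius value 0; the others are
  \<open>q * e\<close> with all primes of \<open>e\<close> above \<open>q\<close>.\<close>

lemma sum_moebius_smallest_prime:
  assumes "prime q"
  shows "(\<Sum>d\<in>{d \<in> rough_upto v (q - 1). q dvd d}. \<mu> d / real d)
    = - (1 / real q) * rough_moebius_sum q (v div q)"
proof -
  have q0: "q > 0" using assms prime_gt_0_nat by blast
  have "(\<Sum>d\<in>{d \<in> rough_upto v (q - 1). q dvd d}. \<mu> d / real d)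
      = (\<Sum>d\<in>{d \<in> rough_upto v (q - 1). q dvd d \<and> \<not> q ^ 2 dvd d}. \<mu> d / real d)"
  proof (intro sum.mono_neutral_right ballI)
    fix d assume d: "d \<in> {d \<in> rough_upto v (q - 1). q dvd d} - {d \<in> rough_upto v (q - 1). q dvd d \<and> \<not> q ^ 2 dvd d}"
    hence "q ^ 2 dvd d" by auto
    hence "\<not> squarefree d" using assms by (intro not_squarefreeI[of q]) auto
    thus "\<mu> d / real d = 0" by (simp add: moebius_mu_def)
  qed auto
  also have "\<dots> = (\<Sum>d\<in>rough_upto (v div q) q. - (1 / real q) * (\<mu> d / real d))"
  proof (rule sum.reindex_bij_witness[where i = "\<lambda>d. q * d" and j = "\<lambda>d. d div q"])
    fix d assume d: "d \<in> {d \<in> rough_upto v (q - 1). q dvd d \<and> \<not> q ^ 2 dvd d}"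
    then obtain e where e: "d = q * e" by auto
    have e0: "e > 0" using d e by (auto simp: rough_upto_def)
    have nd: "\<not> q dvd e" using d e by (auto simp: power2_eq_square)
    show "q * (d div q) = d" using e by simp
    have pf: "prime_factors d = insert q (prime_factors e)"
      using assms e e0 by (simp add: prime_factors_product prime_prime_factors)
    have "q < p" if "p \<in> prime_factors e" for p
    proof -
      have "q - 1 < p" using d pf that by (auto simp: rough_upto_def)
      moreover have "p \<noteq> q" using that nd by auto
      ultimately show ?thesis by simp
    qed
    thus "d div q \<in> rough_upto (v div q) q"
      using d e e0 q0 by (auto simp: rough_upto_def less_eq_div_iff_mult_less_eq mult.commute)
    show "- (1 / real q) * (\<mu> (d div q) / real (d div q)) = \<mu> d / real d"
      using moebius_mult_prime[OF assms nd] e q0 by simp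
  next
    fix e assume e: "e \<in> rough_upto (v div q) q"
    hence e0: "e > 0" by (auto simp: rough_upto_def)
    show "q * e div q = e" using q0 by simp
    have nd: "\<not> q dvd e" using e e0 assms by (auto simp: rough_upto_def in_prime_factors_iff)
    have pf: "prime_factors (q * e) = insert q (prime_factors e)"
      using assms e0 by (simp add: prime_factors_product prime_prime_factors)
    show "q * e \<in> {d \<in> rough_upto v (q - 1). q dvd d \<and> \<not> q ^ 2 dvd d}"
      using e e0 q0 nd pf by (auto simp: rough_upto_def less_eq_div_iff_mult_less_eq mult.commute power2_eq_square)
  qed
  also have "\<dots> = - (1 / real q) * rough_moebius_sum q (v div q)"
    by (simp only: rough_moebius_sum_def sum_distrib_left)
  finally show ?thesis .
qed

text \<open>One step of Buchstab's identity: raising the sieving limit to \<open>t + 1\<close>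
  removes the \<open>d\<close> whose smallest prime factor is \<open>t + 1\<close>.\<close>

lemma rough_moebius_sum_Suc:
  "rough_moebius_sum t v - rough_moebius_sum (Suc t) v =
    (if prime (Suc t) then - (1 / real (Suc t)) * rough_moebius_sum (Suc t) (v div Suc t) else 0)"
proof -
  have split: "rough_upto v (Suc t) = {d \<in> rough_upto v t. \<not> Suc t \<in> prime_factors d}"
    by (auto simp: rough_upto_def) (metis Suc_lessI)
  have "rough_moebius_sum t v - rough_moebius_sum (Suc t) v =
      (\<Sum>d\<in>rough_upto v t - rough_upto v (Suc t). \<mu> d / real d)"
    unfolding rough_moebius_sum_def by (subst sum_diff) (auto simp: split)
  also have "rough_upto v t - rough_upto v (Suc t) = {d \<in> rough_upto v t. Suc t \<in> prime_factors d}"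
    by (auto simp: split)
  also have "\<dots> = (if prime (Suc t) then {d \<in> rough_upto v (Suc t - 1). Suc t dvd d} else {})"
    by (auto simp: in_prime_factors_iff rough_upto_def)
  finally show ?thesis using sum_moebius_smallest_prime[of "Suc t" v] by auto
qed

lemma rough_moebius_sum_diff:
  assumes "v' \<le> v"
  shows "\<bar>rough_moebius_sum t v - rough_moebius_sum t v'\<bar> \<le> (\<Sum>d\<in>{d \<in> rough_upto v t. v' < d}. 1 / real d)"
proof -
  have "rough_moebius_sum t v - rough_moebius_sum t v' =
      (\<Sum>d\<in>rough_upto v t - rough_upto v' t. \<mu> d / real d)"
    unfolding rough_moebius_sum_def using assms by (subst sum_diff) (auto simp: rough_upto_def)
  also have "rough_upto v t - rough_upto v' t = {d \<in> rough_upto v t. v' < d}"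
    by (auto simp: rough_upto_def)
  also have "\<bar>\<Sum>d\<in>{d \<in> rough_upto v t. v' < d}. \<mu> d / real d\<bar>
      \<le> (\<Sum>d\<in>{d \<in> rough_upto v t. v' < d}. \<bar>\<mu> d / real d\<bar>)" by (rule sum_abs)
  also have "\<dots> \<le> (\<Sum>d\<in>{d \<in> rough_upto v t. v' < d}. 1 / real d)"
    by (intro sum_mono) (simp add: divide_right_mono abs_moebius_le_1 abs_divide)
  finally show ?thesis .
qed

lemma sum_inverse_squares_tail:
  assumes "a \<ge> 1"
  shows "(\<Sum>i=a..<b. 1 / real i ^ 2) \<le> 2 / real a"
proof (cases "a < b")
  case True
  hence "Suc a \<le> b" by simp
  hence "(\<Sum>i=a..<b. 1 / real i ^ 2) \<le> 2 / real a - 1 / real (b - 1)"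
  proof (induction rule: dec_induct)
    case base
    have "1 / real a ^ 2 \<le> 1 / real a" using assms by (simp add: field_simps power2_eq_square)
    thus ?case by simp
  next
    case (step n)
    have n: "real n \<ge> 2" using assms step by simp
    have "1 / real n ^ 2 \<le> 1 / (real n - 1) - 1 / real n"
      using n by (simp add: field_simps power2_eq_square)
    thus ?case using step n by (simp add: of_nat_diff)
  qed
  thus ?thesis using assms by (smt (verit) divide_nonneg_nonneg of_nat_0_le_iff)
qed (use assms in simp)

text \<open>In the dyadic block \<open>y div d\<close> about \<open>2 ^ i\<close>, every
  \<open>d\<close> is at most \<open>y / 2 ^ i\<close> and free of primes up to
  \<open>2 ^ i\<close>, so there are O(y / (2 ^ i * i)) of them. With the weight
  \<open>1 / ln (y div d)\<close> this leaves a sum of \<open>1 / i ^ 2\<close> that starts at about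
  \<open>ln t\<close>.\<close>

lemma rough_cofactor_sum_le:
  obtains C where "C \<ge> 0" "\<And>t y D. 2 \<le> t \<Longrightarrow>
    (\<And>d. d \<in> D \<Longrightarrow> d \<in> rough_upto y (y div d) \<and> t < y div d) \<Longrightarrow>
    (\<Sum>d\<in>D. 1 / (real d * ln (real (y div d)))) \<le> C / ln (real t)"
proof -
  obtain C where C: "C \<ge> 0" "\<And>t y. 2 \<le> t \<Longrightarrow> real (card (rough_upto y t)) \<le> C * (real y / ln (real t)) + 1"
    using card_rough_le by blast
  define C' where "C' = 8 * C / ln 2 + 1"
  have "(\<Sum>d\<in>D. 1 / (real d * ln (real (y div d)))) \<le> C' / ln (real t)"
    if t: "2 \<le> t" and D: "\<And>d. d \<in> D \<Longrightarrow> d \<in> rough_upto y (y div d) \<and> t < y div d" for t y :: nat and D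
  proof -
    define h where "h n = (if n \<ge> 2 then 1 / ln (real n) else 1 / ln 2)" for n :: nat
    obtain a where a: "2 ^ a \<le> t" "t < 2 ^ (a + 1)" using ex_power_ivl1[of 2 t] t by auto
    have a1: "a \<ge> 1" using a t by (cases a) auto
    have Dy: "D \<subseteq> {1..y}" using D by (auto simp: rough_upto_def)
    hence fin: "finite D" using finite_subset by blast
    \<comment> \<open>The number 1 is always rough and causes the additive 1 in
      \<open>card_rough_le\<close>. Once it is set apart, the counts in the blocks are bounded by
      multiples of \<open>y / (2 ^ i * i)\<close>.\<close>
    define D' where "D' = D - {1}"
    have h_eq: "1 / (real d * ln (real (y div d))) = h (y div d) / real d" if "d \<in> D" for d
      using D[OF that] t by (simp add: h_def)
    have pow2: "(2::nat) ^ a \<ge> 2" using a1 by (cases a) auto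
    have "(\<Sum>d\<in>D'. h (y div d) / real d) \<le> (\<Sum>i=a..<y. 2 * (C / (ln 2 * real i)) * h (2 ^ i))"
    proof (rule dyadic_sum_le)
      show "D' \<subseteq> {1..y}" using Dy by (auto simp: D'_def)
      show "2 ^ a \<le> y div d \<and> y div d < 2 ^ y" if "d \<in> D'" for d
      proof
        show "2 ^ a \<le> y div d" using a D[of d] that by (auto simp: D'_def)
        have "y div d \<le> y" by (rule div_le_dividend)
        also have "y < 2 ^ y" by (rule less_exp)
        finally show "y div d < 2 ^ y" .
      qed
      show "h n \<le> h m" if "2 ^ a \<le> m" "m \<le> n" for m n
        using that pow2 by (auto simp: h_def intro!: divide_left_mono)
      show "real (card {d \<in> D'. 2 ^ i \<le> y div d}) \<le> C / (ln 2 * real i) * (real y / 2 ^ i)"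
        if i: "a \<le> i" "i < y" for i
      proof (cases "{d \<in> D'. 2 ^ i \<le> y div d} = {}")
        case True
        thus ?thesis using C(1) by (simp only: card.empty) simp
      next
        case False
        let ?R = "rough_upto (y div 2 ^ i) (2 ^ i)"
        have sub: "{d \<in> D'. 2 ^ i \<le> y div d} \<subseteq> ?R - {1}"
        proof
          fix d assume d: "d \<in> {d \<in> D'. 2 ^ i \<le> y div d}"
          hence "d \<in> D" "d \<noteq> 1" by (auto simp: D'_def)
          note * = D[OF this(1)]
          have "d > 0" using * by (auto simp: rough_upto_def)
          hence "d \<le> y div 2 ^ i" using d by (simp add: less_eq_div_iff_mult_less_eq mult.commute)
          thus "d \<in> ?R - {1}" using * d \<open>d \<noteq> 1\<close> by (auto simp: rough_upto_def)
        qed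
        then obtain d where "d \<in> ?R" using False by blast
        hence one: "1 \<in> ?R" by (auto simp: rough_upto_def)
        have "real (card {d \<in> D'. 2 ^ i \<le> y div d}) \<le> real (card (?R - {1}))"
          using sub by (intro of_nat_mono card_mono) auto
        also have "\<dots> = real (card ?R) - 1"
        proof -
          have "card ?R > 0" using one by (subst card_gt_0_iff) auto
          thus ?thesis using one by (simp add: of_nat_diff Suc_le_eq)
        qed
        also have "\<dots> \<le> C * (real (y div 2 ^ i) / ln (real (2 ^ i)))"
        proof -
          have "(2::nat) ^ a \<le> 2 ^ i" using i by (intro power_increasing) auto
          hence "2 \<le> (2::nat) ^ i" using pow2 by linarith
          from C(2)[OF this, of "y div 2 ^ i"] show ?thesis by linarith
        qed
        also have "\<dots> \<le> C * (real y / 2 ^ i / ln (real (2 ^ i)))"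
          using real_nat_div_le[of y "2 ^ i"] C(1) by (intro mult_left_mono divide_right_mono) auto
        also have "ln (real (2 ^ i)) = ln 2 * real i" by (simp add: ln_realpow)
        finally show ?thesis by (simp add: mult_ac)
      qed
    qed (use C(1) in \<open>auto simp: h_def\<close>)
    also have "\<dots> = (\<Sum>i=a..<y. 2 * C / (ln 2)\<^sup>2 * (1 / real i ^ 2))"
    proof (intro sum.cong refl)
      fix i assume "i \<in> {a..<y}"
      hence "(2::nat) ^ a \<le> 2 ^ i" by (intro power_increasing) auto
      hence "(2::nat) ^ i \<ge> 2" using pow2 by linarith
      hence "h (2 ^ i) = 1 / (real i * ln 2)" by (simp add: h_def ln_realpow)
      thus "2 * (C / (ln 2 * real i)) * h (2 ^ i) = 2 * C / (ln 2)\<^sup>2 * (1 / real i ^ 2)"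
        by (simp add: power2_eq_square)
    qed
    also have "\<dots> = 2 * C / (ln 2)\<^sup>2 * (\<Sum>i=a..<y. 1 / real i ^ 2)" by (rule sum_distrib_left[symmetric])
    also have "\<dots> \<le> 2 * C / (ln 2)\<^sup>2 * (2 / real a)"
      using C(1) by (intro mult_left_mono sum_inverse_squares_tail a1) auto
    also have "\<dots> \<le> 2 * C / (ln 2)\<^sup>2 * (4 * ln 2 / ln (real t))"
    proof (intro mult_left_mono)
      have "real t \<le> 2 ^ (a + 1)" using a(2) by (metis less_imp_le of_nat_le_iff of_nat_numeral of_nat_power)
      hence "ln (real t) \<le> ln (2 ^ (a + 1))" using t by (subst ln_le_cancel_iff) auto
      also have "\<dots> = real (a + 1) * ln 2" by (rule ln_realpow)
      also have "\<dots> \<le> (2 * real a) * ln 2" using a1 by (intro mult_right_mono) auto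
      finally show "2 / real a \<le> 4 * ln 2 / ln (real t)" using t a1 by (simp add: field_simps)
    qed (use C(1) in auto)
    also have "\<dots> = 8 * C / ln 2 / ln (real t)" by (simp add: power2_eq_square)
    finally have 1: "(\<Sum>d\<in>D'. h (y div d) / real d) \<le> 8 * C / ln 2 / ln (real t)" .
    have "(\<Sum>d\<in>D. h (y div d) / real d) \<le> 1 / ln (real t) + (\<Sum>d\<in>D'. h (y div d) / real d)"
    proof (cases "1 \<in> D")
      case True
      have "(\<Sum>d\<in>D. h (y div d) / real d) = h y + (\<Sum>d\<in>D'. h (y div d) / real d)"
        using sum.remove[OF fin True, of "\<lambda>d. h (y div d) / real d"] by (simp add: D'_def)
      moreover have "h y \<le> 1 / ln (real t)" using D[OF True] t by (auto simp: h_def intro!: divide_left_mono)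
      ultimately show ?thesis by simp
    next
      case False
      hence "D' = D" by (simp add: D'_def)
      thus ?thesis using t by simp
    qed
    also have "\<dots> \<le> 1 / ln (real t) + 8 * C / ln 2 / ln (real t)" using 1 by simp
    also have "\<dots> = C' / ln (real t)" by (simp add: C'_def add_divide_distrib)
    finally show ?thesis using h_eq by simp
  qed
  thus ?thesis using that[of C'] C(1) by (simp add: C'_def)
qed

text \<open>From \<open>n\<close> to \<open>n + 1\<close> the sum changes because of the prime \<open>n + 1\<close>, or because of the \<open>d\<close> with
  \<open>y div (n + 1) < d \<le> y div n\<close>. Each such \<open>d\<close> belongs to only one \<open>n\<close>, namely \<open>n = y div d\<close>, and has no
  prime factor up to \<open>y div d\<close>, which makes these \<open>d\<close> sparse.\<close>

lemma rough_moebius_sum_variation: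
  obtains C where "C \<ge> 0" "\<And>t y z. 2 \<le> t \<Longrightarrow>
    (\<Sum>n=t+1..<z. \<bar>rough_moebius_sum (Suc n) (y div Suc n) - rough_moebius_sum n (y div n)\<bar> / ln (real n))
      \<le> C / ln (real t)"
proof -
  obtain C1 where C1: "C1 \<ge> 0" "\<And>t y. 2 \<le> t \<Longrightarrow>
    (\<Sum>p | prime p \<and> t < p \<and> p \<le> y. 1 / (real p * ln (real p))) \<le> C1 / ln (real t)"
    by (rule mertens_second) metis
  obtain C2 where C2: "C2 \<ge> 0" "\<And>t y D. 2 \<le> t \<Longrightarrow>
    (\<And>d. d \<in> D \<Longrightarrow> d \<in> rough_upto y (y div d) \<and> t < y div d) \<Longrightarrow>
    (\<Sum>d\<in>D. 1 / (real d * ln (real (y div d)))) \<le> C2 / ln (real t)"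
    using rough_cofactor_sum_le by blast
  have "(\<Sum>n=t+1..<z. \<bar>rough_moebius_sum (Suc n) (y div Suc n) - rough_moebius_sum n (y div n)\<bar> / ln (real n))
      \<le> (4 * C1 + C2) / ln (real t)" if t: "2 \<le> t" for t y z
  proof -
    let ?V = "\<lambda>n. \<bar>rough_moebius_sum (Suc n) (y div Suc n) - rough_moebius_sum n (y div n)\<bar>"
    let ?S = "\<lambda>n. {d \<in> rough_upto (y div n) n. y div Suc n < d}"
    \<comment> \<open>The 4 is the 2 of \<open>abs_rough_moebius_sum_le\<close> times the 2 of
      \<open>ln (n + 1) <= 2 * ln n\<close>, used to express the weight by the prime
      \<open>n + 1\<close> itself.\<close>
    define P where "P n = (if prime (Suc n) then 4 * (1 / (real (Suc n) * ln (real (Suc n)))) else 0)" for n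
    have "(\<Sum>n=t+1..<z. ?V n / ln (real n))
        \<le> (\<Sum>n=t+1..<z. P n + (\<Sum>d\<in>?S n. 1 / (real d * ln (real n))))"
    proof (intro sum_mono)
      fix n assume n: "n \<in> {t+1..<z}"
      hence n2: "n \<ge> 2" using t by simp
      hence lnn: "ln (real n) > 0" by simp
      have "\<bar>rough_moebius_sum n (y div Suc n) - rough_moebius_sum (Suc n) (y div Suc n)\<bar>
          \<le> (if prime (Suc n) then 2 / real (Suc n) else 0)"
        unfolding rough_moebius_sum_Suc using abs_rough_moebius_sum_le[of "Suc n" "y div Suc n div Suc n"]
        by (simp add: abs_mult divide_right_mono)
      moreover have "\<bar>rough_moebius_sum n (y div n) - rough_moebius_sum n (y div Suc n)\<bar> \<le> (\<Sum>d\<in>?S n. 1 / real d)"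
        using n2 by (intro rough_moebius_sum_diff div_le_mono2) auto
      ultimately have "?V n
          \<le> (if prime (Suc n) then 2 / real (Suc n) else 0) + (\<Sum>d\<in>?S n. 1 / real d)" by linarith
      hence "?V n / ln (real n)
          \<le> ((if prime (Suc n) then 2 / real (Suc n) else 0) + (\<Sum>d\<in>?S n. 1 / real d)) / ln (real n)"
        using lnn by (intro divide_right_mono) auto
      also have "\<dots> = (if prime (Suc n) then 2 / (real (Suc n) * ln (real n)) else 0) + (\<Sum>d\<in>?S n. 1 / (real d * ln (real n)))"
        by (simp add: add_divide_distrib sum_divide_distrib)
      also have "(if prime (Suc n) then 2 / (real (Suc n) * ln (real n)) else 0) \<le> P n"
      proof -
        have "2 * real n \<le> real n * real n" using n2 by (intro mult_right_mono) auto
        hence "real (Suc n) \<le> real n ^ 2" using n2 unfolding power2_eq_square of_nat_Suc by linarith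
        hence "ln (real (Suc n)) \<le> ln (real n ^ 2)" using n2 by (subst ln_le_cancel_iff) auto
        hence le: "ln (real (Suc n)) \<le> 2 * ln (real n)" using n2 by (simp add: ln_realpow)
        have "2 / (real (Suc n) * ln (real n)) = 4 / (real (Suc n) * (2 * ln (real n)))" by simp
        also have "\<dots> \<le> 4 / (real (Suc n) * ln (real (Suc n)))"
          using le n2 by (intro divide_left_mono mult_left_mono mult_pos_pos) auto
        finally show ?thesis by (simp add: P_def)
      qed
      finally show "?V n / ln (real n)
          \<le> P n + (\<Sum>d\<in>?S n. 1 / (real d * ln (real n)))" by simp
    qed
    also have "\<dots> = (\<Sum>n=t+1..<z. P n) + (\<Sum>n=t+1..<z. \<Sum>d\<in>?S n. 1 / (real d * ln (real n)))"
      by (rule sum.distrib)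
    also have "(\<Sum>n=t+1..<z. P n) = (\<Sum>p=Suc (t+1)..<Suc z. if prime p then 4 * (1 / (real p * ln (real p))) else 0)"
      by (subst sum.shift_bounds_Suc_ivl) (simp add: P_def)
    also have "\<dots> \<le> (\<Sum>p | prime p \<and> t < p \<and> p \<le> z. 4 * (1 / (real p * ln (real p))))"
      unfolding sum.inter_filter[OF finite_atLeastLessThan, symmetric]
      by (intro sum_mono2) (auto dest: prime_ge_1_nat)
    also have "\<dots> = 4 * (\<Sum>p | prime p \<and> t < p \<and> p \<le> z. 1 / (real p * ln (real p)))"
      by (rule sum_distrib_left[symmetric])
    also have "\<dots> \<le> 4 * (C1 / ln (real t))" using C1(2)[OF t] by (intro mult_left_mono) auto
    also have "(\<Sum>n=t+1..<z. \<Sum>d\<in>?S n. 1 / (real d * ln (real n))) \<le> C2 / ln (real t)"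
    proof -
      have S: "y div d = n" if "d \<in> ?S n" "n \<in> {t+1..<z}" for d n
      proof -
        have d: "d > 0" "d \<le> y div n" "y div Suc n < d" using that by (auto simp: rough_upto_def)
        have "n \<le> y div d" using d that(2) by (simp add: less_eq_div_iff_mult_less_eq mult.commute)
        have "y < d * Suc n" using d(3) by (simp only: div_less_iff_less_mult[OF zero_less_Suc])
        hence "y div d < Suc n" by (simp only: div_less_iff_less_mult[OF d(1)] mult.commute)
        moreover note \<open>n \<le> y div d\<close>
        ultimately show ?thesis by simp
      qed
      have "(\<Sum>n=t+1..<z. \<Sum>d\<in>?S n. 1 / (real d * ln (real n))) =
          (\<Sum>d\<in>(\<Union>n\<in>{t+1..<z}. ?S n). 1 / (real d * ln (real (y div d))))"
      proof (subst sum.UNION_disjoint)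
        show "\<forall>i\<in>{t+1..<z}. \<forall>j\<in>{t+1..<z}. i \<noteq> j \<longrightarrow> ?S i \<inter> ?S j = {}"
        proof (intro ballI impI equals0I)
          fix i j d assume *: "i \<in> {t+1..<z}" "j \<in> {t+1..<z}" "i \<noteq> j" "d \<in> ?S i \<inter> ?S j"
          from *(4) have "d \<in> ?S i" "d \<in> ?S j" by (rule IntD1, rule IntD2)
          from S[OF this(1) *(1)] S[OF this(2) *(2)] *(3) show False by simp
        qed
        show "(\<Sum>n=t+1..<z. \<Sum>d\<in>?S n. 1 / (real d * ln (real n))) =
            (\<Sum>n=t+1..<z. \<Sum>d\<in>?S n. 1 / (real d * ln (real (y div d))))"
        proof (rule sum.cong[OF refl], rule sum.cong[OF refl])
          fix n d assume *: "n \<in> {t+1..<z}" "d \<in> ?S n"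
          show "1 / (real d * ln (real n)) = 1 / (real d * ln (real (y div d)))"
            unfolding S[OF *(2,1)] ..
        qed
      qed auto
      also have "\<dots> \<le> C2 / ln (real t)"
      proof (rule C2(2)[OF t])
        fix d assume "d \<in> (\<Union>n\<in>{t+1..<z}. ?S n)"
        then obtain n where n: "n \<in> {t+1..<z}" "d \<in> ?S n" by blast
        have "d \<le> y" using n(2) div_le_dividend[of y n] by (auto simp: rough_upto_def simp del: div_le_dividend)
        thus "d \<in> rough_upto y (y div d) \<and> t < y div d"
          using n S[OF n(2,1)] by (auto simp: rough_upto_def)
      qed
      finally show ?thesis .
    qed
    finally show ?thesis by (simp add: add_divide_distrib)
  qed
  thus ?thesis using that[of "4 * C1 + C2"] C1(1) C2(1) by simp
qed

section \<open>Distribution of the largest prime factor\<close>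

definition largest_prime_factor :: "nat \<Rightarrow> nat" where
  "largest_prime_factor n = Max (prime_factors n)"

text \<open>The cutoff \<open>z\<close> is needed for cofactors: when larger primes have been split
  off from a number, what remains must have its largest prime below them. The estimates are uniform
  in \<open>z\<close>.\<close>

definition lpf_sum :: "(nat \<Rightarrow> real) \<Rightarrow> nat \<Rightarrow> nat \<Rightarrow> real" where
  "lpf_sum w y z = (\<Sum>m | m \<in> {2..y} \<and> largest_prime_factor m \<le> z. w (largest_prime_factor m))"

lemma prime_factors_nonempty: "2 \<le> (n::nat) \<Longrightarrow> prime_factors n \<noteq> {}"
  by (auto simp: prime_factorization_empty_iff)

lemma largest_prime_factor_in: "2 \<le> n \<Longrightarrow> largest_prime_factor n \<in> prime_factors n"
  unfolding largest_prime_factor_def by (intro Max_in prime_factors_nonempty) auto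

lemma smallest_prime_factor_in: "2 \<le> n \<Longrightarrow> smallest_prime_factor n \<in> prime_factors n"
  unfolding smallest_prime_factor_def by (intro Min_in prime_factors_nonempty) auto

text \<open>Partial summation of \<open>w p * ln p / p\<close>, which has bounded sums, against
  \<open>rough_moebius_sum n (y div n) / ln n\<close>. The variation of the latter comes from the
  Moebius sums, controlled by \<open>rough_moebius_sum_variation\<close>, and from the decrease of
  \<open>1 / ln n\<close>, which telescopes.\<close>

lemma sum_weighted_rough_moebius_le:
  assumes B: "\<And>n. \<bar>\<Sum>i=1..n. w i * log_prime_ratio i\<bar> \<le> B"
  obtains C where "C \<ge> 0" "\<And>t y z. 2 \<le> t \<Longrightarrow>
    \<bar>\<Sum>p | prime p \<and> t < p \<and> p \<le> z. w p / real p * rough_moebius_sum p (y div p)\<bar> \<le> C / ln (real t)"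
proof -
  obtain C1 where C1: "C1 \<ge> 0" "\<And>t y z. 2 \<le> t \<Longrightarrow>
    (\<Sum>n=t+1..<z. \<bar>rough_moebius_sum (Suc n) (y div Suc n) - rough_moebius_sum n (y div n)\<bar> / ln (real n))
      \<le> C1 / ln (real t)"
    using rough_moebius_sum_variation by blast
  have B0: "B \<ge> 0" using B[of 0] by simp
  have "\<bar>\<Sum>p | prime p \<and> t < p \<and> p \<le> z. w p / real p * rough_moebius_sum p (y div p)\<bar> \<le> (2 * B * (4 + C1)) / ln (real t)"
    if t: "2 \<le> t" for t y z
  proof (cases "t \<le> z")
    case True
    define g where "g n = rough_moebius_sum n (y div n) / ln (real n)" for n
    define b where "b i = w i * log_prime_ratio i" for i
    have lnt: "ln (real t) > 0" using t by simp
    have "(\<Sum>p | prime p \<and> t < p \<and> p \<le> z. w p / real p * rough_moebius_sum p (y div p)) = (\<Sum>n=t+1..z. g n *\<^sub>R b n)"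
      using t by (intro sum.mono_neutral_cong_left) (auto simp: g_def b_def log_prime_ratio_def)
    also have "\<bar>\<dots>\<bar> \<le> 2 * B * (\<bar>g z\<bar> + (\<Sum>n=t+1..<z. \<bar>g (Suc n) - g n\<bar>))"
      using sum_by_parts_bound[of b B t z g] B True by (simp add: b_def)
    also have "\<dots> \<le> 2 * B * (2 / ln (real t) + (C1 / ln (real t) + 2 / ln (real t)))"
    proof (intro mult_left_mono add_mono)
      have "\<bar>g z\<bar> = \<bar>rough_moebius_sum z (y div z)\<bar> / ln (real z)" using True t by (simp add: g_def abs_divide)
      also have "\<dots> \<le> 2 / ln (real z)"
        using True t by (intro divide_right_mono abs_rough_moebius_sum_le) auto
      also have "\<dots> \<le> 2 / ln (real t)" using True t by (intro divide_left_mono) auto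
      finally show "\<bar>g z\<bar> \<le> 2 / ln (real t)" .
      have "(\<Sum>n=t+1..<z. \<bar>g (Suc n) - g n\<bar>) \<le>
          (\<Sum>n=t+1..<z. \<bar>rough_moebius_sum (Suc n) (y div Suc n) - rough_moebius_sum n (y div n)\<bar> / ln (real n)
            + 2 * (1 / ln (real n) - 1 / ln (real (Suc n))))"
      proof (intro sum_mono)
        fix n assume n: "n \<in> {t+1..<z}"
        have pos: "ln (real n) > 0" "ln (real (Suc n)) > 0" using n t by auto
        have dec: "1 / ln (real (Suc n)) \<le> 1 / ln (real n)"
          using n t by (intro divide_left_mono mult_pos_pos) auto
        let ?M = "rough_moebius_sum n (y div n)" and ?M' = "rough_moebius_sum (Suc n) (y div Suc n)"
        have "g (Suc n) - g n = (?M' - ?M) / ln (real n) + ?M' * (1 / ln (real (Suc n)) - 1 / ln (real n))"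
          by (simp add: g_def algebra_simps diff_divide_distrib)
        hence "\<bar>g (Suc n) - g n\<bar> \<le> \<bar>(?M' - ?M) / ln (real n)\<bar> + \<bar>?M' * (1 / ln (real (Suc n)) - 1 / ln (real n))\<bar>"
          by (metis abs_triangle_ineq)
        also have "\<bar>(?M' - ?M) / ln (real n)\<bar> = \<bar>?M' - ?M\<bar> / ln (real n)" using pos by (simp add: abs_divide)
        also have "\<bar>?M' * (1 / ln (real (Suc n)) - 1 / ln (real n))\<bar> \<le> 2 * (1 / ln (real n) - 1 / ln (real (Suc n)))"
          using dec abs_rough_moebius_sum_le[of "Suc n" "y div Suc n"] unfolding abs_mult
          by (intro mult_mono) auto
        finally show "\<bar>g (Suc n) - g n\<bar> \<le> \<bar>?M' - ?M\<bar> / ln (real n) + 2 * (1 / ln (real n) - 1 / ln (real (Suc n)))"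
          by simp
      qed
      also have "\<dots> = (\<Sum>n=t+1..<z. \<bar>rough_moebius_sum (Suc n) (y div Suc n) - rough_moebius_sum n (y div n)\<bar> / ln (real n))
            + 2 * (\<Sum>n=t+1..<z. 1 / ln (real n) - 1 / ln (real (Suc n)))"
        by (simp only: sum.distrib sum_distrib_left)
      also have "(\<Sum>n=t+1..<z. 1 / ln (real n) - 1 / ln (real (Suc n))) \<le> 1 / ln (real t)"
      proof (cases "t + 1 \<le> z")
        case True
        have "(\<Sum>n=t+1..<z. 1 / ln (real n) - 1 / ln (real (Suc n))) = 1 / ln (real (t+1)) - 1 / ln (real z)"
          using True by (induction rule: dec_induct) auto
        also have "\<dots> \<le> 1 / ln (real (t + 1))" using True t by simp
        also have "\<dots> \<le> 1 / ln (real t)" using t by (intro divide_left_mono mult_pos_pos) auto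
        finally show ?thesis .
      qed (use lnt in simp)
      finally show "(\<Sum>n=t+1..<z. \<bar>g (Suc n) - g n\<bar>) \<le> C1 / ln (real t) + 2 / ln (real t)"
        using C1(2)[OF t, where y = y and z = z] by simp
    qed (use B0 in auto)
    also have "\<dots> = (2 * B * (4 + C1)) / ln (real t)" by (simp add: algebra_simps add_divide_distrib)
    finally show ?thesis .
  next
    case False
    hence "{p. prime p \<and> t < p \<and> p \<le> z} = {}" by auto
    thus ?thesis using B0 C1(1) t by (simp only: sum.empty) simp
  qed
  thus ?thesis using that[of "2 * B * (4 + C1)"] B0 C1(1) by simp
qed

lemma sum_largest_prime_factor_duality:
  fixes f :: "nat \<Rightarrow> real"
  shows "(\<Sum>m=2..y. f (largest_prime_factor m)) =
    - (\<Sum>n=2..y. \<mu> n * f (smallest_prime_factor n) * real (y div n))"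
proof -
  define F where "F n m = (if n \<ge> 2 then \<mu> n * f (smallest_prime_factor n) else 0)" for n m :: nat
  have "(\<Sum>m=1..y. \<Sum>n | n dvd m. F n (m div n)) = (\<Sum>m=1..y. if m \<ge> 2 then - f (largest_prime_factor m) else 0)"
  proof (intro sum.cong[OF refl])
    fix m assume m: "m \<in> {1..y}"
    hence m0: "m > 0" by simp
    have "(\<Sum>n | n dvd m. F n (m div n)) =
        (\<Sum>n | n dvd m \<and> 2 \<le> n. \<mu> n * 1 * f (smallest_prime_factor n))"
      using m0 by (intro sum.mono_neutral_cong_right) (auto simp: F_def)
    also have "\<dots> = (\<Sum>p\<in>prime_factors m. f p * duality_coeff (\<lambda>_. 1) (card {q \<in> prime_factors m. p < q}))"
      by (rule smallest_largest_duality[OF m0])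
    also have "\<dots> = (\<Sum>p\<in>prime_factors m. if p = largest_prime_factor m then - f p else 0)"
    proof (intro sum.cong refl)
      fix p assume p: "p \<in> prime_factors m"
      have "{q \<in> prime_factors m. p < q} = {} \<longleftrightarrow> p = largest_prime_factor m"
      proof
        assume "{q \<in> prime_factors m. p < q} = {}"
        thus "p = largest_prime_factor m" unfolding largest_prime_factor_def using p
          by (intro Max_eqI[symmetric]) (auto simp: not_less)
      next
        assume "p = largest_prime_factor m"
        thus "{q \<in> prime_factors m. p < q} = {}" unfolding largest_prime_factor_def
          by (auto simp: not_less)
      qed
      moreover have "card {q \<in> prime_factors m. p < q} = 0 \<longleftrightarrow> {q \<in> prime_factors m. p < q} = {}"
        by (subst card_0_eq) auto
      ultimately show "f p * duality_coeff (\<lambda>_. 1) (card {q \<in> prime_factors m. p < q}) =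
          (if p = largest_prime_factor m then - f p else 0)"
        by (simp add: duality_coeff_const)
    qed
    also have "\<dots> = (if m \<ge> 2 then - f (largest_prime_factor m) else 0)"
    proof (cases "m \<ge> 2")
      case True
      thus ?thesis using largest_prime_factor_in[OF True] by simp
    next
      case False
      hence "m = 1" using m0 by simp
      thus ?thesis by simp
    qed
    finally show "(\<Sum>n | n dvd m. F n (m div n)) = (if m \<ge> 2 then - f (largest_prime_factor m) else 0)" .
  qed
  also have "\<dots> = (\<Sum>m=2..y. - f (largest_prime_factor m))"
    by (intro sum.mono_neutral_cong_right) auto
  finally have 1: "(\<Sum>m=1..y. \<Sum>n | n dvd m. F n (m div n)) = - (\<Sum>m=2..y. f (largest_prime_factor m))"
    by (simp add: sum_negf)
  have "(\<Sum>m=1..y. \<Sum>n | n dvd m. F n (m div n)) = (\<Sum>n=1..y. \<Sum>m=1..y div n. F n m)"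
    by (rule sum_divisors_swap)
  also have "\<dots> = (\<Sum>n=2..y. \<mu> n * f (smallest_prime_factor n) * real (y div n))"
    by (intro sum.mono_neutral_cong_right) (auto simp: F_def)
  finally show ?thesis using 1 by simp
qed

lemma sum_moebius_by_smallest_prime:
  fixes w :: "nat \<Rightarrow> real"
  assumes "t \<ge> 1"
  shows "(\<Sum>n | n \<in> {2..y} \<and> t < smallest_prime_factor n \<and> smallest_prime_factor n \<le> z.
            \<mu> n / real n * w (smallest_prime_factor n)) =
         - (\<Sum>p | prime p \<and> t < p \<and> p \<le> z. w p / real p * rough_moebius_sum p (y div p))"
proof -
  let ?A = "{n. n \<in> {2..y} \<and> t < smallest_prime_factor n \<and> smallest_prime_factor n \<le> z}"
  let ?P = "{p. prime p \<and> t < p \<and> p \<le> z}"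
  have fib: "{n \<in> ?A. smallest_prime_factor n = p} = {d \<in> rough_upto y (p - 1). p dvd d}" if p: "p \<in> ?P" for p
  proof (intro equalityI subsetI)
    fix n assume n: "n \<in> {n \<in> ?A. smallest_prime_factor n = p}"
    hence "p \<in> prime_factors n" using smallest_prime_factor_in[of n] by auto
    moreover have "p - 1 < q" if "q \<in> prime_factors n" for q
    proof -
      have "p \<le> q" using n that unfolding smallest_prime_factor_def by auto
      moreover have "p > 0" using p by auto
      ultimately show ?thesis by simp
    qed
    ultimately show "n \<in> {d \<in> rough_upto y (p - 1). p dvd d}" using n
      by (auto simp: rough_upto_def)
  next
    fix n assume n: "n \<in> {d \<in> rough_upto y (p - 1). p dvd d}"
    hence n0: "n > 0" "n \<le> y" by (auto simp: rough_upto_def)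
    have pn: "p \<in> prime_factors n" using n n0 p by (auto simp: in_prime_factors_iff)
    have "smallest_prime_factor n = p" unfolding smallest_prime_factor_def
    proof (intro Min_eqI)
      fix q assume "q \<in> prime_factors n"
      hence "p - 1 < q" using n by (auto simp: rough_upto_def)
      thus "p \<le> q" by simp
    qed (use pn in auto)
    moreover have "2 \<le> p" using p by (auto intro: prime_ge_2_nat)
    moreover have "p \<le> n" using n n0 by (intro dvd_imp_le) auto
    ultimately show "n \<in> {n \<in> ?A. smallest_prime_factor n = p}" using n0 p by auto
  qed
  have "(\<Sum>n\<in>?A. \<mu> n / real n * w (smallest_prime_factor n)) =
      (\<Sum>p\<in>?P. \<Sum>n\<in>{n \<in> ?A. smallest_prime_factor n = p}. \<mu> n / real n * w (smallest_prime_factor n))"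
  proof (intro sum.group[symmetric])
    show "smallest_prime_factor ` ?A \<subseteq> ?P" using smallest_prime_factor_in by auto
  qed auto
  also have "\<dots> = (\<Sum>p\<in>?P. w p * (\<Sum>d\<in>{d \<in> rough_upto y (p - 1). p dvd d}. \<mu> d / real d))"
  proof (rule sum.cong[OF refl])
    fix p assume p: "p \<in> ?P"
    have "(\<Sum>n\<in>{n \<in> ?A. smallest_prime_factor n = p}. \<mu> n / real n * w (smallest_prime_factor n)) =
        (\<Sum>n\<in>{n \<in> ?A. smallest_prime_factor n = p}. w p * (\<mu> n / real n))"
      by (intro sum.cong refl) auto
    also have "\<dots> = w p * (\<Sum>n\<in>{n \<in> ?A. smallest_prime_factor n = p}. \<mu> n / real n)"
      by (rule sum_distrib_left[symmetric])
    finally show "(\<Sum>n\<in>{n \<in> ?A. smallest_prime_factor n = p}. \<mu> n / real n * w (smallest_prime_factor n)) =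
        w p * (\<Sum>d\<in>{d \<in> rough_upto y (p - 1). p dvd d}. \<mu> d / real d)"
      unfolding fib[OF p] .
  qed
  also have "\<dots> = (\<Sum>p\<in>?P. - (w p / real p * rough_moebius_sum p (y div p)))"
  proof (rule sum.cong[OF refl])
    fix p assume "p \<in> ?P"
    hence "prime p" by simp
    show "w p * (\<Sum>d\<in>{d \<in> rough_upto y (p - 1). p dvd d}. \<mu> d / real d) =
        - (w p / real p * rough_moebius_sum p (y div p))"
      unfolding sum_moebius_smallest_prime[OF \<open>prime p\<close>] by simp
  qed
  finally show ?thesis by (simp only: sum_negf)
qed

lemma lpf_sum_above_le:
  assumes B: "\<And>n. \<bar>\<Sum>i=1..n. w i * log_prime_ratio i\<bar> \<le> B" and W: "\<And>p. \<bar>w p\<bar> \<le> W"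
  obtains C where "C \<ge> 0" "\<And>t y z. 2 \<le> t \<Longrightarrow>
    \<bar>\<Sum>m | m \<in> {2..y} \<and> t < largest_prime_factor m \<and> largest_prime_factor m \<le> z. w (largest_prime_factor m)\<bar>
      \<le> C * (real y / ln (real t) + 1)"
proof -
  obtain C1 where C1: "C1 \<ge> 0" "\<And>t y z. 2 \<le> t \<Longrightarrow>
    \<bar>\<Sum>p | prime p \<and> t < p \<and> p \<le> z. w p / real p * rough_moebius_sum p (y div p)\<bar> \<le> C1 / ln (real t)"
    using sum_weighted_rough_moebius_le[OF B] by blast
  obtain C2 where C2: "C2 \<ge> 0" "\<And>t y. 2 \<le> t \<Longrightarrow> real (card (rough_upto y t)) \<le> C2 * (real y / ln (real t)) + 1"
    using card_rough_le by blast
  have W0: "W \<ge> 0" using W[of 0] by linarith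
  have "\<bar>\<Sum>m | m \<in> {2..y} \<and> t < largest_prime_factor m \<and> largest_prime_factor m \<le> z. w (largest_prime_factor m)\<bar>
      \<le> (C1 + W * (C2 + 1)) * (real y / ln (real t) + 1)" if t: "2 \<le> t" for t y z
  proof -
    \<comment> \<open>Cutting \<open>w\<close> off outside \<open>(t, z]\<close> moves the condition
      from the largest prime factor of \<open>m\<close> to the smallest prime factor of
      \<open>n\<close> under duality, so that only \<open>n\<close> in \<open>rough_upto y t\<close>
      remain.\<close>
    define f where "f p = (if t < p \<and> p \<le> z then w p else 0)" for p
    let ?A = "{n. n \<in> {2..y} \<and> t < smallest_prime_factor n \<and> smallest_prime_factor n \<le> z}"
    let ?w = "\<lambda>n. w (smallest_prime_factor n)"
    have "(\<Sum>m | m \<in> {2..y} \<and> t < largest_prime_factor m \<and> largest_prime_factor m \<le> z. w (largest_prime_factor m))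
        = (\<Sum>m=2..y. f (largest_prime_factor m))"
      by (intro sum.mono_neutral_cong_left) (auto simp: f_def)
    also have "\<dots> = - (\<Sum>n=2..y. \<mu> n * f (smallest_prime_factor n) * real (y div n))"
      by (rule sum_largest_prime_factor_duality)
    also have "(\<Sum>n=2..y. \<mu> n * f (smallest_prime_factor n) * real (y div n)) =
        (\<Sum>n\<in>?A. \<mu> n * ?w n * real (y div n))"
      by (intro sum.mono_neutral_cong_right) (auto simp: f_def)
    also have "\<dots> = (\<Sum>n\<in>?A. real y * (\<mu> n / real n * ?w n) -
        \<mu> n * ?w n * (real y / real n - real (y div n)))"
      by (intro sum.cong refl) (simp add: algebra_simps)
    also have "\<dots> = real y * (\<Sum>n\<in>?A. \<mu> n / real n * ?w n) -
        (\<Sum>n\<in>?A. \<mu> n * ?w n * (real y / real n - real (y div n)))"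
      by (simp only: sum_subtractf sum_distrib_left)
    finally have eq: "\<bar>\<Sum>m | m \<in> {2..y} \<and> t < largest_prime_factor m \<and> largest_prime_factor m \<le> z. w (largest_prime_factor m)\<bar> \<le>
        \<bar>real y * (\<Sum>n\<in>?A. \<mu> n / real n * ?w n)\<bar> +
        \<bar>\<Sum>n\<in>?A. \<mu> n * ?w n * (real y / real n - real (y div n))\<bar>" by linarith
    have 1: "\<bar>real y * (\<Sum>n\<in>?A. \<mu> n / real n * ?w n)\<bar> \<le> real y * (C1 / ln (real t))"
    proof -
      have "1 \<le> t" using t by simp
      thus ?thesis using C1(2)[OF t, of y z] unfolding sum_moebius_by_smallest_prime[OF \<open>1 \<le> t\<close>] abs_mult abs_minus_cancel
        by (intro mult_mono) auto
    qed
    have "\<bar>\<Sum>n\<in>?A. \<mu> n * ?w n * (real y / real n - real (y div n))\<bar>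
        \<le> (\<Sum>n\<in>?A. \<bar>\<mu> n * ?w n * (real y / real n - real (y div n))\<bar>)" by (rule sum_abs)
    also have "\<dots> \<le> (\<Sum>n\<in>?A. 1 * W * 1)"
    proof (intro sum_mono)
      fix n
      have "\<bar>real y / real n - real (y div n)\<bar> \<le> 1"
        using real_nat_div_le[of y n] real_div_nat_less[of y n] by linarith
      thus "\<bar>\<mu> n * ?w n * (real y / real n - real (y div n))\<bar> \<le> 1 * W * 1"
        unfolding abs_mult using abs_moebius_le_1[of n] W W0 by (intro mult_mono) auto
    qed
    also have "\<dots> = W * real (card ?A)" by simp
    also have "\<dots> \<le> W * (C2 * (real y / ln (real t)) + 1)"
    proof (intro mult_left_mono W0)
      have "card ?A \<le> card (rough_upto y t)"
      proof (intro card_mono subsetI)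
        fix n assume n: "n \<in> ?A"
        have "t < p" if "p \<in> prime_factors n" for p
        proof -
          have "smallest_prime_factor n \<le> p" using that unfolding smallest_prime_factor_def by auto
          thus ?thesis using n by auto
        qed
        thus "n \<in> rough_upto y t" using n by (auto simp: rough_upto_def)
      qed auto
      thus "real (card ?A) \<le> C2 * (real y / ln (real t)) + 1" using C2(2)[OF t, of y] by linarith
    qed
    finally have 2: "\<bar>\<Sum>n\<in>?A. \<mu> n * ?w n * (real y / real n - real (y div n))\<bar>
        \<le> W * (C2 * (real y / ln (real t)) + 1)" .
    have "0 \<le> real y / ln (real t)" using t by simp
    moreover define u where "u = real y / ln (real t)"
    ultimately have u: "u \<ge> 0" by simp
    have "(C1 + W * (C2 + 1)) * (u + 1) = C1 * u + W * (C2 * u + 1) + (C1 + W * C2 + W * u)"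
      by (simp add: algebra_simps)
    moreover have "0 \<le> C1 + W * C2 + W * u" using C1(1) C2(1) W0 u by simp
    ultimately have "C1 * u + W * (C2 * u + 1) \<le> (C1 + W * (C2 + 1)) * (u + 1)" by linarith
    hence "real y * (C1 / ln (real t)) + W * (C2 * (real y / ln (real t)) + 1) \<le> (C1 + W * (C2 + 1)) * (real y / ln (real t) + 1)"
      by (simp add: u_def mult.commute)
    thus ?thesis using eq 1 2 by linarith
  qed
  thus ?thesis using that[of "C1 + W * (C2 + 1)"] C1(1) C2(1) W0 by simp
qed

text \<open>The factor \<open>ln (ln y)\<close> enters here: the numbers with a prime factor above
  \<open>T\<close> contribute O(y / ln T), and \<open>ln T\<close> is \<open>ln y\<close> divided by
  \<open>2 * ln (ln y)\<close>.\<close>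

lemma lpf_sum_eventually_le:
  assumes B: "\<And>n. \<bar>\<Sum>i=1..n. w i * log_prime_ratio i\<bar> \<le> B" and W: "\<And>p. \<bar>w p\<bar> \<le> W"
  obtains C where "C \<ge> 0" "\<forall>\<^sub>F y in sequentially. \<forall>z. \<bar>lpf_sum w y z\<bar> \<le> C * (real y * ln (ln (real y)) / ln (real y))"
proof -
  obtain C1 where C1: "C1 \<ge> 0" "\<And>t y z. 2 \<le> t \<Longrightarrow>
    \<bar>\<Sum>m | m \<in> {2..y} \<and> t < largest_prime_factor m \<and> largest_prime_factor m \<le> z. w (largest_prime_factor m)\<bar>
      \<le> C1 * (real y / ln (real t) + 1)"
    using lpf_sum_above_le[OF B W] by blast
  obtain C2 where C2: "C2 \<ge> 0" "\<forall>\<^sub>F y in sequentially.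
    real (card {m \<in> {1..y}. \<forall>p\<in>prime_factors m. real p \<le> exp (ln (real y) / (2 * ln (ln (real y))))})
      \<le> C2 * (real y / ln (real y))"
    using card_smooth_le by blast
  have W0: "W \<ge> 0" using W[of 0] by linarith
  have ev: "\<forall>\<^sub>F y in sequentially. ln (ln (real y)) \<ge> 1 \<and> 3 \<le> ln (real y) \<and> 3 \<le> ln (real y) / (2 * ln (ln (real y)))
      \<and> 1 \<le> real y * ln (ln (real y)) / ln (real y)"
    by (intro eventually_conj; real_asymp)
  have "\<forall>\<^sub>F y in sequentially. \<forall>z. \<bar>lpf_sum w y z\<bar> \<le> (5 * C1 + W * C2) * (real y * ln (ln (real y)) / ln (real y))"
    using C2(2) ev
  proof eventually_elim
    case (elim y)
    define L where "L = ln (real y)"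
    define LL where "LL = ln L"
    define T where "T = exp (L / (2 * LL))"
    define t where "t = nat \<lfloor>T\<rfloor>"
    from elim have L: "L \<ge> 3" "LL \<ge> 1" "3 \<le> L / (2 * LL)" "1 \<le> real y * LL / L"
      and smooth: "real (card {m \<in> {1..y}. \<forall>p\<in>prime_factors m. real p \<le> T}) \<le> C2 * (real y / L)"
      by (auto simp: L_def LL_def T_def)
    have "T \<ge> 1 + 3" using L(3) exp_ge_add_one_self[of "L / (2 * LL)"] unfolding T_def by linarith
    hence T: "T \<ge> 4" by simp
    have tT: "real t \<le> T" "T - 1 < real t" using T by (auto simp: t_def)
    have t: "t \<ge> 2" using tT T by linarith
    \<comment> \<open>Rounding \<open>T\<close> down to \<open>t\<close> at most halves the
      logarithm, because \<open>T <= (T - 1) ^ 2\<close> for \<open>T >= 4\<close>.\<close>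
    have "4 * T \<le> T * T" using T by (intro mult_right_mono) auto
    moreover have "(T - 1) ^ 2 = T * T - 2 * T + 1" by (simp add: power2_eq_square algebra_simps)
    ultimately have "T \<le> (T - 1) ^ 2" using T by linarith
    also have "\<dots> \<le> real t ^ 2" using tT T by (intro power_mono) auto
    finally have "ln T \<le> ln (real t ^ 2)" using T t by (subst ln_le_cancel_iff) auto
    hence lnt: "L / (2 * LL) \<le> 2 * ln (real t)" using t by (simp add: ln_realpow T_def)
    have bnd: "real y / ln (real t) \<le> 4 * (real y * LL / L)"
    proof -
      have "real y / ln (real t) = 2 * real y / (2 * ln (real t))" by simp
      also have "\<dots> \<le> 2 * real y / (L / (2 * LL))"
        using lnt L t by (intro divide_left_mono mult_pos_pos) auto
      finally show ?thesis using L by (simp add: field_simps)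
    qed
    show ?case
    proof
      fix z
      let ?lpf = "largest_prime_factor"
      let ?S = "{m. m \<in> {2..y} \<and> ?lpf m \<le> z \<and> ?lpf m \<le> t}"
      let ?R = "{m. m \<in> {2..y} \<and> t < ?lpf m \<and> ?lpf m \<le> z}"
      have "lpf_sum w y z = (\<Sum>m\<in>?S. w (?lpf m)) + (\<Sum>m\<in>?R. w (?lpf m))"
        unfolding lpf_sum_def by (subst sum.union_disjoint[symmetric]) (auto intro!: sum.cong)
      moreover have "\<bar>\<Sum>m\<in>?S. w (?lpf m)\<bar> \<le> W * C2 * (real y * LL / L)"
      proof -
        have "\<bar>\<Sum>m\<in>?S. w (?lpf m)\<bar> \<le> (\<Sum>m\<in>?S. \<bar>w (?lpf m)\<bar>)" by (rule sum_abs)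
        also have "\<dots> \<le> (\<Sum>m\<in>?S. W)" by (intro sum_mono W)
        also have "\<dots> = W * real (card ?S)" by simp
        also have "\<dots> \<le> W * (C2 * (real y / L))"
        proof (intro mult_left_mono W0)
          have "card ?S \<le> card {m \<in> {1..y}. \<forall>p\<in>prime_factors m. real p \<le> T}"
          proof (intro card_mono subsetI)
            fix m assume m: "m \<in> ?S"
            have "real p \<le> T" if "p \<in> prime_factors m" for p
            proof -
              have "p \<le> ?lpf m" using that unfolding largest_prime_factor_def by auto
              hence "p \<le> t" using m by auto
              thus ?thesis using tT(1) by linarith
            qed
            thus "m \<in> {m \<in> {1..y}. \<forall>p\<in>prime_factors m. real p \<le> T}" using m by auto
          qed auto
          thus "real (card ?S) \<le> C2 * (real y / L)" using smooth by linarith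
        qed
        also have "\<dots> \<le> W * (C2 * (real y * LL / L))"
          using W0 C2(1) L by (intro mult_left_mono divide_right_mono) (auto simp: mult_le_cancel_left1)
        finally show ?thesis by (simp add: mult.assoc)
      qed
      moreover have "\<bar>\<Sum>m\<in>?R. w (?lpf m)\<bar> \<le> 5 * C1 * (real y * LL / L)"
      proof -
        have "\<bar>\<Sum>m\<in>?R. w (?lpf m)\<bar> \<le> C1 * (real y / ln (real t) + 1)" by (rule C1(2)[OF t])
        also have "\<dots> \<le> C1 * (4 * (real y * LL / L) + real y * LL / L)"
          using bnd L(4) C1(1) by (intro mult_left_mono add_mono) auto
        finally show ?thesis by (simp add: algebra_simps)
      qed
      ultimately have "\<bar>lpf_sum w y z\<bar> \<le> 5 * C1 * (real y * LL / L) + W * C2 * (real y * LL / L)" by linarith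
      thus "\<bar>lpf_sum w y z\<bar> \<le> (5 * C1 + W * C2) * (real y * ln (ln (real y)) / ln (real y))"
        by (simp only: distrib_right L_def LL_def)
    qed
  qed
  thus ?thesis using that[of "5 * C1 + W * C2"] C1(1) C2(1) W0 by simp
qed

text \<open>This form can be summed over \<open>y = N div Q\<close>: the \<open>+ 2\<close> keeps
  the logarithm positive for every \<open>y\<close>, and \<open>ln (ln N)\<close> replaces
  \<open>ln (ln y)\<close>, which may be negative for small \<open>y\<close>. Where the eventual
  bound does not apply yet, the trivial bound \<open>W * y\<close> suffices.\<close>

lemma lpf_sum_le:
  assumes B: "\<And>n. \<bar>\<Sum>i=1..n. w i * log_prime_ratio i\<bar> \<le> B" and W: "\<And>p. \<bar>w p\<bar> \<le> W"
  obtains C where "C \<ge> 0" "\<And>N y z. 27 \<le> N \<Longrightarrow> y \<le> N \<Longrightarrow>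
    \<bar>lpf_sum w y z\<bar> \<le> C * (real y * ln (ln (real N)) / ln (real y + 2))"
proof -
  obtain C1 where C1: "C1 \<ge> 0" "\<forall>\<^sub>F y in sequentially. \<forall>z. \<bar>lpf_sum w y z\<bar> \<le> C1 * (real y * ln (ln (real y)) / ln (real y))"
    using lpf_sum_eventually_le[OF B W] by blast
  then obtain Y where Y: "\<And>y z. y \<ge> Y \<Longrightarrow> \<bar>lpf_sum w y z\<bar> \<le> C1 * (real y * ln (ln (real y)) / ln (real y))"
    unfolding eventually_sequentially by blast
  have W0: "W \<ge> 0" using W[of 0] by linarith
  define C where "C = 2 * C1 + W * ln (real Y + 5)"
  have C0: "C \<ge> 0" using C1(1) W0 by (simp add: C_def)
  have "\<bar>lpf_sum w y z\<bar> \<le> C * (real y * ln (ln (real N)) / ln (real y + 2))"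
    if N: "27 \<le> N" "y \<le> N" for N y z
  proof -
    have LL: "ln (ln (real N)) \<ge> 1" using ln_ln_ge_1 N by simp
    have ln2: "ln (real y + 2) > 0" by simp
    show ?thesis
    proof (cases "y \<ge> Y \<and> y \<ge> 3")
      case True
      hence y: "y \<ge> Y" "y \<ge> 3" by auto
      have lny: "ln (real y) > 0" using y by simp
      have "2 * real y \<le> real y * real y" using y by (intro mult_right_mono) auto
      hence "real y + 2 \<le> real y ^ 2" using y unfolding power2_eq_square by linarith
      hence "ln (real y + 2) \<le> ln (real y ^ 2)" using y by (subst ln_le_cancel_iff) auto
      hence le: "ln (real y + 2) \<le> 2 * ln (real y)" using y by (simp add: ln_realpow)
      have "\<bar>lpf_sum w y z\<bar> \<le> C1 * (real y * ln (ln (real y)) / ln (real y))" by (rule Y[OF y(1)])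
      also have "\<dots> \<le> C1 * (real y * ln (ln (real N)) / ln (real y))"
        using y N lny C1(1) by (intro mult_left_mono divide_right_mono) auto
      also have "\<dots> = C1 * (2 * (real y * ln (ln (real N))) / (2 * ln (real y)))" by simp
      also have "\<dots> \<le> C1 * (2 * (real y * ln (ln (real N))) / ln (real y + 2))"
        using le y ln2 LL C1(1) by (intro mult_left_mono divide_left_mono mult_pos_pos) auto
      also have "\<dots> = (2 * C1) * (real y * ln (ln (real N)) / ln (real y + 2))" by simp
      also have "\<dots> \<le> C * (real y * ln (ln (real N)) / ln (real y + 2))"
        using W0 LL ln2 by (intro mult_right_mono) (auto simp: C_def)
      finally show ?thesis .
    next
      case False
      have "\<bar>lpf_sum w y z\<bar> \<le> (\<Sum>m | m \<in> {2..y} \<and> largest_prime_factor m \<le> z. \<bar>w (largest_prime_factor m)\<bar>)"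
        unfolding lpf_sum_def by (rule sum_abs)
      also have "\<dots> \<le> (\<Sum>m | m \<in> {2..y} \<and> largest_prime_factor m \<le> z. W)" by (intro sum_mono W)
      also have "\<dots> \<le> (\<Sum>m=1..y. W)" using W0 by (intro sum_mono2) auto
      also have "\<dots> = W * real y" by simp
      also have "\<dots> \<le> W * (real y * (ln (ln (real N)) * ln (real Y + 5) / ln (real y + 2)))"
      proof -
        have "ln (real y + 2) \<le> ln (real Y + 5)" using False by (subst ln_le_cancel_iff) auto
        hence "1 * ln (real y + 2) \<le> ln (ln (real N)) * ln (real Y + 5)" using LL ln2
          by (intro mult_mono) auto
        hence "1 \<le> ln (ln (real N)) * ln (real Y + 5) / ln (real y + 2)" using ln2 by (simp add: le_divide_eq)
        from mult_left_mono[OF this, of "W * real y"] show ?thesis using W0 by simp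
      qed
      also have "\<dots> = (W * ln (real Y + 5)) * (real y * ln (ln (real N)) / ln (real y + 2))" by simp
      also have "\<dots> \<le> C * (real y * ln (ln (real N)) / ln (real y + 2))"
        using C1(1) LL ln2 by (intro mult_right_mono) (auto simp: C_def)
      finally show ?thesis .
    qed
  qed
  thus ?thesis using that[OF C0] by blast
qed

section \<open>Primes in arithmetic progressions\<close>

definition mertens_regular :: "(nat \<Rightarrow> complex) \<Rightarrow> bool" where
  "mertens_regular f \<longleftrightarrow> (\<exists>\<delta> B. \<forall>N.
    norm ((\<Sum>n=1..N. f n * of_real (log_prime_ratio n)) - \<delta> * of_real (ln (real N))) \<le> B)"

lemma mertens_regular_add:
  assumes "mertens_regular f" "mertens_regular g"
  shows "mertens_regular (\<lambda>n. f n + g n)"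
proof -
  let ?S = "\<lambda>f N. \<Sum>n=1..N. f n * complex_of_real (log_prime_ratio n)"
  obtain \<delta> B \<delta>' B' where 1: "\<And>N. norm (?S f N - \<delta> * of_real (ln (real N))) \<le> B"
    and 2: "\<And>N. norm (?S g N - \<delta>' * of_real (ln (real N))) \<le> B'"
    using assms unfolding mertens_regular_def by metis
  have "norm (?S (\<lambda>n. f n + g n) N - (\<delta> + \<delta>') * of_real (ln (real N))) \<le> B + B'" for N
  proof -
    have "?S (\<lambda>n. f n + g n) N - (\<delta> + \<delta>') * of_real (ln (real N)) =
        (?S f N - \<delta> * of_real (ln (real N))) + (?S g N - \<delta>' * of_real (ln (real N)))"
      by (simp add: sum.distrib algebra_simps)
    thus ?thesis using norm_triangle_mono[OF 1[of N] 2[of N]] by (simp only:)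
  qed
  thus ?thesis unfolding mertens_regular_def by blast
qed

lemma mertens_regular_scale:
  assumes "mertens_regular f"
  shows "mertens_regular (\<lambda>n. c * f n)"
proof -
  let ?S = "\<lambda>f N. \<Sum>n=1..N. f n * complex_of_real (log_prime_ratio n)"
  obtain \<delta> B where 1: "\<And>N. norm (?S f N - \<delta> * of_real (ln (real N))) \<le> B"
    using assms unfolding mertens_regular_def by metis
  have "norm (?S (\<lambda>n. c * f n) N - (c * \<delta>) * of_real (ln (real N))) \<le> norm c * B" for N
  proof -
    have "?S (\<lambda>n. c * f n) N - (c * \<delta>) * of_real (ln (real N)) = c * (?S f N - \<delta> * of_real (ln (real N)))"
      by (simp add: right_diff_distrib sum_distrib_left mult.assoc)
    thus ?thesis using mult_left_mono[OF 1[of N], of "norm c"] by (simp add: norm_mult)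
  qed
  thus ?thesis unfolding mertens_regular_def by blast
qed

lemma mertens_regular_zero: "mertens_regular (\<lambda>_. 0)"
  unfolding mertens_regular_def by (intro exI[of _ 0]) simp

definition periodic_on_units :: "nat \<Rightarrow> (nat \<Rightarrow> complex) \<Rightarrow> bool" where
  "periodic_on_units l f \<longleftrightarrow> (\<forall>m n. [m = n] (mod l) \<longrightarrow> f m = f n) \<and> (\<forall>n. \<not> coprime n l \<longrightarrow> f n = 0)"

text \<open>The commuting translations \<open>f \<mapsto> (\<lambda>n. f (a * n))\<close> have finite order, so discrete Fourier
  analysis, applied to one unit \<open>a\<close> after the other, splits any function into joint eigenfunctions.
  This replaces the orthogonality relations of Dirichlet characters.\<close>

lemma periodic_on_units_eigen_induct:
  assumes "l > 0" and zero: "P (\<lambda>_. 0)" and add: "\<And>f g. P f \<Longrightarrow> P g \<Longrightarrow> P (\<lambda>n. f n + g n)"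
    and eigen: "\<And>f. periodic_on_units l f \<Longrightarrow>
      (\<And>a. coprime a l \<Longrightarrow> \<exists>c. \<forall>n. f (a * n) = c * f n) \<Longrightarrow> P f"
    and "periodic_on_units l f"
  shows "P f"
proof -
  define U where "U = {a \<in> {..<l}. coprime a l}"
  \<comment> \<open>By Euler's theorem every translation by a unit has order dividing
    \<open>h\<close>, so its eigenvalues are powers of the root of unity \<open>v\<close>.\<close>
  define h where "h = totient l"
  have h0: "h > 0" using \<open>l > 0\<close> by (simp add: h_def)
  define v where "v = exp (2 * of_real pi * \<i> / of_nat h)"
  have v: "v ^ i = exp (2 * of_real pi * \<i> * of_nat i / of_nat h)" for i
    unfolding v_def exp_of_nat_mult[symmetric] by (simp add: algebra_simps)
  have v1: "v ^ i = 1 \<longleftrightarrow> h dvd i" for i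
    unfolding v using h0 by (intro complex_root_unity_eq_1) simp
  have v0: "v \<noteq> 0" by (simp add: v_def)
  have sum_v: "(\<Sum>r<h. v ^ (r * i)) = (if i = 0 then of_nat h else 0)" if "i < h" for i
  proof (cases "i = 0")
    case False
    hence "v ^ i \<noteq> 1" using v1 that by (auto dest: dvd_imp_le)
    moreover have "(v ^ i) ^ h = 1" using v1[of "i * h"] by (simp add: power_mult[symmetric])
    ultimately have "(\<Sum>r<h. (v ^ i) ^ r) = 0" by (simp add: geometric_sum)
    thus ?thesis using False by (simp add: power_mult[symmetric] mult.commute)
  qed simp
  have sumP: "P (\<lambda>n. \<Sum>r\<in>R. F r n)" if "finite R" "\<And>r. r \<in> R \<Longrightarrow> P (F r)" for R :: "nat set" and F
    using that by (induction R rule: finite_induct) (auto intro: zero add)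
  \<comment> \<open>\<open>A\<close> collects the units whose translation need not yet act on
    \<open>f\<close> as a scalar. For \<open>A = {}\<close> the assumption \<open>eigen\<close>
    applies, and for \<open>A = U\<close> nothing is required beyond periodicity.\<close>
  have "\<forall>f. periodic_on_units l f \<longrightarrow> (\<forall>a\<in>U - A. \<exists>c. \<forall>n. f (a * n) = c * f n) \<longrightarrow> P f"
    if "finite A" "A \<subseteq> U" for A
    using that
  proof (induction A rule: finite_induct)
    case empty
    show ?case
    proof (intro allI impI)
      fix f assume f: "periodic_on_units l f" "\<forall>a\<in>U - {}. \<exists>c. \<forall>n. f (a * n) = c * f n"
      show "P f"
      proof (rule eigen[OF f(1)])
        fix a assume a: "coprime a l"
        have "a mod l \<in> U" using a \<open>l > 0\<close> by (simp add: U_def)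
        then obtain c where c: "\<forall>n. f (a mod l * n) = c * f n" using f(2) by blast
        have "f (a * n) = c * f n" for n
        proof -
          have "[a mod l * n = a * n] (mod l)" by (rule cong_scalar_right) simp
          thus ?thesis using f(1) c unfolding periodic_on_units_def by metis
        qed
        thus "\<exists>c. \<forall>n. f (a * n) = c * f n" by blast
      qed
    qed
  next
    case (insert a A)
    show ?case
    proof (intro allI impI)
      fix f assume f: "periodic_on_units l f" "\<forall>b\<in>U - insert a A. \<exists>c. \<forall>n. f (b * n) = c * f n"
      have per: "f m = f n" if "[m = n] (mod l)" for m n using f(1) that by (auto simp: periodic_on_units_def)
      have nc: "f n = 0" if "\<not> coprime n l" for n using f(1) that by (auto simp: periodic_on_units_def)
      \<comment> \<open>Projection of \<open>f\<close> to the eigenspace of the translation by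
        \<open>a\<close> with eigenvalue \<open>inverse (v ^ r)\<close>. It commutes with the other
        translations, so the scalars already obtained are kept.\<close>
      define F where "F r n = (\<Sum>i<h. v ^ (r * i) * f (a ^ i * n)) / of_nat h" for r n
      have "P (F r)" for r
      proof -
        have "periodic_on_units l (F r)"
          unfolding periodic_on_units_def
        proof (intro conjI allI impI)
          fix m n assume "[m = n] (mod l)"
          hence "f (a ^ i * m) = f (a ^ i * n)" for i by (intro per cong_scalar_left)
          thus "F r m = F r n" by (simp add: F_def)
        next
          fix n assume "\<not> coprime n l"
          hence "f (a ^ i * n) = 0" for i by (intro nc) simp
          thus "F r n = 0" by (simp add: F_def)
        qed
        moreover have "\<exists>c. \<forall>n. F r (b * n) = c * F r n" if b: "b \<in> U - A" for b
        proof (cases "b = a")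
          case False
          then obtain c where c: "\<And>n. f (b * n) = c * f n" using f(2) b by blast
          have "F r (b * n) = c * F r n" for n
          proof -
            have "f (a ^ i * (b * n)) = c * f (a ^ i * n)" for i
              using c[of "a ^ i * n"] by (simp add: mult.left_commute)
            thus ?thesis by (simp add: F_def sum_distrib_left mult.left_commute)
          qed
          thus ?thesis by blast
        next
          case True
          have "v ^ r * F r (a * n) = F r n" for n
          proof -
            define G where "G i = v ^ (r * i) * f (a ^ i * n)" for i
            have "[a ^ h = 1] (mod l)" unfolding h_def
              using b True by (intro euler_theorem) (auto simp: U_def)
            hence "[a ^ h * n = 1 * n] (mod l)" by (rule cong_scalar_right)
            hence "f (a ^ h * n) = f (1 * n)" by (rule per)
            moreover have "v ^ (r * h) = 1" using v1 by simp
            ultimately have Gh: "G h = G 0" by (simp add: G_def)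
            have "G 0 + (\<Sum>i<h. G (Suc i)) = (\<Sum>i<h. G i) + G h"
              by (metis sum.lessThan_Suc sum.lessThan_Suc_shift)
            hence eq: "(\<Sum>i<h. G (Suc i)) = (\<Sum>i<h. G i)" using Gh by simp
            have "v ^ r * F r (a * n) = (\<Sum>i<h. G (Suc i)) / of_nat h"
              by (simp add: F_def G_def sum_distrib_left power_add algebra_simps)
            also have "\<dots> = F r n" unfolding eq by (simp add: F_def G_def)
            finally show ?thesis .
          qed
          hence "F r (a * n) = inverse (v ^ r) * F r n" for n
            using v0 by (metis mult.assoc left_inverse mult_1 power_not_zero)
          thus ?thesis using True by blast
        qed
        ultimately show ?thesis using insert.IH insert.prems by blast
      qed
      hence "P (\<lambda>n. \<Sum>r\<in>{..<h}. F r n)" by (intro sumP) auto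
      also have "(\<lambda>n. \<Sum>r\<in>{..<h}. F r n) = f"
      proof
        fix n
        have "(\<Sum>r<h. F r n) = (\<Sum>r<h. \<Sum>i<h. v ^ (r * i) * f (a ^ i * n)) / of_nat h"
          by (simp add: F_def sum_divide_distrib)
        also have "(\<Sum>r<h. \<Sum>i<h. v ^ (r * i) * f (a ^ i * n)) = (\<Sum>i<h. (\<Sum>r<h. v ^ (r * i)) * f (a ^ i * n))"
          by (subst sum.swap) (simp add: sum_distrib_right)
        also have "\<dots> = (\<Sum>i<h. if i = 0 then of_nat h * f n else 0)"
          by (intro sum.cong refl) (auto simp: sum_v)
        also have "\<dots> = of_nat h * f n" using h0 by simp
        finally show "(\<Sum>r<h. F r n) = f n" using h0 by simp
      qed
      finally show "P f" .
    qed
  qed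
  from this[of U] show ?thesis using assms(5) by (auto simp: U_def)
qed

section \<open>Mertens' estimate for Dirichlet characters\<close>

lemma sum_divisors_nested_swap:
  fixes F :: "nat \<Rightarrow> nat \<Rightarrow> 'a::comm_monoid_add"
  assumes "n > 0"
  shows "(\<Sum>d | d dvd n. \<Sum>e | e dvd n div d. F d e) = (\<Sum>e | e dvd n. \<Sum>d | d dvd n div e. F d e)"
proof -
  have fin: "finite {d. d dvd n div e}" if "e dvd n" for e
    using that assms by (intro finite_divisors_nat) (auto elim!: dvdE)
  have iff: "d dvd n \<and> e dvd n div d \<longleftrightarrow> d * e dvd n" for d e
    using assms by (metis div_dvd_div dvd_div_iff_mult dvd_mult_left dvd_0_left mult.commute neq0_conv)
  have *: "e dvd n \<and> d dvd n div e" if "d dvd n" "e dvd n div d" for d e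
    using iff[of d e] iff[of e d] that by (simp add: mult.commute)
  have "(\<Sum>d | d dvd n. \<Sum>e | e dvd n div d. F d e) = (\<Sum>(d,e)\<in>(SIGMA d:{d. d dvd n}. {e. e dvd n div d}). F d e)"
    using assms fin by (intro sum.Sigma) auto
  also have "\<dots> = (\<Sum>(e,d)\<in>(SIGMA e:{e. e dvd n}. {d. d dvd n div e}). F d e)"
  proof (rule sum.reindex_bij_witness[where i = prod.swap and j = prod.swap])
    fix x assume "x \<in> (SIGMA d:{d. d dvd n}. {e. e dvd n div d})"
    then obtain d e where x: "x = (d, e)" "d dvd n" "e dvd n div d" by blast
    show "prod.swap x \<in> (SIGMA e:{e. e dvd n}. {d. d dvd n div e})" using x(1) *[OF x(2,3)] by simp
  next
    fix x assume "x \<in> (SIGMA e:{e. e dvd n}. {d. d dvd n div e})"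
    then obtain d e where x: "x = (d, e)" "d dvd n" "e dvd n div d" by blast
    show "prod.swap x \<in> (SIGMA d:{d. d dvd n}. {e. e dvd n div d})" using x(1) *[OF x(2,3)] by simp
  qed auto
  also have "\<dots> = (\<Sum>e | e dvd n. \<Sum>d | d dvd n div e. F d e)"
    using assms fin by (intro sum.Sigma[symmetric]) auto
  finally show ?thesis .
qed

text \<open>Moebius inversion of \<open>mangoldt_sum\<close>, followed by
  \<open>ln (n div d) = ln n - ln d\<close>. The part with \<open>ln n\<close> vanishes, either
  through the Moebius sum or because \<open>ln 1 = 0\<close>.\<close>

lemma sum_moebius_ln:
  assumes "n > 0"
  shows "(\<Sum>d | d dvd n. \<mu> d * ln (real d)) = - mangoldt n"
proof -
  have "(\<Sum>d | d dvd n. \<mu> d * ln (real (n div d))) =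
      (\<Sum>d | d dvd n. \<Sum>e | e dvd n div d. \<mu> d * mangoldt e)"
  proof (intro sum.cong refl)
    fix d assume "d \<in> {d. d dvd n}"
    hence "n div d \<noteq> 0" using assms by (auto elim!: dvdE)
    from mangoldt_sum[OF this, where ?'a = real]
    show "\<mu> d * ln (real (n div d)) =
        (\<Sum>e | e dvd n div d. \<mu> d * mangoldt e)"
      by (simp add: sum_distrib_left[symmetric])
  qed
  also have "\<dots> = (\<Sum>e | e dvd n. \<Sum>d | d dvd n div e. \<mu> d * mangoldt e)"
    by (rule sum_divisors_nested_swap[OF assms])
  also have "\<dots> = (\<Sum>e | e dvd n. if e = n then mangoldt e else 0)"
  proof (intro sum.cong refl)
    fix e assume e: "e \<in> {e. e dvd n}"
    hence pos: "n div e > 0" using assms by (auto elim!: dvdE)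
    have "n div e = 1 \<longleftrightarrow> e = n" using e assms by (auto elim!: dvdE)
    thus "(\<Sum>d | d dvd n div e. \<mu> d * mangoldt e) = (if e = n then mangoldt e else 0)"
      using sum_moebius_divisors[OF pos] by (simp add: sum_distrib_right[symmetric])
  qed
  also have "\<dots> = mangoldt n" using assms by simp
  finally have 1: "(\<Sum>d | d dvd n. \<mu> d * ln (real (n div d))) = mangoldt n" .
  have "(\<Sum>d | d dvd n. \<mu> d * ln (real (n div d))) =
      (\<Sum>d | d dvd n. ln (real n) * \<mu> d - \<mu> d * ln (real d))"
  proof (intro sum.cong refl)
    fix d assume "d \<in> {d. d dvd n}"
    then obtain e where e: "n = d * e" "d > 0" "e > 0" using assms by (auto elim!: dvdE)
    thus "\<mu> d * ln (real (n div d)) =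
        ln (real n) * \<mu> d - \<mu> d * ln (real d)"
      by (simp add: ln_mult algebra_simps)
  qed
  also have "\<dots> = ln (real n) * (\<Sum>d | d dvd n. \<mu> d) - (\<Sum>d | d dvd n. \<mu> d * ln (real d))"
    by (simp only: sum_subtractf sum_distrib_left)
  also have "ln (real n) * (\<Sum>d | d dvd n. \<mu> d) = 0"
    using sum_moebius_divisors[OF assms] by simp
  finally show ?thesis using 1 by simp
qed

lemma norm_completely_multiplicative_le_1:
  fixes \<psi> :: "nat \<Rightarrow> complex"
  assumes "l > 0" "periodic_on_units l \<psi>" "\<psi> 1 = 1" "\<And>a b. \<psi> (a * b) = \<psi> a * \<psi> b"
  shows "norm (\<psi> n) \<le> 1"
proof (cases "coprime n l")
  case True
  have pow: "\<psi> (n ^ i) = \<psi> n ^ i" for i using assms(3,4) by (induction i) auto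
  have "[n ^ totient l = 1] (mod l)" using True by (rule euler_theorem)
  hence "\<psi> (n ^ totient l) = 1" using assms(2,3) unfolding periodic_on_units_def by metis
  hence "norm (\<psi> n) ^ totient l = 1" by (metis pow norm_power norm_one)
  hence "norm (\<psi> n) = 1" 
    using \<open>l > 0\<close> power_eq_imp_eq_base[of "norm (\<psi> n)" "totient l" 1] by simp
  thus ?thesis by simp
next
  case False
  thus ?thesis using assms(2) by (simp add: periodic_on_units_def)
qed

text \<open>Multiplication by \<open>a\<close> permutes the residues, so the sum over a period
  equals \<open>\<psi> a\<close> times itself and vanishes. The extra 1 pays for
  \<open>\<psi> 0\<close>: the periods start at 0, the sum at 1.\<close>

lemma sum_nonprincipal_bounded:
  fixes \<psi> :: "nat \<Rightarrow> complex"
  assumes l: "l > 0" and per: "periodic_on_units l \<psi>" and one: "\<psi> 1 = 1"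
    and mult: "\<And>a b. \<psi> (a * b) = \<psi> a * \<psi> b"
    and a: "coprime a l" "\<psi> a \<noteq> 1"
  shows "norm (\<Sum>n=1..N. \<psi> n) \<le> real l + 1"
proof -
  note le1 = norm_completely_multiplicative_le_1[OF l per one mult]
  have per': "\<psi> m = \<psi> n" if "[m = n] (mod l)" for m n using per that by (auto simp: periodic_on_units_def)
  define s where "s N = (\<Sum>n<N. \<psi> n)" for N
  have "bij_betw (\<lambda>n. a * n mod l) {..<l} {..<l}"
  proof -
    have "inj_on (\<lambda>n. a * n mod l) {..<l}"
    proof (rule inj_onI)
      fix x y assume "x \<in> {..<l}" "y \<in> {..<l}" "a * x mod l = a * y mod l"
      hence "[a * x = a * y] (mod l)" by (simp add: Cong.cong_def)
      hence "[x = y] (mod l)" using a(1) by (simp add: cong_mult_lcancel_nat)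
      thus "x = y" using \<open>x \<in> {..<l}\<close> \<open>y \<in> {..<l}\<close> by (simp add: cong_less_modulus_unique_nat)
    qed
    moreover have "(\<lambda>n. a * n mod l) ` {..<l} \<subseteq> {..<l}" using l by auto
    ultimately show ?thesis by (simp add: bij_betw_def endo_inj_surj)
  qed
  hence "s l = (\<Sum>n<l. \<psi> (a * n mod l))"
    unfolding s_def by (rule sum.reindex_bij_betw[symmetric])
  also have "\<dots> = (\<Sum>n<l. \<psi> a * \<psi> n)"
  proof (intro sum.cong refl)
    fix n
    have "\<psi> (a * n mod l) = \<psi> (a * n)" by (rule per') simp
    thus "\<psi> (a * n mod l) = \<psi> a * \<psi> n" by (simp add: mult)
  qed
  also have "\<dots> = \<psi> a * s l" by (simp add: s_def sum_distrib_left)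
  finally have "(1 - \<psi> a) * s l = 0" by (simp add: algebra_simps)
  hence sl: "s l = 0" using a(2) by simp
  have shift: "s (N + l) = s N" for N
  proof (induction N)
    case (Suc N)
    have "\<psi> (N + l) = \<psi> N" by (rule per') (simp add: Cong.cong_def)
    thus ?case using Suc by (simp add: s_def)
  qed (use sl in \<open>simp add: s_def\<close>)
  have "norm (s N) \<le> real l" for N
  proof (induction N rule: less_induct)
    case (less N)
    show ?case
    proof (cases "N < l")
      case True
      have "norm (s N) \<le> (\<Sum>n<N. norm (\<psi> n))" unfolding s_def by (rule norm_sum)
      also have "\<dots> \<le> (\<Sum>n<N. 1)" by (intro sum_mono le1)
      finally show ?thesis using True by simp
    next
      case False
      hence "s N = s (N - l)" using shift[of "N - l"] by simp
      thus ?thesis using less.IH[of "N - l"] False l by simp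
    qed
  qed
  moreover have "(\<Sum>n=1..N. \<psi> n) = s (Suc N) - \<psi> 0"
  proof -
    have "s (Suc N) = (\<Sum>n\<in>insert 0 {1..N}. \<psi> n)" unfolding s_def by (intro sum.cong) auto
    thus ?thesis by simp
  qed
  ultimately show ?thesis using le1[of 0] norm_triangle_ineq4[of "s (Suc N)" "\<psi> 0"]
    by (smt (verit))
qed

lemma ln_div_self_decreasing:
  assumes "n \<ge> (3::nat)"
  shows "ln (real (Suc n)) / real (Suc n) \<le> ln (real n) / real n"
proof -
  have "exp 1 \<le> real n" using exp_le assms by linarith
  hence 1: "1 \<le> ln (real n)" using assms by (simp add: ln_ge_iff)
  have "real (Suc n) = real n * (1 + 1 / real n)" using assms by (simp add: field_simps)
  hence "ln (real (Suc n)) = ln (real n * (1 + 1 / real n))" by (simp only:)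
  also have "\<dots> = ln (real n) + ln (1 + 1 / real n)"
    using assms by (intro ln_mult_pos) (auto intro: add_pos_nonneg)
  also have "\<dots> \<le> ln (real n) + 1 / real n"
    by (intro add_left_mono ln_add_one_self_le_self) simp
  finally have "real n * ln (real (Suc n)) \<le> real n * (ln (real n) + 1 / real n)"
    by (rule mult_left_mono) simp
  also have "\<dots> = real n * ln (real n) + 1" using assms by (simp add: distrib_left)
  also have "\<dots> \<le> real (Suc n) * ln (real n)" using 1 by (simp add: algebra_simps)
  finally show ?thesis using assms by (simp add: field_simps)
qed

text \<open>In the application \<open>L\<close> is L(1, \<psi>). The explicit rate matters: at
  \<open>N div d\<close> the error is O(d / N), which compensates the weights \<open>1 / d\<close>
  of the sums in which it occurs.\<close>

lemma sum_nonprincipal_over_n: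
  fixes \<psi> :: "nat \<Rightarrow> complex"
  assumes B: "\<And>N. norm (\<Sum>n=1..N. \<psi> n) \<le> B"
  obtains L where "\<And>N. norm ((\<Sum>n=1..N. \<psi> n / of_nat n) - L) \<le> 2 * B / real (N + 1)"
proof -
  define A where "A N = (\<Sum>n=1..N. \<psi> n / of_nat n)" for N
  have diff: "norm (A N - A M) \<le> 2 * B / real (M + 1)" if "M \<le> N" for M N
  proof -
    have "A N - A M = (\<Sum>n=M+1..N. (1 / real n) *\<^sub>R \<psi> n)"
      using that sum.ub_add_nat[of 1 M "\<lambda>n. \<psi> n / of_nat n" "N - M"]
      by (simp add: A_def scaleR_conv_of_real)
    also have "norm \<dots> \<le> 2 * B * (1 / real (M + 1))"
      by (rule sum_by_parts_decreasing[OF B]) (auto simp: frac_le)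
    finally show ?thesis by simp
  qed
  have B0: "B \<ge> 0" using B[of 0] by simp
  have "Cauchy A"
  proof (rule CauchyI')
    fix e :: real assume e: "e > 0"
    obtain M :: nat where M: "real M > 2 * B / e" using reals_Archimedean2 by blast
    have "norm (A m - A n) < e" if "m \<ge> M" "n > m" for m n
    proof -
      have 1: "norm (A m - A n) \<le> 2 * B / real (m + 1)"
        using diff[of m n] that by (simp add: norm_minus_commute)
      have "2 * B < e * real M" using M e by (simp add: field_simps)
      also have "\<dots> \<le> e * real (m + 1)" using that e by (intro mult_left_mono) auto
      finally have "2 * B / real (m + 1) < e" by (simp add: field_simps)
      thus ?thesis using 1 by linarith
    qed
    thus "\<exists>M. \<forall>m\<ge>M. \<forall>n>m. dist (A m) (A n) < e" unfolding dist_norm by blast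
  qed
  then obtain L where L: "A \<longlonglongrightarrow> L" using Cauchy_convergent convergent_def by blast
  have "norm (A N - L) \<le> 2 * B / real (N + 1)" for N
  proof -
    have "(\<lambda>n. norm (A n - A N)) \<longlonglongrightarrow> norm (L - A N)" by (intro tendsto_intros L)
    hence "norm (L - A N) \<le> 2 * B / real (N + 1)"
      by (rule LIMSEQ_le_const2) (use diff in blast)
    thus ?thesis by (simp add: norm_minus_commute)
  qed
  thus ?thesis using that unfolding A_def by blast
qed

text \<open>The slope \<delta> is 1 for the principal character, 0 if L(1, \<psi>) is nonzero and -1
  if it is zero. In the second case a bounded sum equals L(1, \<psi>) times the wanted one up to
  O(1). In the third the truncated L-sums are themselves O(d / N), so that a Moebius-weighted sum of
  them is bounded.\<close>

lemma completely_multiplicative_mertens_regular: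
  fixes \<psi> :: "nat \<Rightarrow> complex"
  assumes l: "l > 0" and per: "periodic_on_units l \<psi>" and one: "\<psi> 1 = 1"
    and mult: "\<And>a b. \<psi> (a * b) = \<psi> a * \<psi> b"
  shows "mertens_regular \<psi>"
proof (cases "\<forall>a. coprime a l \<longrightarrow> \<psi> a = 1")
  case True
  obtain B where B: "\<And>N. \<bar>(\<Sum>n=1..N. log_prime_ratio n) - ln (real N)\<bar> \<le> B"
    using mertens_first by blast
  have lpr0: "log_prime_ratio n \<ge> 0" for n
    by (cases "n = 0") (auto simp: log_prime_ratio_def)
  \<comment> \<open>Bounds the share of the primes dividing \<open>l\<close>, on which
    \<open>\<psi>\<close> vanishes; the composite divisors add 0.\<close>
  define K where "K = (\<Sum>d | d dvd l. log_prime_ratio d)"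
  have "norm ((\<Sum>n=1..N. \<psi> n * of_real (log_prime_ratio n)) - 1 * of_real (ln (real N))) \<le> B + K" for N
  proof -
    let ?X = "\<Sum>n | n \<in> {1..N} \<and> \<not> coprime n l. log_prime_ratio n"
    have "(\<Sum>n=1..N. \<psi> n * of_real (log_prime_ratio n)) =
        (\<Sum>n=1..N. of_real (log_prime_ratio n) - (if \<not> coprime n l then of_real (log_prime_ratio n) else 0))"
      by (intro sum.cong refl) (use True per in \<open>auto simp: periodic_on_units_def\<close>)
    also have "\<dots> = of_real ((\<Sum>n=1..N. log_prime_ratio n) - ?X)"
      by (auto simp: sum_subtractf sum.inter_filter[symmetric] intro!: sum.cong)
    finally have "(\<Sum>n=1..N. \<psi> n * of_real (log_prime_ratio n)) - 1 * of_real (ln (real N)) =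
        complex_of_real ((\<Sum>n=1..N. log_prime_ratio n) - ?X - ln (real N))" by simp
    moreover have "0 \<le> ?X" by (intro sum_nonneg lpr0)
    moreover have "?X \<le> K"
    proof -
      have "?X = (\<Sum>n | n \<in> {1..N} \<and> prime n \<and> n dvd l. log_prime_ratio n)"
      proof (intro sum.mono_neutral_right ballI)
        show "{n. n \<in> {1..N} \<and> prime n \<and> n dvd l} \<subseteq> {n. n \<in> {1..N} \<and> \<not> coprime n l}"
          by (auto simp: coprime_absorb_left)
        fix n assume "n \<in> {n. n \<in> {1..N} \<and> \<not> coprime n l} - {n. n \<in> {1..N} \<and> prime n \<and> n dvd l}"
        hence "\<not> prime n" using prime_imp_coprime by blast
        thus "log_prime_ratio n = 0" by (simp add: log_prime_ratio_def)
      qed auto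
      also have "\<dots> \<le> K" unfolding K_def using l lpr0 by (intro sum_mono2) auto
      finally show ?thesis .
    qed
    ultimately show ?thesis using B[of N] by (simp only: norm_of_real)
  qed
  thus ?thesis unfolding mertens_regular_def by blast
next
  case False
  then obtain a where a: "coprime a l" "\<psi> a \<noteq> 1" by blast
  note le1 = norm_completely_multiplicative_le_1[OF l per one mult]
  define B where "B = real l + 1"
  have B: "norm (\<Sum>n=1..N. \<psi> n) \<le> B" for N
    unfolding B_def by (rule sum_nonprincipal_bounded[OF l per one mult a])
  have B0: "B \<ge> 0" by (simp add: B_def)
  define A where "A N = (\<Sum>n=1..N. \<psi> n / of_nat n)" for N
  obtain L where L: "\<And>N. norm (A N - L) \<le> 2 * B / real (N + 1)"
    using sum_nonprincipal_over_n[OF B] unfolding A_def by blast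
  have tail: "norm (A (N div d) - L) \<le> 2 * B * real d / real N" if "d \<in> {1..N}" for d N
  proof -
    have "real N / real d < real (N div d + 1)" using real_div_nat_less[of N d] by simp
    hence "2 * B / real (N div d + 1) \<le> 2 * B / (real N / real d)"
      using that B0 by (intro divide_left_mono) auto
    thus ?thesis using L[of "N div d"] by simp
  qed
  define Y where "Y N = (\<Sum>n=1..N. \<psi> n * of_real (mangoldt n / real n))" for N
  have psi_div: "\<psi> (d * m) / of_nat (d * m) = \<psi> d / of_nat d * (\<psi> m / of_nat m)" for d m
    by (simp add: mult)
  have "\<exists>\<delta> K. \<forall>N\<ge>1. norm (Y N - \<delta> * of_real (ln (real N))) \<le> K"
  proof (cases "L = 0")
    case False
    (* evaluate X N in two ways: by partial summation, and by writing ln as a divisor sum of mangoldt *)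
    define X where "X N = (\<Sum>n=1..N. \<psi> n / of_nat n * of_real (ln (real n)))" for N
    \<comment> \<open>The 1 bounds the terms up to \<open>n = 2\<close>; partial summation starts at
      3 because \<open>ln n / n\<close> decreases only from there.\<close>
    define K1 where "K1 = 1 + 2 * B * (ln 3 / 3)"
    have X: "norm (X N) \<le> K1" for N
    proof -
      have "norm (X N) \<le> norm (X (min N 2)) + norm (\<Sum>n=2+1..N. (ln (real n) / real n) *\<^sub>R \<psi> n)"
      proof (cases "N \<le> 2")
        case False
        have "X N = (\<Sum>n\<in>{1..2} \<union> {2+1..N}. \<psi> n / of_nat n * of_real (ln (real n)))"
          unfolding X_def using False by (intro sum.cong) auto
        also have "\<dots> = X 2 + (\<Sum>n=2+1..N. \<psi> n / of_nat n * of_real (ln (real n)))"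
          unfolding X_def by (intro sum.union_disjoint) auto
        also have "(\<Sum>n=2+1..N. \<psi> n / of_nat n * of_real (ln (real n))) = (\<Sum>n=2+1..N. (ln (real n) / real n) *\<^sub>R \<psi> n)"
          by (intro sum.cong refl) (simp add: scaleR_conv_of_real)
        finally show ?thesis using False by (simp add: norm_triangle_ineq)
      qed simp
      moreover have "norm (X (min N 2)) \<le> 1"
      proof -
        have "norm (\<psi> 2) * \<bar>ln 2\<bar> \<le> 1 * 1"
          using le1[of 2] ln_2_less_1 by (intro mult_mono) auto
        hence "norm (\<psi> 2 * of_real (ln 2) / 2) \<le> 1 * 1 / 2" by (simp add: norm_mult norm_divide)
        show ?thesis
        proof (cases "N \<ge> 2")
          case True
          hence "X (min N 2) = X 2" by simp
          also have "X 2 = \<psi> 2 * of_real (ln 2) / 2" by (simp add: X_def eval_nat_numeral)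
          finally have eq: "X (min N 2) = \<psi> 2 * of_real (ln 2) / 2" .
          show ?thesis unfolding eq using \<open>norm (\<psi> 2 * of_real (ln 2) / 2) \<le> 1 * 1 / 2\<close> by linarith
        next
          case False
          hence "N = 0 \<or> N = 1" by auto
          thus ?thesis by (auto simp: X_def)
        qed
      qed
      moreover have "norm (\<Sum>n=2+1..N. (ln (real n) / real n) *\<^sub>R \<psi> n) \<le> 2 * B * (ln (real (2 + 1)) / real (2 + 1))"
      proof (rule sum_by_parts_decreasing[OF B])
        fix n :: nat assume "n > 2"
        thus "ln (real (Suc n)) / real (Suc n) \<le> ln (real n) / real n" by (intro ln_div_self_decreasing) simp
      qed simp
      ultimately show ?thesis by (simp add: K1_def)
    qed
    have "norm (Y N - 0 * of_real (ln (real N))) \<le> (K1 + 8 * B) / norm L" if N: "N \<ge> 1" for N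
    proof -
      have "X N = (\<Sum>n=1..N. \<Sum>d | d dvd n. \<psi> (d * (n div d)) / of_nat (d * (n div d)) * of_real (mangoldt d))"
        unfolding X_def
      proof (intro sum.cong refl)
        fix n assume "n \<in> {1..N}"
        hence "n \<noteq> 0" by auto
        have "of_real (ln (real n)) = (\<Sum>d | d dvd n. complex_of_real (mangoldt d))"
          using mangoldt_sum[OF \<open>n \<noteq> 0\<close>, where ?'a = real] by (metis of_real_sum id_apply of_real_eq_id)
        hence "\<psi> n / of_nat n * of_real (ln (real n)) = (\<Sum>d | d dvd n. \<psi> n / of_nat n * of_real (mangoldt d))"
          by (simp only: sum_distrib_left)
        also have "\<dots> = (\<Sum>d | d dvd n. \<psi> (d * (n div d)) / of_nat (d * (n div d)) * of_real (mangoldt d))"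
          by (intro sum.cong refl) auto
        finally show "\<psi> n / of_nat n * of_real (ln (real n)) =
            (\<Sum>d | d dvd n. \<psi> (d * (n div d)) / of_nat (d * (n div d)) * of_real (mangoldt d))" .
      qed
      also have "\<dots> = (\<Sum>d=1..N. \<Sum>m=1..N div d. \<psi> (d * m) / of_nat (d * m) * of_real (mangoldt d))"
        by (rule sum_divisors_swap)
      also have "\<dots> = (\<Sum>d=1..N. \<psi> d * of_real (mangoldt d / real d) * A (N div d))"
        unfolding psi_div A_def by (simp add: sum_distrib_left sum_distrib_right algebra_simps)
      also have "\<dots> = (\<Sum>d=1..N. \<psi> d * of_real (mangoldt d / real d) * L
          + \<psi> d * of_real (mangoldt d / real d) * (A (N div d) - L))"
        by (intro sum.cong refl) (simp only: distrib_left[symmetric] add_diff_cancel_left' diff_add_cancel add_diff_eq)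
      also have "\<dots> = Y N * L + (\<Sum>d=1..N. \<psi> d * of_real (mangoldt d / real d) * (A (N div d) - L))"
        unfolding sum.distrib Y_def sum_distrib_right ..
      finally have "Y N * L = X N - (\<Sum>d=1..N. \<psi> d * of_real (mangoldt d / real d) * (A (N div d) - L))" by simp
      hence "norm (Y N * L) \<le> norm (X N) + norm (\<Sum>d=1..N. \<psi> d * of_real (mangoldt d / real d) * (A (N div d) - L))"
        by (metis norm_triangle_ineq4)
      also have "norm (\<Sum>d=1..N. \<psi> d * of_real (mangoldt d / real d) * (A (N div d) - L))
          \<le> (\<Sum>d=1..N. 2 * B / real N * mangoldt d)"
      proof (intro sum_norm_le)
        fix d assume d: "d \<in> {1..N}"
        have "norm (\<psi> d * of_real (mangoldt d / real d) * (A (N div d) - L))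
            \<le> 1 * (mangoldt d / real d) * (2 * B * real d / real N)"
          unfolding norm_mult norm_of_real using le1[of d] tail[OF d] d
          by (intro mult_mono) (auto simp: mangoldt_nonneg)
        also have "\<dots> = 2 * B / real N * mangoldt d" using d by simp
        finally show "norm (\<psi> d * of_real (mangoldt d / real d) * (A (N div d) - L)) \<le> 2 * B / real N * mangoldt d" .
      qed
      also have "\<dots> = 2 * B / real N * (\<Sum>d=1..N. mangoldt d)" by (rule sum_distrib_left[symmetric])
      also have "\<dots> \<le> 2 * B / real N * (4 * real N)"
        using B0 by (intro mult_left_mono chebyshev_mangoldt) auto
      also have "\<dots> = 8 * B" using N by simp
      finally have "norm (Y N) * norm L \<le> K1 + 8 * B" using X[of N] by (simp add: norm_mult)
      thus ?thesis using False by (simp add: field_simps)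
    qed
    thus ?thesis by blast
  next
    case True
    (* now the identity used is that moebius_mu d * ln (N / d), summed over the divisors of n,
       gives mangoldt n, plus ln N if n = 1 *)
    have "norm (Y N - (- 1) * of_real (ln (real N))) \<le> 2 * B" if N: "N \<ge> 1" for N
    proof -
      let ?c = "\<lambda>d. \<mu> d * (ln (real N) - ln (real d))"
      have "(\<Sum>n=1..N. \<Sum>d | d dvd n. \<psi> (d * (n div d)) / of_nat (d * (n div d)) * of_real (?c d)) =
          (\<Sum>n=1..N. (if n = 1 then of_real (ln (real N)) else 0) + \<psi> n * of_real (mangoldt n / real n))"
      proof (rule sum.cong[OF refl])
        fix n assume "n \<in> {1..N}"
        hence n: "n > 0" by auto
        have "(\<Sum>d | d dvd n. ?c d) = ln (real N) * (\<Sum>d | d dvd n. \<mu> d)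
            - (\<Sum>d | d dvd n. \<mu> d * ln (real d))"
          unfolding sum_distrib_left sum_subtractf[symmetric]
          by (intro sum.cong refl) (simp add: algebra_simps)
        also have "\<dots> = (if n = 1 then ln (real N) else 0) + mangoldt n"
          unfolding sum_moebius_divisors[OF n] sum_moebius_ln[OF n] by simp
        finally have c: "(\<Sum>d | d dvd n. ?c d) = (if n = 1 then ln (real N) else 0) + mangoldt n" .
        have "(\<Sum>d | d dvd n. \<psi> (d * (n div d)) / of_nat (d * (n div d)) * of_real (?c d)) =
            (\<Sum>d | d dvd n. \<psi> n / of_nat n * of_real (?c d))"
          by (intro sum.cong refl) auto
        also have "\<dots> = \<psi> n / of_nat n * of_real (\<Sum>d | d dvd n. ?c d)"
          by (simp only: of_real_sum sum_distrib_left)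
        also have "\<dots> = (if n = 1 then of_real (ln (real N)) else 0) + \<psi> n * of_real (mangoldt n / real n)"
          unfolding c using one by (auto simp: algebra_simps)
        finally show "(\<Sum>d | d dvd n. \<psi> (d * (n div d)) / of_nat (d * (n div d)) * of_real (?c d)) =
          (if n = 1 then of_real (ln (real N)) else 0) + \<psi> n * of_real (mangoldt n / real n)" .
      qed
      also have "\<dots> = of_real (ln (real N)) + Y N" using N by (simp add: sum.distrib Y_def)
      also have "(\<Sum>n=1..N. \<Sum>d | d dvd n. \<psi> (d * (n div d)) / of_nat (d * (n div d)) * of_real (?c d)) =
          (\<Sum>d=1..N. \<Sum>m=1..N div d. \<psi> (d * m) / of_nat (d * m) * of_real (?c d))"
        by (rule sum_divisors_swap)
      also have "\<dots> = (\<Sum>d=1..N. \<psi> d * of_real (?c d / real d) * A (N div d))"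
      proof (rule sum.cong[OF refl])
        fix d
        have "(\<Sum>m=1..N div d. \<psi> (d * m) / of_nat (d * m) * of_real (?c d)) =
            (\<Sum>m=1..N div d. \<psi> d * of_real (?c d / real d) * (\<psi> m / of_nat m))"
          unfolding psi_div by (intro sum.cong refl) (simp add: mult_ac)
        thus "(\<Sum>m=1..N div d. \<psi> (d * m) / of_nat (d * m) * of_real (?c d)) =
            \<psi> d * of_real (?c d / real d) * A (N div d)"
          unfolding A_def sum_distrib_left .
      qed
      finally have "of_real (ln (real N)) + Y N = (\<Sum>d=1..N. \<psi> d * of_real (?c d / real d) * A (N div d))" by simp
      \<comment> \<open>As \<open>L = 0\<close>, the factor \<open>A (N div d)\<close> is itself at
        most \<open>2 * B * d / N\<close>, which cancels the denominator \<open>d\<close>.\<close>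
      also have "norm \<dots> \<le> (\<Sum>d=1..N. 2 * B / real N * ln (real N / real d))"
      proof (intro sum_norm_le)
        fix d assume d: "d \<in> {1..N}"
        have ln0: "ln (real N / real d) \<ge> 0" using d by (intro ln_ge_zero) auto
        have eq: "ln (real N) - ln (real d) = ln (real N / real d)" using d by (simp add: ln_div)
        have "\<bar>?c d\<bar> \<le> 1 * ln (real N / real d)"
          unfolding eq abs_mult using abs_moebius_le_1[of d] ln0 by (intro mult_mono) auto
        hence c: "\<bar>?c d / real d\<bar> \<le> ln (real N / real d) / real d" using d by (simp add: divide_right_mono)
        have "norm (\<psi> d * of_real (?c d / real d) * A (N div d))
            \<le> 1 * (ln (real N / real d) / real d) * (2 * B * real d / real N)"
          unfolding norm_mult norm_of_real using le1[of d] tail[OF d] True c ln0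
          by (intro mult_mono) auto
        also have "\<dots> = 2 * B / real N * ln (real N / real d)" using d by simp
        finally show "norm (\<psi> d * of_real (?c d / real d) * A (N div d)) \<le> 2 * B / real N * ln (real N / real d)" .
      qed
      also have "\<dots> = 2 * B / real N * (\<Sum>d=1..N. ln (real N / real d))" by (rule sum_distrib_left[symmetric])
      also have "\<dots> \<le> 2 * B / real N * real N" using B0 by (intro mult_left_mono sum_ln_ratio_le) auto
      also have "\<dots> = 2 * B" using N by simp
      finally show ?thesis by (simp add: add.commute)
    qed
    thus ?thesis by blast
  qed
  then obtain \<delta> K where K: "\<And>N. N \<ge> 1 \<Longrightarrow> norm (Y N - \<delta> * of_real (ln (real N))) \<le> K" by blast
  obtain H where H: "H \<ge> 0" "\<And>N. (\<Sum>n | n \<in> {1..N} \<and> \<not> prime n. mangoldt n / real n) \<le> H"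
    using sum_mangoldt_nonprime_bounded by blast
  have "norm ((\<Sum>n=1..N. \<psi> n * of_real (log_prime_ratio n)) - \<delta> * of_real (ln (real N))) \<le> K + H" for N
  proof (cases "N = 0")
    case True
    have "K \<ge> 0" using K[of 1] norm_ge_zero order_trans by blast
    thus ?thesis using True H(1) by simp
  next
    case False
    let ?E = "\<Sum>n | n \<in> {1..N} \<and> \<not> prime n. \<psi> n * of_real (mangoldt n / real n)"
    have "Y N = (\<Sum>n=1..N. \<psi> n * of_real (log_prime_ratio n) + (if \<not> prime n then \<psi> n * of_real (mangoldt n / real n) else 0))"
      unfolding Y_def by (intro sum.cong refl) (auto simp: log_prime_ratio_def)
    also have "\<dots> = (\<Sum>n=1..N. \<psi> n * of_real (log_prime_ratio n)) + ?E"
      unfolding sum.distrib by (subst sum.inter_filter) auto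
    finally have eq: "(\<Sum>n=1..N. \<psi> n * of_real (log_prime_ratio n)) - \<delta> * of_real (ln (real N)) = (Y N - \<delta> * of_real (ln (real N))) - ?E"
      by simp
    have "norm ?E \<le> (\<Sum>n | n \<in> {1..N} \<and> \<not> prime n. mangoldt n / real n)"
    proof (intro sum_norm_le)
      fix n
      have "norm (\<psi> n * of_real (mangoldt n / real n)) \<le> 1 * (mangoldt n / real n)"
        unfolding norm_mult norm_of_real using le1[of n] by (intro mult_mono) (auto simp: mangoldt_nonneg)
      thus "norm (\<psi> n * of_real (mangoldt n / real n)) \<le> mangoldt n / real n" by simp
    qed
    hence "norm ?E \<le> H" using H(2)[of N] by linarith
    thus ?thesis unfolding eq using norm_triangle_ineq4[of "Y N - \<delta> * of_real (ln (real N))" ?E] K[of N] False by linarith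
  qed
  thus ?thesis unfolding mertens_regular_def by blast
qed

text \<open>A joint eigenfunction satisfies \<open>f (a * n) * f 1 = f a * f n\<close>, so
  \<open>f n / f 1\<close> is completely multiplicative unless \<open>f 1 = 0\<close>, which forces
  \<open>f\<close> to vanish.\<close>

lemma periodic_on_units_mertens_regular:
  assumes l: "l > 0" and f: "periodic_on_units l f"
  shows "mertens_regular f"
  using l mertens_regular_zero mertens_regular_add _ f
proof (rule periodic_on_units_eigen_induct)
  fix f assume f: "periodic_on_units l f" and ev: "\<And>a. coprime a l \<Longrightarrow> \<exists>c. \<forall>n. f (a * n) = c * f n"
  show "mertens_regular f"
  proof (cases "f 1 = 0")
    case True
    have "f a = 0" for a
    proof (cases "coprime a l")
      case True
      then obtain c where "\<forall>n. f (a * n) = c * f n" using ev by blast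
      hence "f (a * 1) = c * f 1" by blast
      thus ?thesis using \<open>f 1 = 0\<close> by simp
    qed (use f in \<open>simp add: periodic_on_units_def\<close>)
    hence "f = (\<lambda>_. 0)" by auto
    thus ?thesis using mertens_regular_zero by simp
  next
    case False
    define \<psi> where "\<psi> n = f n / f 1" for n
    have "mertens_regular \<psi>"
    proof (rule completely_multiplicative_mertens_regular[OF l])
      show "periodic_on_units l \<psi>" using f by (auto simp: periodic_on_units_def \<psi>_def)
      show "\<psi> 1 = 1" using False by (simp add: \<psi>_def)
      show "\<psi> (a * b) = \<psi> a * \<psi> b" for a b
      proof (cases "coprime a l")
        case True
        then obtain c where c: "\<forall>n. f (a * n) = c * f n" using ev by blast
        hence "f (a * 1) = c * f 1" by blast
        thus ?thesis using c False by (simp add: \<psi>_def)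
      next
        case False
        hence "f a = 0" "f (a * b) = 0" using f by (auto simp: periodic_on_units_def)
        thus ?thesis by (simp add: \<psi>_def)
      qed
    qed
    from mertens_regular_scale[OF this, of "f 1"] show ?thesis using False by (simp add: \<psi>_def)
  qed
qed

lemma mertens_arithmetic_progression:
  assumes "l > 0" "coprime j l"
  obtains \<alpha> B :: real where
    "\<And>N. \<bar>\<Sum>n=1..N. ((if [n = j] (mod l) then 1 else 0) - \<alpha>) * log_prime_ratio n\<bar> \<le> B"
proof -
  define f where "f n = (if [n = j] (mod l) then 1 else 0 :: complex)" for n
  have "periodic_on_units l f"
    unfolding periodic_on_units_def
  proof (intro conjI allI impI)
    fix m n assume "[m = n] (mod l)"
    thus "f m = f n" unfolding f_def by (metis cong_sym cong_trans)
  next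
    fix n assume "\<not> coprime n l"
    thus "f n = 0" using assms(2) cong_imp_coprime cong_sym unfolding f_def by metis
  qed
  hence "mertens_regular f" by (rule periodic_on_units_mertens_regular[OF assms(1)])
  then obtain \<delta> B where B: "\<And>N. norm ((\<Sum>n=1..N. f n * of_real (log_prime_ratio n)) - \<delta> * of_real (ln (real N))) \<le> B"
    unfolding mertens_regular_def by blast
  obtain B' where B': "\<And>N. \<bar>(\<Sum>n=1..N. log_prime_ratio n) - ln (real N)\<bar> \<le> B'"
    using mertens_first by blast
  let ?g = "\<lambda>n. if [n = j] (mod l) then 1 else 0 :: real"
  \<comment> \<open>The indicator and the weights are real, so real parts may be taken and \<alpha>
    is \<open>Re \<delta>\<close>; \<open>mertens_first\<close> then trades \<open>ln N\<close> for
    the sum of the weights.\<close>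
  have "\<bar>\<Sum>n=1..N. (?g n - Re \<delta>) * log_prime_ratio n\<bar> \<le> B + \<bar>Re \<delta>\<bar> * B'" for N
  proof -
    have Re_f: "Re (f n * of_real x) = ?g n * x" for n x by (simp add: f_def)
    have "Re ((\<Sum>n=1..N. f n * of_real (log_prime_ratio n)) - \<delta> * of_real (ln (real N))) =
        (\<Sum>n=1..N. ?g n * log_prime_ratio n) - Re \<delta> * ln (real N)"
      by (simp only: minus_complex.sel Re_sum Re_f Re_complex_of_real times_complex.sel Im_complex_of_real)
        (auto simp: f_def intro!: sum.cong)
    hence 1: "\<bar>(\<Sum>n=1..N. ?g n * log_prime_ratio n) - Re \<delta> * ln (real N)\<bar> \<le> B"
      using B[of N] abs_Re_le_cmod order_trans by metis
    have "(\<Sum>n=1..N. (?g n - Re \<delta>) * log_prime_ratio n) =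
        ((\<Sum>n=1..N. ?g n * log_prime_ratio n) - Re \<delta> * ln (real N)) - Re \<delta> * ((\<Sum>n=1..N. log_prime_ratio n) - ln (real N))"
      by (simp only: left_diff_distrib sum_subtractf sum_distrib_left right_diff_distrib)
    also have "\<bar>\<dots>\<bar> \<le> B + \<bar>Re \<delta> * ((\<Sum>n=1..N. log_prime_ratio n) - ln (real N))\<bar>" using 1 by linarith
    also have "\<dots> \<le> B + \<bar>Re \<delta>\<bar> * B'" using B'[of N] by (simp add: abs_mult mult_left_mono)
    finally show ?thesis .
  qed
  thus ?thesis using that by blast
qed

section \<open>Distribution of the larger prime factors\<close>

text \<open>Each rank below \<open>card A\<close> is taken once: a new minimum leaves the ranks of
  the other elements unchanged and itself gets the rank \<open>card A\<close>.\<close>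

lemma sum_card_greater:
  fixes A :: "nat set" and c :: "nat \<Rightarrow> real"
  assumes "finite A"
  shows "(\<Sum>p\<in>A. c (card {q \<in> A. p < q})) = (\<Sum>s<card A. c s)"
  using assms
proof (induction A rule: finite_linorder_min_induct)
  case (insert b A)
  have b: "b \<notin> A" using insert by auto
  have "{q \<in> insert b A. b < q} = A" using insert by auto
  moreover have "{q \<in> insert b A. p < q} = {q \<in> A. p < q}" if "p \<in> A" for p
    using insert that by fastforce
  ultimately have "(\<Sum>p\<in>insert b A. c (card {q \<in> insert b A. p < q})) = c (card A) + (\<Sum>p\<in>A. c (card {q \<in> A. p < q}))"
    using insert b by simp
  thus ?case using insert b by simp
qed simp

definition prime_part_above :: "nat \<Rightarrow> nat \<Rightarrow> nat" where
  "prime_part_above p m = (\<Prod>q\<in>{q \<in> prime_factors m. p < q}. q ^ multiplicity q m)"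

lemma prime_part_above_decomp:
  assumes m: "m > 0" and p: "p \<in> prime_factors m"
  defines "Q \<equiv> prime_part_above p m"
  shows "Q * (m div Q) = m" "prime_factors Q = {q \<in> prime_factors m. p < q}"
    "largest_prime_factor (m div Q) = p" "m div Q \<ge> 2" "Q > 0"
proof -
  define R where "R = (\<Prod>q\<in>{q \<in> prime_factors m. \<not> p < q}. q ^ multiplicity q m)"
  have pos: "multiplicity q m > 0" if "q \<in> prime_factors m" for q
    using that m by (rule prime_factors_remove_prime(3)[rotated])
  have "m = (\<Prod>q\<in>prime_factors m. q ^ multiplicity q m)"
    using m by (intro prime_factorization_nat)
  also have "\<dots> = (\<Prod>q\<in>{q \<in> prime_factors m. p < q} \<union> {q \<in> prime_factors m. \<not> p < q}. q ^ multiplicity q m)"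
    by (intro prod.cong) auto
  also have "\<dots> = Q * R"
    unfolding Q_def prime_part_above_def R_def by (intro prod.union_disjoint) auto
  finally have mQR: "m = Q * R" .
  show Q0: "Q > 0" using mQR m by (intro Nat.gr0I) auto
  have R0: "R > 0" using mQR m by (intro Nat.gr0I) auto
  have div: "m div Q = R" using mQR Q0 by simp
  show "Q * (m div Q) = m" using mQR div by simp
  have pf: "prime_factors (\<Prod>q\<in>S. q ^ multiplicity q m) = S" if "S \<subseteq> prime_factors m" for S
  proof -
    have fin: "finite S" using that by (rule finite_subset) simp
    have S: "\<And>q. q \<in> S \<Longrightarrow> prime q" using that by auto
    have nz: "(\<Prod>q\<in>S. q ^ multiplicity q m) \<noteq> 0" using fin S by (auto dest: prime_gt_0_nat)
    have "q \<in> prime_factors (\<Prod>q\<in>S. q ^ multiplicity q m) \<longleftrightarrow> q \<in> S" for q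
    proof (cases "prime q")
      case True
      have "q \<in> prime_factors (\<Prod>q\<in>S. q ^ multiplicity q m) \<longleftrightarrow> multiplicity q (\<Prod>q\<in>S. q ^ multiplicity q m) > 0"
        using True nz by (simp add: in_prime_factors_iff prime_multiplicity_gt_zero_iff)
      also have "multiplicity q (\<Prod>q\<in>S. q ^ multiplicity q m) = (if q \<in> S then multiplicity q m else 0)"
        using fin S True by (intro multiplicity_prod_prime_powers) auto
      also have "\<dots> > 0 \<longleftrightarrow> q \<in> S" using pos that by auto
      finally show ?thesis .
    next
      case False
      thus ?thesis using S by auto
    qed
    thus ?thesis by blast
  qed
  show "prime_factors Q = {q \<in> prime_factors m. p < q}"
    unfolding Q_def prime_part_above_def by (rule pf) auto
  have R: "prime_factors R = {q \<in> prime_factors m. \<not> p < q}"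
    unfolding R_def by (rule pf) auto
  show "largest_prime_factor (m div Q) = p"
    unfolding largest_prime_factor_def div R using p by (intro Max_eqI) auto
  have "p \<in> prime_factors R" using p R by auto
  hence "p dvd R" "prime p" by auto
  hence "p \<le> R" "2 \<le> p" using R0 by (auto dest: dvd_imp_le prime_ge_2_nat)
  thus "m div Q \<ge> 2" unfolding div by simp
qed

lemma prime_part_above_mult:
  assumes "Q > 0" "m \<ge> 2" "\<And>q. q \<in> prime_factors Q \<Longrightarrow> largest_prime_factor m < q"
  shows "prime_part_above (largest_prime_factor m) (Q * m) = Q"
    "{q \<in> prime_factors (Q * m). largest_prime_factor m < q} = prime_factors Q"
    "largest_prime_factor m \<in> prime_factors (Q * m)"
proof -
  let ?p = "largest_prime_factor m"
  have pf: "prime_factors (Q * m) = prime_factors Q \<union> prime_factors m"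
    using assms by (intro prime_factors_product) auto
  have le: "q \<le> ?p" if "q \<in> prime_factors m" for q
    using that unfolding largest_prime_factor_def by auto
  show set: "{q \<in> prime_factors (Q * m). ?p < q} = prime_factors Q"
    unfolding pf using assms(3) le by (auto simp: not_less[symmetric])
  show "?p \<in> prime_factors (Q * m)" unfolding pf using largest_prime_factor_in[OF assms(2)] by blast
  have "prime_part_above ?p (Q * m) = (\<Prod>q\<in>prime_factors Q. q ^ multiplicity q Q)"
    unfolding prime_part_above_def set
  proof (intro prod.cong refl)
    fix q assume q: "q \<in> prime_factors Q"
    have "\<not> q dvd m"
    proof
      assume "q dvd m"
      hence "q \<in> prime_factors m" using q assms(2) by (auto simp: in_prime_factors_iff)
      thus False using le[of q] assms(3)[OF q] by simp
    qed
    hence "multiplicity q m = 0" by (rule not_dvd_imp_multiplicity_0)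
    hence "multiplicity q (Q * m) = multiplicity q Q"
      using q assms by (subst prime_elem_multiplicity_mult_distrib) auto
    thus "q ^ multiplicity q (Q * m) = q ^ multiplicity q Q" by simp
  qed
  also have "\<dots> = Q" using assms(1) by (intro prime_factorization_nat[symmetric])
  finally show "prime_part_above ?p (Q * m) = Q" .
qed

text \<open>The inner sum has at most one term, the \<open>(s + 1)\<close>-st largest prime factor of \<open>m\<close>.\<close>

definition ranked_prime_sum :: "(nat \<Rightarrow> real) \<Rightarrow> nat \<Rightarrow> nat \<Rightarrow> real" where
  "ranked_prime_sum w s N =
    (\<Sum>m=1..N. \<Sum>p | p \<in> prime_factors m \<and> card {q \<in> prime_factors m. p < q} = s. w p)"

text \<open>Write \<open>m = Q * m'\<close>, where \<open>Q\<close> carries the \<open>s\<close>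
  primes above \<open>p\<close> with their full powers. Then \<open>p\<close> is the largest prime
  factor of \<open>m'\<close>, and the only link between the parts is that \<open>p\<close> lies
  below all primes of \<open>Q\<close>. For \<open>Q = 1\<close> there is no such link, and the
  cutoff \<open>N\<close> has no effect.\<close>

lemma ranked_prime_sum_eq:
  "ranked_prime_sum w s N = (\<Sum>Q | Q \<in> {1..N} \<and> omega Q = s.
     lpf_sum w (N div Q) (if Q = 1 then N else smallest_prime_factor Q - 1))"
proof -
  define z where "z Q = (if Q = 1 then N else smallest_prime_factor Q - 1)" for Q
  let ?I = "SIGMA m:{1..N}. {p. p \<in> prime_factors m \<and> card {q \<in> prime_factors m. p < q} = s}"
  let ?J = "SIGMA Q:{Q. Q \<in> {1..N} \<and> omega Q = s}. {m. m \<in> {2..N div Q} \<and> largest_prime_factor m \<le> z Q}"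
  have z: "largest_prime_factor m < q" if "q \<in> prime_factors Q" "largest_prime_factor m \<le> z Q" for q Q m
  proof -
    have "q dvd Q" "prime q" using that(1) by auto
    hence "Q \<noteq> 1" by (auto dest: prime_gt_1_nat)
    hence "largest_prime_factor m \<le> smallest_prime_factor Q - 1" using that(2) by (simp add: z_def)
    moreover have "smallest_prime_factor Q \<le> q" using that(1) unfolding smallest_prime_factor_def by auto
    moreover have "q > 0" using \<open>prime q\<close> by (rule prime_gt_0_nat)
    ultimately show ?thesis by linarith
  qed
  have "ranked_prime_sum w s N = (\<Sum>(m,p)\<in>?I. w p)"
    unfolding ranked_prime_sum_def by (intro sum.Sigma) auto
  also have "\<dots> = (\<Sum>(Q,m)\<in>?J. w (largest_prime_factor m))"
  proof (rule sum.reindex_bij_witness[where i = "\<lambda>(Q,m). (Q * m, largest_prime_factor m)"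
        and j = "\<lambda>(m,p). (prime_part_above p m, m div prime_part_above p m)"])
    fix x assume "x \<in> ?I"
    then obtain m p where x: "x = (m, p)" "m \<in> {1..N}" "p \<in> prime_factors m"
        "card {q \<in> prime_factors m. p < q} = s" by auto
    have m0: "m > 0" using x by auto
    note d = prime_part_above_decomp[OF m0 x(3)]
    let ?Q = "prime_part_above p m"
    show "(\<lambda>(Q,m). (Q * m, largest_prime_factor m)) ((\<lambda>(m,p). (prime_part_above p m, m div prime_part_above p m)) x) = x"
      using d x by simp
    show "(case (\<lambda>(m,p). (prime_part_above p m, m div prime_part_above p m)) x of (Q, m) \<Rightarrow> w (largest_prime_factor m)) =
        (case x of (m, p) \<Rightarrow> w p)"
      using d x by simp
    have "?Q dvd m" using d(1) by (metis dvd_triv_left)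
    hence "?Q \<le> m" using m0 by (rule dvd_imp_le)
    moreover have "p \<le> z ?Q"
    proof (cases "?Q = 1")
      case True
      have "p \<le> m" using x(3) m0 by (auto dest: dvd_imp_le)
      thus ?thesis using True x(2) by (simp add: z_def)
    next
      case False
      hence "?Q \<ge> 2" using d(5) by simp
      hence "smallest_prime_factor ?Q \<in> prime_factors ?Q" by (rule smallest_prime_factor_in)
      hence "p < smallest_prime_factor ?Q" using d(2) by auto
      thus ?thesis using False by (simp add: z_def)
    qed
    moreover have "m div ?Q \<le> N div ?Q" using x(2) by (intro div_le_mono) auto
    ultimately show "(\<lambda>(m,p). (prime_part_above p m, m div prime_part_above p m)) x \<in> ?J"
      using d x by (auto simp: omega_def)
  next
    fix x assume "x \<in> ?J"
    then obtain Q m where x: "x = (Q, m)" "Q \<in> {1..N}" "omega Q = s" "m \<in> {2..N div Q}" "largest_prime_factor m \<le> z Q"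
      by auto
    have Q0: "Q > 0" and m2: "m \<ge> 2" using x by auto
    note d = prime_part_above_mult[OF Q0 m2 z[OF _ x(5)], simplified]
    show "(\<lambda>(m,p). (prime_part_above p m, m div prime_part_above p m)) ((\<lambda>(Q,m). (Q * m, largest_prime_factor m)) x) = x"
      using d(1) x(1) Q0 by simp
    have "Q * m \<le> N" using x(4) Q0 by (simp add: less_eq_div_iff_mult_less_eq mult.commute)
    thus "(\<lambda>(Q,m). (Q * m, largest_prime_factor m)) x \<in> ?I"
      using prime_part_above_mult[OF Q0 m2 z[OF _ x(5)]] x Q0 m2 by (simp add: omega_def)
  qed
  also have "\<dots> = (\<Sum>Q | Q \<in> {1..N} \<and> omega Q = s. lpf_sum w (N div Q) (z Q))"
    unfolding lpf_sum_def by (intro sum.Sigma[symmetric]) auto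
  finally show ?thesis by (simp only: z_def)
qed

section \<open>Averaging over the part made of the larger primes\<close>

lemma sum_harmonic_le: "1 \<le> b \<Longrightarrow> (\<Sum>i<b. 1 / real (Suc i)) \<le> 1 + ln (real b)"
proof (induction b rule: dec_induct)
  case (step n)
  have "ln (real n / real (Suc n)) \<le> real n / real (Suc n) - 1" using step by (intro ln_le_minus_one) auto
  also have "\<dots> = - (1 / real (Suc n))" by (simp add: field_simps)
  finally have "1 / real (Suc n) \<le> ln (real (Suc n)) - ln (real n)" using step by (simp add: ln_div del: of_nat_Suc)
  thus ?case using step by (simp del: of_nat_Suc)
qed simp

text \<open>Let \<open>L = ln N\<close> and \<open>LL = ln L\<close>. For \<open>Q <= sqrt N\<close>
  the logarithm is at least \<open>L / 2\<close>, and the harmonic sum over \<open>Q\<close> is O(LL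
  ^ s). For larger \<open>Q\<close> the logarithm may be small, but the sparseness of the
  \<open>Q\<close> with \<open>omega Q = s\<close> supplies \<open>LL ^ (s - 1) / L\<close>, and the
  dyadic sum of \<open>1 / i\<close> over O(L) blocks adds one \<open>LL\<close>. For
  \<open>s = 0\<close> this gives \<open>LL\<close> rather than 1, hence the condition
  \<open>1 <= r\<close>.\<close>

lemma sum_omega_over_log_le:
  assumes "s \<le> r" "1 \<le> r"
  obtains C where "C \<ge> 0" "\<And>N. 729 \<le> N \<Longrightarrow>
    (\<Sum>Q | Q \<in> {1..N} \<and> omega Q = s. 1 / ln (real (N div Q) + 2) / real Q) \<le> C * (ln (ln (real N)) ^ r / ln (real N))"
proof -
  obtain C1 where C1: "C1 \<ge> 0" "\<And>N s. 27 \<le> N \<Longrightarrow>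
    (\<Sum>m | m \<in> {1..N} \<and> omega m = s. 1 / real m) \<le> C1 ^ s * ln (ln (real N)) ^ s"
    using sum_reciprocals_omega_loglog by blast
  obtain C2 where C2: "C2 \<ge> 0" "\<And>N. 27 \<le> N \<Longrightarrow>
    real (card {m \<in> {1..N}. omega m = s}) \<le> C2 * (real N * ln (ln (real N)) ^ (s - 1) / ln (real N))"
    using card_omega_le[where s = s] by blast
  have "(\<Sum>Q | Q \<in> {1..N} \<and> omega Q = s. 1 / ln (real (N div Q) + 2) / real Q) \<le>
      (2 * C1 ^ s + 64 * C2) * (ln (ln (real N)) ^ r / ln (real N))" if N: "729 \<le> N" for N
  proof -
    define L where "L = ln (real N)"
    define LL where "LL = ln L"
    have L: "L \<ge> 3" and LL: "LL \<ge> 1" using ln_ln_ge_1[of "real N"] N by (auto simp: L_def LL_def)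
    define h where "h v = 1 / ln (real v + 2)" for v :: nat
    have h0: "h v \<ge> 0" for v by (simp add: h_def)
    let ?D1 = "{Q. Q \<in> {1..N} \<and> omega Q = s \<and> Q * Q \<le> N}"
    let ?D2 = "{Q. Q \<in> {1..N} \<and> omega Q = s \<and> N < Q * Q}"
    have "(\<Sum>Q | Q \<in> {1..N} \<and> omega Q = s. 1 / ln (real (N div Q) + 2) / real Q) =
        (\<Sum>Q\<in>?D1. h (N div Q) / real Q) + (\<Sum>Q\<in>?D2. h (N div Q) / real Q)"
      unfolding h_def by (subst sum.union_disjoint[symmetric]) (auto intro!: sum.cong)
    moreover have "(\<Sum>Q\<in>?D1. h (N div Q) / real Q) \<le> 2 * C1 ^ s * (LL ^ r / L)"
    proof -
      have "(\<Sum>Q\<in>?D1. h (N div Q) / real Q) \<le> (\<Sum>Q\<in>?D1. 2 / L * (1 / real Q))"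
      proof (intro sum_mono)
        fix Q assume Q: "Q \<in> ?D1"
        have "Q \<le> N div Q" using Q by (simp add: less_eq_div_iff_mult_less_eq)
        have "N < Suc (N div Q) * Q" using Q dividend_less_div_times[of Q N] by (auto simp: add.commute)
        also have "\<dots> \<le> Suc (N div Q) * Suc (N div Q)" using \<open>Q \<le> N div Q\<close> by (intro mult_le_mono) auto
        finally have "real N \<le> real (Suc (N div Q)) ^ 2"
          unfolding power2_eq_square of_nat_mult[symmetric] of_nat_le_iff by simp
        also have "\<dots> \<le> (real (N div Q) + 2) ^ 2" by (intro power_mono) auto
        finally have "ln (real N) \<le> ln ((real (N div Q) + 2) ^ 2)" using N by (subst ln_le_cancel_iff) auto
        hence "L \<le> 2 * ln (real (N div Q) + 2)" by (simp add: L_def ln_realpow)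
        hence "h (N div Q) \<le> 2 / L" using L by (simp add: h_def field_simps)
        from mult_right_mono[OF this, of "1 / real Q"]
        show "h (N div Q) / real Q \<le> 2 / L * (1 / real Q)" by simp
      qed
      also have "\<dots> = 2 / L * (\<Sum>Q\<in>?D1. 1 / real Q)" by (rule sum_distrib_left[symmetric])
      also have "\<dots> \<le> 2 / L * (\<Sum>m | m \<in> {1..N} \<and> omega m = s. 1 / real m)"
        using L by (intro mult_left_mono sum_mono2) auto
      also have "\<dots> \<le> 2 / L * (C1 ^ s * LL ^ r)"
      proof (intro mult_left_mono)
        have "(\<Sum>m | m \<in> {1..N} \<and> omega m = s. 1 / real m) \<le> C1 ^ s * LL ^ s"
          using C1(2)[of N s] N by (simp add: LL_def L_def)
        also have "\<dots> \<le> C1 ^ s * LL ^ r"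
          using LL C1(1) assms by (intro mult_left_mono power_increasing) auto
        finally show "(\<Sum>m | m \<in> {1..N} \<and> omega m = s. 1 / real m) \<le> C1 ^ s * LL ^ r" .
      qed (use L in auto)
      finally show ?thesis by simp
    qed
    moreover have "(\<Sum>Q\<in>?D2. h (N div Q) / real Q) \<le> 64 * C2 * (LL ^ r / L)"
    proof -
      \<comment> \<open>The 2 comes from \<open>ln M >= L / 2\<close> for
        \<open>M = N div 2 ^ i\<close>, which holds whenever the set to be counted is
        nonempty.\<close>
      define K where "K = 2 * C2 * (LL ^ (s - 1) / L)"
      have K0: "K \<ge> 0" using C2(1) L LL by (simp add: K_def)
      obtain i0 where i0: "2 ^ i0 \<le> N" "N < 2 ^ (i0 + 1)" using ex_power_ivl1[of 2 N] N by auto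
      define b where "b = i0 + 1"
      have "(\<Sum>Q\<in>?D2. h (N div Q) / real Q) \<le> (\<Sum>i=0..<b. 2 * K * h (2 ^ i))"
      proof (rule dyadic_sum_le)
        show "2 ^ 0 \<le> N div Q \<and> N div Q < 2 ^ b" if "Q \<in> ?D2" for Q
        proof
          show "2 ^ 0 \<le> N div Q" using that by (simp add: div_greater_zero_iff Suc_le_eq)
          have "N div Q \<le> N" by (rule div_le_dividend)
          also have "N < 2 ^ b" using i0(2) by (simp only: b_def)
          finally show "N div Q < 2 ^ b" .
        qed
        show "h n \<le> h m" if "m \<le> n" for m n
          using that unfolding h_def by (intro divide_left_mono mult_pos_pos) auto
        show "real (card {Q \<in> ?D2. 2 ^ i \<le> N div Q}) \<le> K * (real N / 2 ^ i)" for i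
        proof (cases "{Q \<in> ?D2. 2 ^ i \<le> N div Q} = {}")
          case True
          thus ?thesis using K0 by (simp only: card.empty) simp
        next
          case False
          define M where "M = N div 2 ^ i"
          have leM: "Q \<le> M" if "Q \<in> {Q \<in> ?D2. 2 ^ i \<le> N div Q}" for Q
            using that by (auto simp: M_def less_eq_div_iff_mult_less_eq mult.commute)
          obtain Q where Q: "Q \<in> {Q \<in> ?D2. 2 ^ i \<le> N div Q}" using False by blast
          have "N < Q * Q" using Q by auto
          also have "\<dots> \<le> M * M" using leM[OF Q] by (intro mult_le_mono)
          finally have NM: "N < M * M" .
          \<comment> \<open>The hypothesis \<open>N >= 729 = 27 ^ 2\<close> is made for this: it
            brings \<open>M\<close> into the range of \<open>card_omega_le\<close>.\<close>
          have M27: "M \<ge> 27"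
          proof (rule ccontr)
            assume "\<not> M \<ge> 27"
            hence "M * M \<le> 27 * 27" by (intro mult_le_mono) auto
            thus False using NM N by simp
          qed
          have "real N \<le> real M ^ 2" using NM unfolding power2_eq_square of_nat_mult[symmetric] of_nat_le_iff by simp
          hence "ln (real N) \<le> ln (real M ^ 2)" using N M27 by (subst ln_le_cancel_iff) auto
          hence lnM: "L / 2 \<le> ln (real M)" using M27 by (simp add: L_def ln_realpow)
          have MN: "M \<le> N" unfolding M_def by (rule div_le_dividend)
          have lnM3: "ln (real M) \<ge> 3" using ln_ln_ge_1 M27 by simp
          have "ln (real M) \<le> L" using MN M27 by (simp add: L_def)
          hence LLM: "ln (ln (real M)) \<le> LL" unfolding LL_def using lnM3 by (subst ln_le_cancel_iff) auto
          have LLM1: "ln (ln (real M)) \<ge> 1" using ln_ln_ge_1 M27 by simp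
          have "card {Q \<in> ?D2. 2 ^ i \<le> N div Q} \<le> card {m \<in> {1..M}. omega m = s}"
            using leM by (intro card_mono) auto
          hence "real (card {Q \<in> ?D2. 2 ^ i \<le> N div Q}) \<le> C2 * (real M * ln (ln (real M)) ^ (s - 1) / ln (real M))"
            using C2(2)[OF M27] by linarith
          also have "\<dots> \<le> C2 * (real N / 2 ^ i * LL ^ (s - 1) / (L / 2))"
          proof (intro mult_left_mono frac_le mult_mono power_mono)
            show "real M \<le> real N / 2 ^ i" using real_nat_div_le[of N "2 ^ i"] by (simp add: M_def)
          qed (use lnM L LL LLM LLM1 C2(1) in auto)
          also have "\<dots> = K * (real N / 2 ^ i)" by (simp add: K_def mult_ac)
          finally show ?thesis .
        qed
      qed (use K0 h0 in auto)
      also have "\<dots> \<le> (\<Sum>i<b. 2 * K * (4 * (1 / real (Suc i))))"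
        unfolding atLeast0LessThan
      proof (intro sum_mono mult_left_mono)
        fix i
        \<comment> \<open>The bound \<open>h (2 ^ i) <= 4 / (i + 1)\<close>, valid also at
          \<open>i = 0\<close>, follows from \<open>2 ^ (i + 1) <= (2 ^ i + 2) ^ 2\<close> and
          \<open>ln 2 >= 1 / 2\<close>.\<close>
        have "real (Suc i) * ln 2 = ln (2 ^ Suc i)" by (simp only: ln_realpow)
        also have "\<dots> \<le> ln ((2 ^ i + 2) ^ 2)"
          by (subst ln_le_cancel_iff) (auto simp: power2_eq_square algebra_simps intro!: add_pos_pos)
        also have "\<dots> = 2 * ln (2 ^ i + 2)" by (subst ln_realpow) auto
        finally have 1: "real (Suc i) * ln 2 \<le> 2 * ln (2 ^ i + 2)" .
        have "1 / 2 \<le> ln (2::real)" using ln2_ge_two_thirds by simp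
        hence "real (Suc i) * (1 / 2) \<le> real (Suc i) * ln 2" by (intro mult_left_mono) auto
        hence "real (Suc i) * (1 / 2) \<le> 2 * ln (2 ^ i + 2)" using 1 by (rule order_trans)
        moreover have "a \<le> 4 * b" if "a * (1 / 2) \<le> 2 * b" for a b :: real using that by simp
        ultimately have "real (Suc i) \<le> 4 * ln (2 ^ i + 2)" by blast
        moreover have "ln (2 ^ i + 2 :: real) > 0" by (intro ln_gt_zero) (simp add: add_pos_pos add.commute less_add_same_cancel1)
        ultimately show "h (2 ^ i) \<le> 4 * (1 / real (Suc i))" by (simp add: h_def field_simps)
      qed (use K0 in auto)
      also have "\<dots> = 8 * K * (\<Sum>i<b. 1 / real (Suc i))" by (simp add: sum_distrib_left mult.assoc)
      also have "\<dots> \<le> 8 * K * (4 * LL)"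
      proof (intro mult_left_mono)
        have "(\<Sum>i<b. 1 / real (Suc i)) \<le> 1 + ln (real b)" by (rule sum_harmonic_le) (simp add: b_def)
        also have "ln (real b) \<le> ln (3 * L)"
        proof -
          have "real (2 ^ i0) \<le> real N" using i0(1) of_nat_le_iff by blast
          hence "ln (2 ^ i0) \<le> L" unfolding L_def using N by (subst ln_le_cancel_iff) auto
          hence "real i0 * ln 2 \<le> L" by (simp add: ln_realpow)
          moreover have "real i0 * (1 / 2) \<le> real i0 * ln 2" using ln2_ge_two_thirds by (intro mult_left_mono) auto
          ultimately have "real b \<le> 3 * L" using L by (simp add: b_def)
          thus ?thesis using L by (subst ln_le_cancel_iff) (auto simp: b_def)
        qed
        also have "ln (3 * L) = ln 3 + LL" using L by (simp add: ln_mult LL_def)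
        also have "ln 3 \<le> (2::real)" using ln_le_minus_one[of 3] by simp
        finally show "(\<Sum>i<b. 1 / real (Suc i)) \<le> 4 * LL" using LL by linarith
      qed (use K0 in auto)
      also have "\<dots> = 64 * C2 * (LL ^ Suc (s - 1) / L)" by (simp add: K_def)
      also have "\<dots> \<le> 64 * C2 * (LL ^ r / L)"
        using LL L C2(1) assms by (intro mult_left_mono divide_right_mono power_increasing) auto
      finally show ?thesis .
    qed
    ultimately show ?thesis unfolding distrib_right L_def[symmetric] LL_def[symmetric] by linarith
  qed
  thus ?thesis using that[of "2 * C1 ^ s + 64 * C2"] C1(1) C2(1) by simp
qed

text \<open>One factor \<open>ln (ln N)\<close> comes from \<open>lpf_sum_le\<close>, and
  \<open>r\<close> of them from averaging over \<open>Q\<close>. With \<open>r = k - 1\<close> for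
  all \<open>s < k\<close> this is the exponent \<open>k\<close> of the theorem.\<close>

lemma ranked_prime_sum_le:
  assumes B: "\<And>n. \<bar>\<Sum>i=1..n. w i * log_prime_ratio i\<bar> \<le> B" and W: "\<And>p. \<bar>w p\<bar> \<le> W"
    and r: "s \<le> r" "1 \<le> r"
  obtains C where "C \<ge> 0" "\<And>N. 729 \<le> N \<Longrightarrow>
    \<bar>ranked_prime_sum w s N\<bar> \<le> C * (real N * ln (ln (real N)) ^ Suc r / ln (real N))"
proof -
  obtain C1 where C1: "C1 \<ge> 0" "\<And>N y z. 27 \<le> N \<Longrightarrow> y \<le> N \<Longrightarrow>
    \<bar>lpf_sum w y z\<bar> \<le> C1 * (real y * ln (ln (real N)) / ln (real y + 2))"
    using lpf_sum_le[OF B W] by blast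
  obtain C2 where C2: "C2 \<ge> 0" "\<And>N. 729 \<le> N \<Longrightarrow>
    (\<Sum>Q | Q \<in> {1..N} \<and> omega Q = s. 1 / ln (real (N div Q) + 2) / real Q) \<le> C2 * (ln (ln (real N)) ^ r / ln (real N))"
    using sum_omega_over_log_le[OF r] by blast
  have "\<bar>ranked_prime_sum w s N\<bar> \<le> (C1 * C2) * (real N * ln (ln (real N)) ^ Suc r / ln (real N))" if N: "729 \<le> N" for N
  proof -
    define LL where "LL = ln (ln (real N))"
    have LL: "LL \<ge> 1" unfolding LL_def using ln_ln_ge_1 N by simp
    let ?D = "{Q. Q \<in> {1..N} \<and> omega Q = s}"
    have "\<bar>ranked_prime_sum w s N\<bar> \<le> (\<Sum>Q\<in>?D. \<bar>lpf_sum w (N div Q) (if Q = 1 then N else smallest_prime_factor Q - 1)\<bar>)"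
      unfolding ranked_prime_sum_eq by (rule sum_abs)
    also have "\<dots> \<le> (\<Sum>Q\<in>?D. C1 * real N * LL * (1 / ln (real (N div Q) + 2) / real Q))"
    proof (intro sum_mono)
      fix Q assume Q: "Q \<in> ?D"
      have "\<bar>lpf_sum w (N div Q) (if Q = 1 then N else smallest_prime_factor Q - 1)\<bar>
          \<le> C1 * (real (N div Q) * LL / ln (real (N div Q) + 2))"
        unfolding LL_def using N by (intro C1(2)) auto
      also have "\<dots> \<le> C1 * ((real N / real Q) * LL / ln (real (N div Q) + 2))"
        using C1(1) LL by (intro mult_left_mono divide_right_mono mult_right_mono real_nat_div_le) auto
      also have "\<dots> = C1 * real N * LL * (1 / ln (real (N div Q) + 2) / real Q)" by (simp add: mult_ac)
      finally show "\<bar>lpf_sum w (N div Q) (if Q = 1 then N else smallest_prime_factor Q - 1)\<bar>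
          \<le> C1 * real N * LL * (1 / ln (real (N div Q) + 2) / real Q)" .
    qed
    also have "\<dots> = C1 * real N * LL * (\<Sum>Q\<in>?D. 1 / ln (real (N div Q) + 2) / real Q)"
      by (rule sum_distrib_left[symmetric])
    also have "\<dots> \<le> C1 * real N * LL * (C2 * (LL ^ r / ln (real N)))"
      using C2(2)[OF N] C1(1) LL unfolding LL_def by (intro mult_left_mono) auto
    also have "\<dots> = (C1 * C2) * (real N * LL ^ Suc r / ln (real N))" by simp
    finally show ?thesis by (simp only: LL_def)
  qed
  thus ?thesis using that[of "C1 * C2"] C1(1) C2(1) by simp
qed

text \<open>The coefficient of \<alpha> at \<open>m\<close> is the sum of \<open>c s\<close> over
  \<open>s < omega m\<close>. Since \<open>c\<close> vanishes from \<open>k\<close> on and has total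
  0, this is 0 as soon as \<open>omega m >= k\<close>, so \<alpha> meets only numbers with few prime
  factors.\<close>

lemma sum_duality_decomp:
  fixes w :: "nat \<Rightarrow> real" and \<alpha> :: real
  assumes k: "k \<ge> 2" and f: "\<And>p. f p = w p + \<alpha>"
  defines "c \<equiv> duality_coeff (\<lambda>n. real n ^ (k - 1))"
  shows "(\<Sum>n=2..N. \<mu> n * real (omega n) ^ (k - 1) * f (smallest_prime_factor n) * real (N div n))
    = (\<Sum>s<k. c s * ranked_prime_sum w s N) + \<alpha> * (\<Sum>m | m \<in> {1..N} \<and> omega m < k. \<Sum>s<omega m. c s)"
proof -
  define F where "F n m = (if n \<ge> 2 then \<mu> n * real (omega n) ^ (k - 1) * f (smallest_prime_factor n) else 0)"
    for n m :: nat
  let ?g = "\<lambda>m p. card {q \<in> prime_factors m. p < q}"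
  have c0: "c s = 0" if "s \<ge> k" for s
    unfolding c_def using that k by (intro duality_coeff_power_eq_0) auto
  have "(\<Sum>n=2..N. \<mu> n * real (omega n) ^ (k - 1) * f (smallest_prime_factor n) * real (N div n))
      = (\<Sum>n=1..N. \<Sum>m=1..N div n. F n m)"
    by (intro sum.mono_neutral_cong_left) (auto simp: F_def)
  also have "\<dots> = (\<Sum>m=1..N. \<Sum>n | n dvd m. F n (m div n))" by (rule sum_divisors_swap[symmetric])
  also have "\<dots> = (\<Sum>m=1..N. (\<Sum>s<k. c s * (\<Sum>p | p \<in> prime_factors m \<and> ?g m p = s. w p))
      + \<alpha> * (if omega m < k then \<Sum>s<omega m. c s else 0))"
  proof (rule sum.cong[OF refl])
    fix m assume m: "m \<in> {1..N}"
    hence m0: "m > 0" by simp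
    have "(\<Sum>n | n dvd m. F n (m div n)) =
        (\<Sum>n | n dvd m \<and> 2 \<le> n. \<mu> n * real (omega n) ^ (k - 1) * f (smallest_prime_factor n))"
      using m0 by (intro sum.mono_neutral_cong_right) (auto simp: F_def)
    also have "\<dots> = (\<Sum>p\<in>prime_factors m. f p * c (?g m p))"
      unfolding c_def by (rule smallest_largest_duality[OF m0])
    also have "\<dots> = (\<Sum>p\<in>prime_factors m. w p * c (?g m p)) + \<alpha> * (\<Sum>p\<in>prime_factors m. c (?g m p))"
      by (simp add: f distrib_right sum.distrib sum_distrib_left)
    also have "(\<Sum>p\<in>prime_factors m. c (?g m p)) = (\<Sum>s<omega m. c s)"
      unfolding omega_def by (rule sum_card_greater) simp
    also have "\<dots> = (if omega m < k then \<Sum>s<omega m. c s else 0)"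
    proof (cases "omega m < k")
      case False
      hence "(\<Sum>s<omega m. c s) = (\<Sum>s<k. c s)"
        using c0 by (intro sum.mono_neutral_right) auto
      thus ?thesis using False sum_duality_coeff_power[OF k] by (simp add: c_def)
    qed simp
    also have "(\<Sum>p\<in>prime_factors m. w p * c (?g m p)) =
        (\<Sum>p | p \<in> prime_factors m \<and> ?g m p < k. w p * c (?g m p))"
      using c0 by (intro sum.mono_neutral_right) (auto simp: not_less)
    also have "\<dots> = (\<Sum>s<k. \<Sum>p | p \<in> {p. p \<in> prime_factors m \<and> ?g m p < k} \<and> ?g m p = s. w p * c (?g m p))"
      by (intro sum.group[symmetric]) auto
    also have "\<dots> = (\<Sum>s<k. c s * (\<Sum>p | p \<in> prime_factors m \<and> ?g m p = s. w p))"
      unfolding sum_distrib_left by (intro sum.cong refl) auto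
    finally show "(\<Sum>n | n dvd m. F n (m div n)) = (\<Sum>s<k. c s * (\<Sum>p | p \<in> prime_factors m \<and> ?g m p = s. w p))
      + \<alpha> * (if omega m < k then \<Sum>s<omega m. c s else 0)" .
  qed
  also have "\<dots> = (\<Sum>m=1..N. \<Sum>s<k. c s * (\<Sum>p | p \<in> prime_factors m \<and> ?g m p = s. w p))
      + \<alpha> * (\<Sum>m=1..N. if omega m < k then \<Sum>s<omega m. c s else 0)"
    by (simp only: sum.distrib sum_distrib_left)
  also have "(\<Sum>m=1..N. \<Sum>s<k. c s * (\<Sum>p | p \<in> prime_factors m \<and> ?g m p = s. w p)) = (\<Sum>s<k. c s * ranked_prime_sum w s N)"
    unfolding ranked_prime_sum_def sum_distrib_left by (rule sum.swap)
  also have "(\<Sum>m=1..N. if omega m < k then \<Sum>s<omega m. c s else 0) = (\<Sum>m | m \<in> {1..N} \<and> omega m < k. \<Sum>s<omega m. c s)"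
    by (subst sum.inter_filter) auto
  finally show ?thesis .
qed

section \<open>Assembly of the estimate\<close>

lemma sum_progression_le:
  assumes k: "k \<ge> 2" and l: "l > 0" "coprime j l"
  obtains C where "C \<ge> 0" "\<And>N. 729 \<le> N \<Longrightarrow>
    \<bar>\<Sum>n | n \<in> {2..N} \<and> [smallest_prime_factor n = j] (mod l).
        \<mu> n * real (omega n) ^ (k - 1) * real (N div n)\<bar>
      \<le> C * (real N * ln (ln (real N)) ^ k / ln (real N))"
proof -
  obtain \<alpha> B :: real where B:
    "\<And>N. \<bar>\<Sum>n=1..N. ((if [n = j] (mod l) then 1 else 0) - \<alpha>) * log_prime_ratio n\<bar> \<le> B"
    using mertens_arithmetic_progression[OF l] by blast
  define f where "f n = (if [n = j] (mod l) then 1 else 0 :: real)" for n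
  define w where "w n = f n - \<alpha>" for n
  define c where "c = duality_coeff (\<lambda>n. real n ^ (k - 1))"
  have wB: "\<bar>\<Sum>i=1..n. w i * log_prime_ratio i\<bar> \<le> B" for n using B[of n] by (simp add: w_def f_def)
  have wW: "\<bar>w p\<bar> \<le> 1 + \<bar>\<alpha>\<bar>" for p
    by (cases "[p = j] (mod l)") (auto simp: w_def f_def abs_if)
  have "\<forall>s\<in>{..<k}. \<exists>C\<ge>0. \<forall>N\<ge>729. \<bar>ranked_prime_sum w s N\<bar> \<le> C * (real N * ln (ln (real N)) ^ k / ln (real N))"
  proof
    fix s assume "s \<in> {..<k}"
    hence s: "s \<le> k - 1" "1 \<le> k - 1" "Suc (k - 1) = k" using k by auto
    obtain C where "C \<ge> 0" "\<And>N. 729 \<le> N \<Longrightarrow>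
        \<bar>ranked_prime_sum w s N\<bar> \<le> C * (real N * ln (ln (real N)) ^ Suc (k - 1) / ln (real N))"
      using ranked_prime_sum_le[OF wB wW s(1,2)] by blast
    thus "\<exists>C\<ge>0. \<forall>N\<ge>729. \<bar>ranked_prime_sum w s N\<bar> \<le> C * (real N * ln (ln (real N)) ^ k / ln (real N))"
      unfolding s(3) by blast
  qed
  then obtain A where A: "\<And>s. s < k \<Longrightarrow> A s \<ge> 0"
    "\<And>s N. s < k \<Longrightarrow> N \<ge> 729 \<Longrightarrow> \<bar>ranked_prime_sum w s N\<bar> \<le> A s * (real N * ln (ln (real N)) ^ k / ln (real N))"
    unfolding bchoice_iff by (metis lessThan_iff)
  have "\<forall>s. \<exists>C\<ge>0. \<forall>N\<ge>27. real (card {m \<in> {1..N}. omega m = s}) \<le> C * (real N * ln (ln (real N)) ^ (s - 1) / ln (real N))"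
  proof
    fix s
    show "\<exists>C\<ge>0. \<forall>N\<ge>27. real (card {m \<in> {1..N}. omega m = s}) \<le> C * (real N * ln (ln (real N)) ^ (s - 1) / ln (real N))"
      using card_omega_le[where s = s] by blast
  qed
  then obtain D where D: "\<And>s. D s \<ge> 0"
    "\<And>s N. N \<ge> 27 \<Longrightarrow> real (card {m \<in> {1..N}. omega m = s}) \<le> D s * (real N * ln (ln (real N)) ^ (s - 1) / ln (real N))"
    by metis
  define E where "E = (\<Sum>s<k. \<bar>c s\<bar>)"
  define C where "C = (\<Sum>s<k. \<bar>c s\<bar> * A s) + \<bar>\<alpha>\<bar> * (E * (\<Sum>s<k. D s))"
  have E0: "E \<ge> 0" unfolding E_def by (intro sum_nonneg) auto
  have C0: "C \<ge> 0" unfolding C_def using A(1) D(1) E0 by (intro add_nonneg_nonneg mult_nonneg_nonneg sum_nonneg) auto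
  show ?thesis
  proof (rule that[OF C0])
    fix N :: nat assume N: "729 \<le> N"
    define G where "G = real N * ln (ln (real N)) ^ k / ln (real N)"
    have LL: "ln (ln (real N)) \<ge> 1" "ln (real N) \<ge> 3" using ln_ln_ge_1[of "real N"] N by auto
    have "(\<Sum>n | n \<in> {2..N} \<and> [smallest_prime_factor n = j] (mod l).
          \<mu> n * real (omega n) ^ (k - 1) * real (N div n)) =
        (\<Sum>n=2..N. \<mu> n * real (omega n) ^ (k - 1) * f (smallest_prime_factor n) * real (N div n))"
      by (intro sum.mono_neutral_cong_left) (auto simp: f_def)
    also have "\<dots> = (\<Sum>s<k. c s * ranked_prime_sum w s N) + \<alpha> * (\<Sum>m | m \<in> {1..N} \<and> omega m < k. \<Sum>s<omega m. c s)"
      unfolding c_def by (rule sum_duality_decomp[OF k]) (simp add: w_def)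
    finally have eq: "(\<Sum>n | n \<in> {2..N} \<and> [smallest_prime_factor n = j] (mod l).
          \<mu> n * real (omega n) ^ (k - 1) * real (N div n)) =
        (\<Sum>s<k. c s * ranked_prime_sum w s N) + \<alpha> * (\<Sum>m | m \<in> {1..N} \<and> omega m < k. \<Sum>s<omega m. c s)" .
    have "\<bar>(\<Sum>s<k. c s * ranked_prime_sum w s N) + \<alpha> * (\<Sum>m | m \<in> {1..N} \<and> omega m < k. \<Sum>s<omega m. c s)\<bar>
        \<le> \<bar>\<Sum>s<k. c s * ranked_prime_sum w s N\<bar> + \<bar>\<alpha>\<bar> * \<bar>\<Sum>m | m \<in> {1..N} \<and> omega m < k. \<Sum>s<omega m. c s\<bar>"
      unfolding abs_mult[symmetric] by (rule abs_triangle_ineq)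
    moreover have "\<bar>\<Sum>s<k. c s * ranked_prime_sum w s N\<bar> \<le> (\<Sum>s<k. \<bar>c s\<bar> * A s * G)"
    proof -
      have "\<bar>\<Sum>s<k. c s * ranked_prime_sum w s N\<bar> \<le> (\<Sum>s<k. \<bar>c s * ranked_prime_sum w s N\<bar>)" by (rule sum_abs)
      also have "\<dots> \<le> (\<Sum>s<k. \<bar>c s\<bar> * A s * G)"
      proof (intro sum_mono)
        fix s assume "s \<in> {..<k}"
        hence "\<bar>ranked_prime_sum w s N\<bar> \<le> A s * G" unfolding G_def using N by (intro A(2)) auto
        thus "\<bar>c s * ranked_prime_sum w s N\<bar> \<le> \<bar>c s\<bar> * A s * G"
          unfolding abs_mult mult.assoc by (intro mult_left_mono) auto
      qed
      finally show ?thesis .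
    qed
    \<comment> \<open>Every inner sum is at most \<open>E\<close> in absolute value. The bound of
      \<open>card_omega_le\<close> for each value \<open>s < k\<close> of \<open>omega m\<close> has
      the exponent \<open>s - 1\<close>, here enlarged to \<open>k\<close>.\<close>
    moreover have "\<bar>\<alpha>\<bar> * \<bar>\<Sum>m | m \<in> {1..N} \<and> omega m < k. \<Sum>s<omega m. c s\<bar> \<le> \<bar>\<alpha>\<bar> * (E * ((\<Sum>s<k. D s) * G))"
    proof -
      have "\<bar>\<Sum>m | m \<in> {1..N} \<and> omega m < k. \<Sum>s<omega m. c s\<bar>
          \<le> (\<Sum>m | m \<in> {1..N} \<and> omega m < k. \<bar>\<Sum>s<omega m. c s\<bar>)" by (rule sum_abs)
      also have "\<dots> \<le> (\<Sum>m | m \<in> {1..N} \<and> omega m < k. E)"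
      proof (intro sum_mono)
        fix m assume "m \<in> {m \<in> {1..N}. omega m < k}"
        hence "(\<Sum>s<omega m. \<bar>c s\<bar>) \<le> E" unfolding E_def by (intro sum_mono2) auto
        thus "\<bar>\<Sum>s<omega m. c s\<bar> \<le> E" using sum_abs[of c "{..<omega m}"] by linarith
      qed
      also have "\<dots> = E * real (card {m. m \<in> {1..N} \<and> omega m < k})" by simp
      also have "\<dots> \<le> E * ((\<Sum>s<k. D s) * G)"
      proof (intro mult_left_mono E0)
        have "real (card {m. m \<in> {1..N} \<and> omega m < k}) = (\<Sum>m | m \<in> {1..N} \<and> omega m < k. 1)" by simp
        also have "\<dots> = (\<Sum>s<k. \<Sum>m | m \<in> {m. m \<in> {1..N} \<and> omega m < k} \<and> omega m = s. 1)"
          by (intro sum.group[symmetric]) auto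
        also have "\<dots> \<le> (\<Sum>s<k. D s * G)"
        proof (intro sum_mono)
          fix s assume s: "s \<in> {..<k}"
          have "(\<Sum>m | m \<in> {m. m \<in> {1..N} \<and> omega m < k} \<and> omega m = s. 1) = real (card {m \<in> {1..N}. omega m = s})"
            using s by (simp, intro arg_cong[of _ _ card]) auto
          also have "\<dots> \<le> D s * (real N * ln (ln (real N)) ^ (s - 1) / ln (real N))" using N by (intro D(2)) simp
          also have "\<dots> \<le> D s * G" unfolding G_def
            using LL s D(1) by (intro mult_left_mono divide_right_mono power_increasing) auto
          finally show "(\<Sum>m | m \<in> {m. m \<in> {1..N} \<and> omega m < k} \<and> omega m = s. 1) \<le> D s * G" .
        qed
        finally show "real (card {m. m \<in> {1..N} \<and> omega m < k}) \<le> (\<Sum>s<k. D s) * G"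
          by (simp only: sum_distrib_right)
      qed
      finally show ?thesis by (intro mult_left_mono) auto
    qed
    moreover have "(\<Sum>s<k. \<bar>c s\<bar> * A s * G) + \<bar>\<alpha>\<bar> * (E * ((\<Sum>s<k. D s) * G)) = C * G"
      by (simp add: C_def distrib_right sum_distrib_right)
    ultimately show "\<bar>\<Sum>n | n \<in> {2..N} \<and> [smallest_prime_factor n = j] (mod l).
        \<mu> n * real (omega n) ^ (k - 1) * real (N div n)\<bar>
      \<le> C * (real N * ln (ln (real N)) ^ k / ln (real N))"
      unfolding eq G_def[symmetric] by linarith
  qed
qed

lemma sum_progression_real_le:
  assumes k: "k \<ge> 2" and l: "l > 0" "coprime j l"
  shows "\<exists>C\<ge>0. \<forall>\<^sub>F x::real in at_top.
    \<bar>\<Sum>n | 2 \<le> n \<and> real n \<le> x \<and> [smallest_prime_factor n = j] (mod l).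
        \<mu> n * real (omega n) ^ (k - 1) * real_of_int \<lfloor>x / real n\<rfloor>\<bar>
      \<le> C * (x * (ln (ln x)) ^ k / ln x)"
proof -
  obtain C where C: "C \<ge> 0" "\<And>N. 729 \<le> N \<Longrightarrow>
    \<bar>\<Sum>n | n \<in> {2..N} \<and> [smallest_prime_factor n = j] (mod l).
        \<mu> n * real (omega n) ^ (k - 1) * real (N div n)\<bar>
      \<le> C * (real N * ln (ln (real N)) ^ k / ln (real N))"
    using sum_progression_le[OF assms] by blast
  have "\<forall>\<^sub>F x::real in at_top.
    \<bar>\<Sum>n | 2 \<le> n \<and> real n \<le> x \<and> [smallest_prime_factor n = j] (mod l).
        \<mu> n * real (omega n) ^ (k - 1) * real_of_int \<lfloor>x / real n\<rfloor>\<bar>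
      \<le> (2 * C) * (x * (ln (ln x)) ^ k / ln x)"
    using eventually_ge_at_top[of "730::real"]
  proof eventually_elim
    case (elim x)
    define N where "N = nat \<lfloor>x\<rfloor>"
    have N: "729 \<le> N" "real N \<le> x" "x < real N + 1" using elim by (auto simp: N_def le_nat_iff le_floor_iff)
    have flx: "\<lfloor>x\<rfloor> = int N" using elim by (simp add: N_def)
    have "(\<Sum>n | 2 \<le> n \<and> real n \<le> x \<and> [smallest_prime_factor n = j] (mod l).
        \<mu> n * real (omega n) ^ (k - 1) * real_of_int \<lfloor>x / real n\<rfloor>) =
      (\<Sum>n | n \<in> {2..N} \<and> [smallest_prime_factor n = j] (mod l).
        \<mu> n * real (omega n) ^ (k - 1) * real (N div n))"
    proof (rule sum.cong)
      have "real n \<le> x \<longleftrightarrow> n \<le> N" for n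
        using elim by (auto simp: N_def le_nat_iff le_floor_iff)
      thus "{n. 2 \<le> n \<and> real n \<le> x \<and> [smallest_prime_factor n = j] (mod l)} =
          {n. n \<in> {2..N} \<and> [smallest_prime_factor n = j] (mod l)}" by auto
      fix n
      have "\<lfloor>x / real n\<rfloor> = \<lfloor>x / real_of_int (int n)\<rfloor>" by simp
      also have "\<dots> = int (N div n)" by (subst floor_divide_real_eq_div) (auto simp: flx zdiv_int)
      finally show "\<mu> n * real (omega n) ^ (k - 1) * real_of_int \<lfloor>x / real n\<rfloor> =
          \<mu> n * real (omega n) ^ (k - 1) * real (N div n)" by simp
    qed
    also have "\<bar>\<dots>\<bar> \<le> C * (real N * ln (ln (real N)) ^ k / ln (real N))" by (rule C(2)[OF N(1)])
    \<comment> \<open>From \<open>x < N + 1 <= N ^ 2\<close> follows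
      \<open>ln N >= ln x / 2\<close>, the source of the factor 2 in the constant.\<close>
    also have "\<dots> \<le> C * (x * (ln (ln x)) ^ k / (ln x / 2))"
    proof (intro mult_left_mono C(1) frac_le mult_mono power_mono)
      have lnN: "ln (real N) \<ge> 3" "ln (ln (real N)) \<ge> 1" using ln_ln_ge_1[of "real N"] N(1) by auto
      show lx: "ln x / 2 \<le> ln (real N)"
      proof -
        have "2 * real N \<le> real N * real N" using N(1) by (intro mult_right_mono) auto
        hence "x \<le> real N ^ 2" using N unfolding power2_eq_square by linarith
        hence "ln x \<le> ln (real N ^ 2)" using elim N by (subst ln_le_cancel_iff) auto
        thus ?thesis using N by (simp add: ln_realpow)
      qed
      have le: "ln (real N) \<le> ln x" using N by simp
      thus le2: "ln (ln (real N)) \<le> ln (ln x)" using lnN by (subst ln_le_cancel_iff) auto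
      show "0 \<le> ln (ln (real N))" "0 < ln x / 2" "0 \<le> x * ln (ln x) ^ k" "0 \<le> ln (ln (real N)) ^ k"
        using lnN le le2 elim by (auto intro!: mult_nonneg_nonneg zero_le_power)
    qed (use N elim in auto)
    also have "\<dots> = (2 * C) * (x * (ln (ln x)) ^ k / ln x)" by simp
    finally show ?case .
  qed
  thus ?thesis using C(1) by (intro exI[of _ "2 * C"]) simp
qed

theorem theorem6p3:
  fixes k l :: nat
  assumes "k \<ge> 4"
  shows "\<exists>C::real. \<forall>\<^sub>F x::real in at_top. \<forall>j::nat. 1 \<le> j \<and> j \<le> l \<and> coprime j l \<longrightarrow>
    \<bar>\<Sum>n | 2 \<le> n \<and> real n \<le> x \<and> [smallest_prime_factor n = j] (mod l).
        real_of_int (moebius_mu n) * real (omega n) ^ (k - 1) * real_of_int \<lfloor>x / real n\<rfloor>\<bar>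
      \<le> C * (x * (ln (ln x)) ^ k / ln x)"
proof -
  let ?S = "\<lambda>x j. \<Sum>n | 2 \<le> n \<and> real n \<le> x \<and> [smallest_prime_factor n = j] (mod l).
        \<mu> n * real (omega n) ^ (k - 1) * real_of_int \<lfloor>x / real n\<rfloor>"
  \<comment> \<open>The bound is to hold with one constant for all \<open>j\<close>: there are
    finitely many residues, so their constants can be added and their ranges of \<open>x\<close>
    intersected.\<close>
  define J where "J = {j. 1 \<le> j \<and> j \<le> l \<and> coprime j l}"
  have fin: "finite J" by (rule finite_subset[of _ "{..l}"]) (auto simp: J_def)
  have "\<forall>j\<in>J. \<exists>C\<ge>0. \<forall>\<^sub>F x::real in at_top. \<bar>?S x j\<bar> \<le> C * (x * (ln (ln x)) ^ k / ln x)"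
    using assms by (intro ballI sum_progression_real_le) (auto simp: J_def)
  from bchoice[OF this] obtain C where C: "\<forall>j\<in>J. C j \<ge> 0 \<and>
    (\<forall>\<^sub>F x::real in at_top. \<bar>?S x j\<bar> \<le> C j * (x * (ln (ln x)) ^ k / ln x))" by blast
  have "\<forall>\<^sub>F x::real in at_top. \<forall>j\<in>J. \<bar>?S x j\<bar> \<le> C j * (x * (ln (ln x)) ^ k / ln x)"
    using C fin by (intro eventually_ball_finite) blast+
  hence "\<forall>\<^sub>F x::real in at_top. \<forall>j. 1 \<le> j \<and> j \<le> l \<and> coprime j l \<longrightarrow>
      \<bar>?S x j\<bar> \<le> (\<Sum>j\<in>J. C j) * (x * (ln (ln x)) ^ k / ln x)"
    using eventually_ge_at_top[of "27::real"]
  proof eventually_elim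
    case (elim x)
    show ?case
    proof (intro allI impI)
      fix j assume "1 \<le> j \<and> j \<le> l \<and> coprime j l"
      hence j: "j \<in> J" by (simp add: J_def)
      have "\<bar>?S x j\<bar> \<le> C j * (x * (ln (ln x)) ^ k / ln x)" using elim(1) j by blast
      also have "\<dots> \<le> (\<Sum>j\<in>J. C j) * (x * (ln (ln x)) ^ k / ln x)"
      proof (intro mult_right_mono)
        show "C j \<le> (\<Sum>j\<in>J. C j)" using C fin j by (intro member_le_sum) blast+
        show "0 \<le> x * (ln (ln x)) ^ k / ln x" using ln_ln_ge_1[OF elim(2)] elim(2) by simp
      qed
      finally show "\<bar>?S x j\<bar> \<le> (\<Sum>j\<in>J. C j) * (x * (ln (ln x)) ^ k / ln x)" .
    qed
  qed
  thus ?thesis by blast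
qed

end
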